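(* Let $L>0$, and let $(\bar k_n)_{n\in\mathbb N}$ be positive integers with $\bar k_n\le C_0\log n/\log\log n$ for all $n\ge 3$, for some constant $C_0>0$. Let $\Pi=\Pi_n$ be priors satisfying conditions (P1), (P2), (P3) described in the context, with the constant $A$ in (P1) sufficiently large, i.e. $A\ge A_0$ for a suitable $A_0>0$ depending only on $L$ and the constants $c_4,\dots,c_7,\eta_0$ in (P2)–(P3). Then there is a (sufficiently large) constant $M'>0$, not depending on $n,k^\star,\gamma,\omega,\nu^\star$, such that for all sequences of positive integers $k^\star\le\bar k_n$ and reals $\gamma,\omega>0$ (all possibly depending on $n$) satisfying $$\gamma\omega>M'\max\{\bar\epsilon_{n,k^\star},\ \epsilon_{n,k^\star,k^\star,\gamma}\},$$ where $$\bar\epsilon_{n,k^\star}:=(k^\star)^{3/2}\Big(\frac{\log^2n}{n}\Big)^{\frac1{4k^\star-2}},\qquad \epsilon_{n,k^\star,k^\star,\gamma}:=(k^\star)^{\frac{2k^\star+3}{2}}\gamma^{-(2k^\star-2)}\Big(\frac{\log^2n}{n}\Big)^{\frac12},$$ one has $$\inf_{\nu^\star\in\mathcal M_{k^\star,k^\star,\gamma,\omega}}\mathsf P^{(n)}_{\nu^\star*\Phi}\Big[\Pi\big(\nu\in\mathcal M_{k^\star}\setminus\mathcal M_{k^\star-1}\,\big|\,X_{1:n}\big)\Big]\to1\quad(n\to\infty).$$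
   Context: Notation. $[k]:=\{1,\dots,k\}$, $\Delta_k:=\{w\in[0,1]^k:\sum_j w_j=1\}$. For $k\in\mathbb N$, $\mathcal M_k$ is the set of distributions $\sum_{j=1}^k w_j\delta_{\theta_j}$ with $(w_1,\dots,w_k)\in\Delta_k$, $\theta_1,\dots,\theta_k\in[-L,L]$; $\mathcal M_0:=\emptyset$; $\mathcal M:=\bigcup_{k\in\mathbb N}\mathcal M_k$. For $\nu=\sum_j w_j\delta_{\theta_j}$, $\nu*\Phi$ is the Gaussian mixture $\sum_j w_j\,\mathrm N(\theta_j,1)$. $\mathsf P_G^{(n)}$ denotes probability or expectation when $X_1,\dots,X_n$ are i.i.d. from $G$, and $p_G^{(n)}$ is the joint Lebesgue density; $X_{1:n}=(X_1,\dots,X_n)$. Separation. An atomic distribution $\nu=\sum_{j=1}^kw_j\delta_{\theta_j}$ is $k_0$ $(\gamma,\omega)$-separated ($k_0\in[k]$, $\gamma,\omega>0$) if there is a partition $S_1,\dots,S_{k_0}$ of $[k]$ such that $|\theta_j-\theta_{j'}|\ge\gamma$ for all $j\in S_l$, $j'\in S_{l'}$, $l\ne l'$, and $\sum_{j\in S_l}w_j\ge\omega$ for all $l\in[k_0]$. $\mathcal M_{k,k_0,\gamma,\omega}$ is the set of $\nu\in\mathcal M_k$ that are $k_0$ $(\gamma,\omega)$-separated. Prior and posterior. For each $n$, the prior $\Pi=\Pi_n$ on $\mathcal M$ is generated by drawing $k\in\mathbb N$ from $\Pi(k)$ and then, given $k$, independently drawing $\theta\in[-L,L]^k$ from $\Pi(\theta|k)$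 and $w\in\Delta_k$ from $\Pi(w|k)$, and setting $\nu=\sum_{j=1}^k w_j\delta_{\theta_j}$. The posterior is $\Pi(\mathrm d\nu|X_{1:n})=p^{(n)}_{\nu*\Phi}(X_{1:n})\Pi(\mathrm d\nu)/\int p^{(n)}_{\nu*\Phi}(X_{1:n})\Pi(\mathrm d\nu)$. Conditions on the prior (all constants are independent of $n,k,w^0,\theta^0$): (P1) There are $c_1>0$, $A>0$ such that for all $n\in\mathbb N$, $k^\circ\in\mathbb N$: $\Pi(k=k^\circ+1)\le c_1e^{-A\bar k_n\log n}\,\Pi(k=k^\circ)$; and there are $c_2,c_3>0$ such that for all $n$ and all $k^\dagger\in[\bar k_n]$: $\Pi(k=k^\dagger)\ge c_2e^{-(c_3\bar k_n\log n)k^\dagger}$. (P2) There are $c_4,c_5>0$ such that for all $k\in\mathbb N$, $w^0\in\Delta_k$, $\eta\in(0,1/k)$: $\Pi(\sum_{j=1}^k|w_j-w_j^0|\le\eta\,|\,k)\ge c_4\eta^{c_5k}$. (P3) There are $c_6,c_7>0$ and $\eta_0\in(0,1)$ such that for all $k\in\mathbb N$, $\theta^0\in[-L,L]^k$, $\eta\in(0,\eta_0)$: $\Pi(\max_{1\le j\le k}|\theta_j-\theta_j^0|\le\eta\,|\,k)\ge c_6\eta^{c_7k}$. *)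

theory Defs
  imports "HOL-Probability.Probability"
begin

section \<open>Atomic distributions and Gaussian mixtures\<close>

text \<open>Weight and location vectors of length \<open>k\<close> are extensional functions on \<open>{1..k}\<close>.
  Note that \<open>weights 0\<close> is empty, because an empty sum is not \<open>1\<close>.\<close>

definition weights :: "nat \<Rightarrow> (nat \<Rightarrow> real) set" where
  "weights k = {w \<in> {1..k} \<rightarrow>\<^sub>E {0..1}. (\<Sum>j\<in>{1..k}. w j) = 1}"

definition locations :: "real \<Rightarrow> nat \<Rightarrow> (nat \<Rightarrow> real) set" where
  "locations L k = {1..k} \<rightarrow>\<^sub>E {- L..L}"

text \<open>The distribution \<open>\<Sum>j\<in>{1..k}. w j \<cdot> \<delta>(\<theta> j)\<close>, as the image of the measure on the indices
  with point masses \<open>w j\<close>; see \<open>emeasure_atomic\<close> below.\<close>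

definition atomic :: "nat \<Rightarrow> (nat \<Rightarrow> real) \<Rightarrow> (nat \<Rightarrow> real) \<Rightarrow> real measure" where
  "atomic k w \<theta> = distr (point_measure {1..k} (\<lambda>j. ennreal (w j))) borel \<theta>"

text \<open>Weights may vanish and locations may coincide, so \<open>mixing L k\<close> is increasing in \<open>k\<close>.
  Moreover \<open>mixing L 0 = {}\<close>.\<close>

definition mixing :: "real \<Rightarrow> nat \<Rightarrow> real measure set" where
  "mixing L k = {atomic k w \<theta> | w \<theta>. w \<in> weights k \<and> \<theta> \<in> locations L k}"

definition separated ::
  "nat \<Rightarrow> nat \<Rightarrow> real \<Rightarrow> real \<Rightarrow> (nat \<Rightarrow> real) \<Rightarrow> (nat \<Rightarrow> real) \<Rightarrow> bool" where
  "separated k k0 \<gamma> \<omega> w \<theta> \<longleftrightarrow>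
    (\<exists>P. partition_on {1..k} P \<and> card P = k0 \<and>
      (\<forall>S\<in>P. \<forall>S'\<in>P. S \<noteq> S' \<longrightarrow> (\<forall>j\<in>S. \<forall>j'\<in>S'. \<gamma> \<le> \<bar>\<theta> j - \<theta> j'\<bar>)) \<and>
      (\<forall>S\<in>P. \<omega> \<le> (\<Sum>j\<in>S. w j)))"

definition mixing_sep :: "real \<Rightarrow> nat \<Rightarrow> nat \<Rightarrow> real \<Rightarrow> real \<Rightarrow> real measure set" where
  "mixing_sep L k k0 \<gamma> \<omega> =
    {atomic k w \<theta> | w \<theta>. w \<in> weights k \<and> \<theta> \<in> locations L k \<and> separated k k0 \<gamma> \<omega> w \<theta>}"

definition gauss_mixture :: "real measure \<Rightarrow> real measure" where
  "gauss_mixture \<nu> = (\<nu> \<star> density lborel std_normal_density)"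

text \<open>The Lebesgue density of the mixture; see \<open>gauss_mixture_density\<close> below.\<close>

definition mixture_density :: "real measure \<Rightarrow> real \<Rightarrow> ennreal" where
  "mixture_density \<nu> y = (\<integral>\<^sup>+ t. ennreal (normal_density t 1 y) \<partial>\<nu>)"

definition joint_density :: "nat \<Rightarrow> real measure \<Rightarrow> (nat \<Rightarrow> real) \<Rightarrow> ennreal" where
  "joint_density n \<nu> x = (\<Prod>i\<in>{1..n}. mixture_density \<nu> (x i))"

definition sample :: "nat \<Rightarrow> real measure \<Rightarrow> (nat \<Rightarrow> real) measure" where
  "sample n G = (\<Pi>\<^sub>M i\<in>{1..n}. G)"


section \<open>Prior and posterior\<close>

definition weight_space :: "nat \<Rightarrow> (nat \<Rightarrow> real) measure" where
  "weight_space k = restrict_space (\<Pi>\<^sub>M j\<in>{1..k}. borel) (weights k)"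

definition location_space :: "real \<Rightarrow> nat \<Rightarrow> (nat \<Rightarrow> real) measure" where
  "location_space L k = restrict_space (\<Pi>\<^sub>M j\<in>{1..k}. borel) (locations L k)"

text \<open>The set of all finitely supported distributions on \<open>[-L, L]\<close>, with the trace of the
  \<open>\<sigma>\<close>-algebra generated by the evaluations \<open>\<nu> \<mapsto> \<nu>(B)\<close>, \<open>B\<close> Borel.\<close>

definition mixing_space :: "real \<Rightarrow> real measure measure" where
  "mixing_space L = restrict_space (prob_algebra borel) (\<Union>k\<in>{1..}. mixing L k)"

text \<open>The ingredients of a prior: \<open>K\<close> is the distribution of the number of components, a
  probability measure on the positive integers; \<open>W k\<close> and \<open>T k\<close> are the conditional distributions
  of the weights and of the locations given \<open>k\<close>.\<close>

definition prior_data ::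
  "real \<Rightarrow> nat measure \<Rightarrow> (nat \<Rightarrow> (nat \<Rightarrow> real) measure) \<Rightarrow> (nat \<Rightarrow> (nat \<Rightarrow> real) measure) \<Rightarrow> bool"
  where
  "prior_data L K W T \<longleftrightarrow>
    K \<in> space (prob_algebra (count_space {1..})) \<and>
    (\<forall>k\<ge>1. W k \<in> space (prob_algebra (weight_space k))) \<and>
    (\<forall>k\<ge>1. T k \<in> space (prob_algebra (location_space L k)))"

definition prior ::
  "real \<Rightarrow> nat measure \<Rightarrow> (nat \<Rightarrow> (nat \<Rightarrow> real) measure) \<Rightarrow> (nat \<Rightarrow> (nat \<Rightarrow> real) measure)
    \<Rightarrow> real measure measure" where
  "prior L K W T =
    K \<bind> (\<lambda>k. distr (W k \<Otimes>\<^sub>M T k) (mixing_space L) (\<lambda>(w, \<theta>). atomic k w \<theta>))"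

definition posterior :: "nat \<Rightarrow> real measure measure \<Rightarrow> (nat \<Rightarrow> real) \<Rightarrow> real measure measure" where
  "posterior n Q x =
    density Q (\<lambda>\<nu>. joint_density n \<nu> x / (\<integral>\<^sup>+ \<nu>'. joint_density n \<nu>' x \<partial>Q))"


section \<open>Conditions on the prior\<close>

text \<open>In all three conditions, the first argument of \<open>K\<close>, \<open>W\<close>, \<open>T\<close> is the sample size.\<close>

definition P1 :: "(nat \<Rightarrow> nat) \<Rightarrow> (nat \<Rightarrow> nat measure) \<Rightarrow> real \<Rightarrow> real \<Rightarrow> real \<Rightarrow> real \<Rightarrow> bool" where
  "P1 kbar K c1 A c2 c3 \<longleftrightarrow>
    (\<forall>n\<ge>1. \<forall>k\<ge>1. measure (K n) {k + 1}
        \<le> c1 * exp (- A * real (kbar n) * ln (real n)) * measure (K n) {k}) \<and>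
    (\<forall>n\<ge>1. \<forall>k\<in>{1..kbar n}. measure (K n) {k}
        \<ge> c2 * exp (- (c3 * real (kbar n) * ln (real n)) * real k))"

definition P2 :: "(nat \<Rightarrow> nat \<Rightarrow> (nat \<Rightarrow> real) measure) \<Rightarrow> real \<Rightarrow> real \<Rightarrow> bool" where
  "P2 W c4 c5 \<longleftrightarrow>
    (\<forall>n\<ge>1. \<forall>k\<ge>1. \<forall>w0\<in>weights k. \<forall>\<eta>\<in>{0<..<1 / real k}.
      measure (W n k) {w \<in> space (W n k). (\<Sum>j\<in>{1..k}. \<bar>w j - w0 j\<bar>) \<le> \<eta>}
        \<ge> c4 * \<eta> powr (c5 * real k))"

definition P3 ::
  "real \<Rightarrow> (nat \<Rightarrow> nat \<Rightarrow> (nat \<Rightarrow> real) measure) \<Rightarrow> real \<Rightarrow> real \<Rightarrow> real \<Rightarrow> bool" where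
  "P3 L T c6 c7 \<eta>0 \<longleftrightarrow>
    (\<forall>n\<ge>1. \<forall>k\<ge>1. \<forall>\<theta>0\<in>locations L k. \<forall>\<eta>\<in>{0<..<\<eta>0}.
      measure (T n k) {\<theta> \<in> space (T n k). (MAX j\<in>{1..k}. \<bar>\<theta> j - \<theta>0 j\<bar>) \<le> \<eta>}
        \<ge> c6 * \<eta> powr (c7 * real k))"


section \<open>Rates\<close>

definition eps_bar :: "nat \<Rightarrow> nat \<Rightarrow> real" where
  "eps_bar n k = real k powr (3 / 2) * ((ln (real n))\<^sup>2 / real n) powr (1 / (4 * real k - 2))"

definition eps_sep :: "nat \<Rightarrow> nat \<Rightarrow> real \<Rightarrow> real" where
  "eps_sep n k \<gamma> =
    real k powr ((2 * real k + 3) / 2) * \<gamma> powr (- (2 * real k - 2))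
      * ((ln (real n))\<^sup>2 / real n) powr (1 / 2)"


section \<open>Basic facts\<close>

lemma emeasure_atomic:
  assumes "A \<in> sets borel"
  shows "emeasure (atomic k w \<theta>) A = (\<Sum>j\<in>{1..k}. ennreal (w j) * indicator A (\<theta> j))"
proof -
  have "emeasure (atomic k w \<theta>) A
      = emeasure (point_measure {1..k} (\<lambda>j. ennreal (w j))) (\<theta> -` A \<inter> {1..k})"
    using assms by (simp add: atomic_def emeasure_distr space_point_measure)
  also have "\<dots> = (\<Sum>j\<in>\<theta> -` A \<inter> {1..k}. ennreal (w j))"
    by (subst emeasure_point_measure_finite) auto
  also have "\<dots> = (\<Sum>j\<in>{1..k}. ennreal (w j) * indicator A (\<theta> j))"
    by (intro sum.mono_neutral_cong_left) (auto simp: indicator_def)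
  finally show ?thesis .
qed

lemma sets_atomic [simp]: "sets (atomic k w \<theta>) = sets borel"
  by (simp add: atomic_def)

lemma prob_space_atomic:
  assumes "w \<in> weights k"
  shows "prob_space (atomic k w \<theta>)"
proof
  have "(\<Sum>j\<in>{1..k}. ennreal (w j)) = ennreal (\<Sum>j\<in>{1..k}. w j)"
    using assms by (intro sum_ennreal) (auto simp: weights_def PiE_def Pi_def)
  then show "emeasure (atomic k w \<theta>) (space (atomic k w \<theta>)) = 1"
    using assms emeasure_atomic[of UNIV k w \<theta>] by (simp add: weights_def atomic_def)
qed

lemma gauss_mixture_density:
  assumes "prob_space \<nu>" and sets [measurable_cong]: "sets \<nu> = sets borel"
  shows "gauss_mixture \<nu> = density lborel (mixture_density \<nu>)"
proof (rule measure_eqI)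
  interpret \<nu>: prob_space \<nu> by fact
  interpret N: prob_space "density lborel std_normal_density"
    by (rule prob_space_normal_density) simp
  interpret pair_sigma_finite \<nu> lborel ..
  fix A assume "A \<in> sets (gauss_mixture \<nu>)"
  then have A [measurable]: "A \<in> sets borel" by (simp add: gauss_mixture_def)
  have [measurable]: "(\<lambda>(t, y). ennreal (normal_density t 1 y)) \<in> borel_measurable (\<nu> \<Otimes>\<^sub>M lborel)"
    unfolding normal_density_def by measurable
  have [measurable]: "mixture_density \<nu> \<in> borel_measurable lborel"
    unfolding mixture_density_def normal_density_def by measurable
  have shift: "(\<integral>\<^sup>+ y. ennreal (std_normal_density y) * indicator A (t + y) \<partial>lborel)
      = (\<integral>\<^sup>+ y. ennreal (normal_density t 1 y) * indicator A y \<partial>lborel)" for t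
    by (subst nn_integral_real_affine[where c=1 and t="- t"])
      (auto simp: normal_density_def power2_commute intro!: nn_integral_cong)
  have "emeasure (gauss_mixture \<nu>) A
      = (\<integral>\<^sup>+ t. \<integral>\<^sup>+ y. indicator A (t + y) \<partial>density lborel std_normal_density \<partial>\<nu>)"
    unfolding gauss_mixture_def
    by (rule convolution_emeasure') (auto simp: sets \<nu>.finite_measure_axioms N.finite_measure_axioms)
  also have "\<dots> = (\<integral>\<^sup>+ t. \<integral>\<^sup>+ y. ennreal (normal_density t 1 y) * indicator A y \<partial>lborel \<partial>\<nu>)"
    by (intro nn_integral_cong) (simp add: nn_integral_density shift)
  also have "\<dots> = (\<integral>\<^sup>+ y. \<integral>\<^sup>+ t. ennreal (normal_density t 1 y) * indicator A y \<partial>\<nu> \<partial>lborel)"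
    by (rule Fubini'[symmetric]) measurable
  also have "\<dots> = (\<integral>\<^sup>+ y. mixture_density \<nu> y * indicator A y \<partial>lborel)"
    unfolding mixture_density_def normal_density_def
    by (intro nn_integral_cong nn_integral_multc) measurable
  also have "\<dots> = emeasure (density lborel (mixture_density \<nu>)) A"
    by (simp add: emeasure_density)
  finally show "emeasure (gauss_mixture \<nu>) A = emeasure (density lborel (mixture_density \<nu>)) A" .
qed (simp add: gauss_mixture_def)

lemma measurable_atomic:
  assumes "k \<ge> 1"
  shows "(\<lambda>(w, \<theta>). atomic k w \<theta>) \<in> weight_space k \<Otimes>\<^sub>M location_space L k \<rightarrow>\<^sub>M mixing_space L"
proof -
  let ?M = "weight_space k \<Otimes>\<^sub>M location_space L k"
  have sp: "space ?M = weights k \<times> locations L k"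
    by (auto simp: space_pair_measure weight_space_def location_space_def space_restrict_space
        space_PiM weights_def locations_def)
  have w [measurable]: "(\<lambda>p. fst p j) \<in> borel_measurable ?M" if "j \<in> {1..k}" for j
    unfolding weight_space_def
    by (rule measurable_compose[OF measurable_fst])
      (rule measurable_restrict_space1, rule measurable_component_singleton, fact)
  have t [measurable]: "(\<lambda>p. snd p j) \<in> borel_measurable ?M" if "j \<in> {1..k}" for j
    unfolding location_space_def
    by (rule measurable_compose[OF measurable_snd])
      (rule measurable_restrict_space1, rule measurable_component_singleton, fact)
  have "(\<lambda>p. atomic k (fst p) (snd p)) \<in> ?M \<rightarrow>\<^sub>M prob_algebra borel"
  proof (rule measurable_prob_algebraI)
    show "(\<lambda>p. atomic k (fst p) (snd p)) \<in> ?M \<rightarrow>\<^sub>M subprob_algebra borel"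
    proof (rule measurable_subprob_algebra)
      fix A :: "real set" assume [measurable]: "A \<in> sets borel"
      show "(\<lambda>p. emeasure (atomic k (fst p) (snd p)) A) \<in> borel_measurable ?M"
        by (subst emeasure_atomic) measurable
    qed (auto simp: sp intro!: prob_space_imp_subprob_space prob_space_atomic)
  qed (auto simp: sp intro!: prob_space_atomic)
  then show ?thesis
    unfolding mixing_space_def using assms
    by (intro measurable_restrict_space2)
      (auto simp: sp mixing_def case_prod_beta' intro!: bexI[of _ k], blast)
qed

lemma prior_in_prob_algebra:
  assumes "prior_data L K W T"
  shows "prior L K W T \<in> space (prob_algebra (mixing_space L))"
proof -
  have W: "W k \<in> space (prob_algebra (weight_space k))"
    and T: "T k \<in> space (prob_algebra (location_space L k))" if "k \<ge> 1" for k
    using assms that by (auto simp: prior_data_def)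
  have "distr (W k \<Otimes>\<^sub>M T k) (mixing_space L) (\<lambda>(w, \<theta>). atomic k w \<theta>)
      \<in> space (prob_algebra (mixing_space L))" if k: "k \<ge> 1" for k
  proof -
    interpret W: prob_space "W k" using W[OF k] by (simp add: space_prob_algebra)
    interpret T: prob_space "T k" using T[OF k] by (simp add: space_prob_algebra)
    interpret pair_prob_space "W k" "T k" ..
    have "sets (W k \<Otimes>\<^sub>M T k) = sets (weight_space k \<Otimes>\<^sub>M location_space L k)"
      using W[OF k] T[OF k] by (intro sets_pair_measure_cong) (auto simp: space_prob_algebra)
    then have "(\<lambda>(w, \<theta>). atomic k w \<theta>) \<in> W k \<Otimes>\<^sub>M T k \<rightarrow>\<^sub>M mixing_space L"
      using measurable_atomic[OF k] by (simp cong: measurable_cong_sets)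
    then show ?thesis by (auto simp: space_prob_algebra intro!: prob_space_distr)
  qed
  then have "(\<lambda>k. distr (W k \<Otimes>\<^sub>M T k) (mixing_space L) (\<lambda>(w, \<theta>). atomic k w \<theta>))
      \<in> count_space {1..} \<rightarrow>\<^sub>M prob_algebra (mixing_space L)"
    by auto
  moreover have "K \<in> space (prob_algebra (count_space {1..}))"
    using assms by (simp add: prior_data_def)
  ultimately show ?thesis
    unfolding prior_def
    using measurable_space[OF measurable_bind_prob_space[OF measurable_ident_sets[OF refl]]] by blast
qed

end

theory Submission
  imports Defs "HOL-Real_Asymp.Real_Asymp"
begin

text \<open>
  Replace the true density of the sample by the average of the densities \<open>p\<^sub>\<nu>\<close> over the prior
  restricted to \<open>k\<close> components within distance \<open>n\<^sup>-\<^sup>2\<close> of the truth; this costs \<open>O(1/n)\<close> in total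
  variation. Under this average the posterior mass of a set \<open>C\<close> is on average at most
  \<open>\<Pi>(C) / b\<close>, where \<open>b\<close> is the prior mass of the neighbourhood. For \<open>C\<close> the distributions with more
  than \<open>k\<close> atoms, the geometric decay of the prior on the number of components makes this \<open>O(1/n)\<close>.

  For \<open>C\<close> the distributions with fewer than \<open>k\<close> atoms a test is needed. If \<open>\<nu>\<close> has atoms
  \<open>r\<^sub>1, \<dots>, r\<^sub>k\<^sub>-\<^sub>1\<close>, the trigonometric polynomial \<open>\<Prod>\<^sub>j \<bar>exp(iut) - exp(iur\<^sub>j)\<bar>\<^sup>2\<close> has \<open>\<nu>\<close>-integral zero, while
  by the pigeonhole principle one of the \<open>k\<close> separated atoms of the truth is far from all its
  zeros. Hence the two Gaussian mixtures differ noticeably in the characteristic function at one of the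
  frequencies \<open>um\<close>, \<open>\<bar>m\<bar> < k\<close>, and Hoeffding's inequality for the empirical cosines and sines gives a
  test that works for all \<open>\<nu>\<close> at once. With \<open>u\<close> of order \<open>k\<^sup>-\<^sup>1\<^sup>/\<^sup>2\<close>, the condition on \<open>\<gamma>\<omega>\<close> makes its error
  probabilities small compared with \<open>b\<close>.
\<close>

section \<open>Densities of samples\<close>

text \<open>Prior mass alone cannot exclude too few atoms: by (P1) each smaller number of components
  is favoured by a factor that grows with n. Hence a test is used on that side only.

  Averaging over a neighbourhood avoids bounding the marginal likelihood from below outside an
  exceptional event. All estimates are inequalities between expectations with explicit constants, so
  uniformity in the truth is automatic.

  The constants are dictated by \<open>b\<close>. With radius n^-2, (P2) and (P3) give b at least a
  constant times Pi(k) n^(-2 (c5 + c7) k). On the side of too many atoms Pi(k) cancels, and A \<ge>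
  2 (c5 + c7) + 1 leaves a factor 1/n. On the other side only Pi(k) \<ge> c2 exp(-c3 kbar k log n)
  is available; since kbar = O(log n), 1/b may be as large as exp(O(k log^2 n)). So the test
  threshold is taken of order k log n / sqrt n, which is where log^2 n / n in the rate is consumed.
  The test separates at a scale of order omega exp(-k/2) (c gamma / sqrt k)^(2k-2), to be compared
  with the (2k-1)-th power of the rate.\<close>

lemma PiM_density:
  assumes "sigma_finite_measure M" and f [measurable]: "f \<in> borel_measurable M"
    and "sigma_finite_measure (density M f)" and I: "finite I"
  shows "(\<Pi>\<^sub>M i\<in>I. density M f) = density (\<Pi>\<^sub>M i\<in>I. M) (\<lambda>x. \<Prod>i\<in>I. f (x i))"
proof -
  interpret M: product_sigma_finite "\<lambda>_. M" using assms by (simp add: product_sigma_finite_def)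
  interpret D: product_sigma_finite "\<lambda>_. density M f" using assms by (simp add: product_sigma_finite_def)
  show ?thesis
  proof (rule D.PiM_eqI[OF I, symmetric])
    show "sets (density (\<Pi>\<^sub>M i\<in>I. M) (\<lambda>x. \<Prod>i\<in>I. f (x i))) = sets (\<Pi>\<^sub>M i\<in>I. density M f)"
      by (simp cong: sets_PiM_cong)
    fix A assume "\<And>i. i \<in> I \<Longrightarrow> A i \<in> sets (density M f)"
    then have A [measurable]: "\<And>i. i \<in> I \<Longrightarrow> A i \<in> sets M" by simp
    have [measurable]: "Pi\<^sub>E I A \<in> sets (\<Pi>\<^sub>M i\<in>I. M)"
      using A I by (intro sets_PiM_I_finite)
    have "emeasure (density (\<Pi>\<^sub>M i\<in>I. M) (\<lambda>x. \<Prod>i\<in>I. f (x i))) (Pi\<^sub>E I A)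
        = (\<integral>\<^sup>+ x. (\<Prod>i\<in>I. f (x i)) * indicator (Pi\<^sub>E I A) x \<partial>(\<Pi>\<^sub>M i\<in>I. M))"
      by (rule emeasure_density) measurable
    also have "\<dots> = (\<integral>\<^sup>+ x. (\<Prod>i\<in>I. f (x i) * indicator (A i) (x i)) \<partial>(\<Pi>\<^sub>M i\<in>I. M))"
    proof (rule nn_integral_cong)
      fix x assume "x \<in> space (\<Pi>\<^sub>M i\<in>I. M)"
      then have "indicator (Pi\<^sub>E I A) x = (\<Prod>i\<in>I. indicator (A i) (x i) :: ennreal)"
        using I by (auto simp: indicator_def space_PiM PiE_iff prod_zero_iff)
      then show "(\<Prod>i\<in>I. f (x i)) * indicator (Pi\<^sub>E I A) x = (\<Prod>i\<in>I. f (x i) * indicator (A i) (x i))"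
        by (simp add: prod.distrib)
    qed
    also have "\<dots> = (\<Prod>i\<in>I. \<integral>\<^sup>+ y. f y * indicator (A i) y \<partial>M)"
      using I A by (intro M.product_nn_integral_prod) auto
    also have "\<dots> = (\<Prod>i\<in>I. emeasure (density M f) (A i))"
      using A by (intro prod.cong refl emeasure_density[symmetric]) auto
    finally show "emeasure (density (\<Pi>\<^sub>M i\<in>I. M) (\<lambda>x. \<Prod>i\<in>I. f (x i))) (Pi\<^sub>E I A)
      = (\<Prod>i\<in>I. emeasure (density M f) (A i))" .
  qed
qed

lemma measurable_mixture_density:
  assumes "sets \<nu> = sets borel" "prob_space \<nu>"
  shows "mixture_density \<nu> \<in> borel_measurable borel"
proof -
  interpret prob_space \<nu> by fact
  note assms(1)[measurable_cong]
  show ?thesis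
    unfolding mixture_density_def normal_density_def by measurable
qed

lemma sigma_finite_lborel_PiM: "sigma_finite_measure (\<Pi>\<^sub>M i\<in>{1..n::nat}. (lborel :: real measure))"
proof -
  interpret product_sigma_finite "\<lambda>_. lborel :: real measure"
    by (simp add: product_sigma_finite_def lborel.sigma_finite_measure_axioms)
  show ?thesis by (rule sigma_finite) simp
qed

lemma prob_space_gauss_mixture:
  assumes "prob_space \<nu>" and "sets \<nu> = sets borel"
  shows "prob_space (gauss_mixture \<nu>)"
proof -
  interpret \<nu>: prob_space \<nu> by fact
  interpret N: prob_space "density lborel std_normal_density"
    by (rule prob_space_normal_density) simp
  interpret pair_prob_space \<nu> "density lborel std_normal_density" ..
  show ?thesis
    unfolding gauss_mixture_def convolution_def using assms(2)
    by (intro prob_space_distr) (simp cong: measurable_cong_sets)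
qed

lemma sets_gauss_mixture [simp]: "sets (gauss_mixture \<nu>) = sets borel"
  by (simp add: gauss_mixture_def)

lemma sample_gauss_mixture:
  assumes "prob_space \<nu>" and "sets \<nu> = sets borel"
  shows "sample n (gauss_mixture \<nu>) = density (\<Pi>\<^sub>M i\<in>{1..n}. lborel) (joint_density n \<nu>)"
proof -
  have "sigma_finite_measure (density lborel (mixture_density \<nu>))"
    using prob_space_gauss_mixture[OF assms] prob_space_imp_sigma_finite
    by (simp add: gauss_mixture_density[OF assms])
  then show ?thesis
    unfolding sample_def gauss_mixture_density[OF assms] joint_density_def
    using measurable_mixture_density[OF assms(2,1)]
    by (subst PiM_density) (auto simp: lborel.sigma_finite_measure_axioms)
qed

lemma prob_space_sample:
  assumes "prob_space \<nu>" and "sets \<nu> = sets borel"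
  shows "prob_space (sample n (gauss_mixture \<nu>))"
  unfolding sample_def using prob_space_gauss_mixture[OF assms] by (intro prob_space_PiM)

lemma mixing_spaceD:
  assumes "\<nu> \<in> space (mixing_space L)"
  shows "prob_space \<nu>" "sets \<nu> = sets borel"
  using assms by (auto simp: mixing_space_def space_restrict_space space_prob_algebra)

lemma mixing_in_prob_algebra:
  assumes "\<nu> \<in> mixing L k"
  shows "\<nu> \<in> space (prob_algebra borel)"
  using assms by (auto simp: mixing_def space_prob_algebra prob_space_atomic)

text \<open>Joint measurability in the mixing distribution and the sample is what allows Fubini
  between prior and sample. It rests on the sigma-algebra of \<open>mixing_space\<close> being
  generated by evaluations, which makes integration against a varying measure measurable.\<close>

lemma measurable_joint_density:
  "(\<lambda>(\<nu>, x). joint_density n \<nu> x) \<in> borel_measurable (mixing_space L \<Otimes>\<^sub>M (\<Pi>\<^sub>M i\<in>{1..n}. lborel))"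
proof -
  have id: "(\<lambda>\<nu>. \<nu>) \<in> mixing_space L \<rightarrow>\<^sub>M prob_algebra borel"
    unfolding mixing_space_def by (rule measurable_restrict_space1) simp
  have "(\<lambda>p. \<integral>\<^sup>+ t. ennreal (normal_density t 1 (snd p)) \<partial>fst p)
      \<in> borel_measurable (mixing_space L \<Otimes>\<^sub>M borel)"
  proof (rule nn_integral_measurable_subprob_algebra2)
    show "(\<lambda>(p, t). ennreal (normal_density t 1 (snd p)))
        \<in> borel_measurable ((mixing_space L \<Otimes>\<^sub>M borel) \<Otimes>\<^sub>M borel)"
      unfolding normal_density_def by measurable
    show "fst \<in> mixing_space L \<Otimes>\<^sub>M borel \<rightarrow>\<^sub>M subprob_algebra borel"
      by (rule measurable_compose[OF measurable_fst measurable_prob_algebraD[OF id]])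
  qed
  then have *: "(\<lambda>p. mixture_density (fst p) (snd p)) \<in> borel_measurable (mixing_space L \<Otimes>\<^sub>M borel)"
    unfolding mixture_density_def .
  have "(\<lambda>p. mixture_density (fst p) (snd p i))
      \<in> borel_measurable (mixing_space L \<Otimes>\<^sub>M (\<Pi>\<^sub>M i\<in>{1..n}. lborel))" if "i \<in> {1..n}" for i
  proof -
    have "(\<lambda>p. (fst p, snd p i)) \<in> mixing_space L \<Otimes>\<^sub>M (\<Pi>\<^sub>M i\<in>{1..n}. lborel) \<rightarrow>\<^sub>M mixing_space L \<Otimes>\<^sub>M borel"
      using that by measurable
    from measurable_compose[OF this *] show ?thesis by simp
  qed
  then show ?thesis
    unfolding joint_density_def case_prod_beta' by (intro borel_measurable_prod_ennreal)
qed

text \<open>Positivity keeps the denominator of the posterior away from 0, and the upper bound keeps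
  it finite; both are needed for division and subtraction in \<open>ennreal\<close> to behave as
  usual.\<close>

lemma mixture_density_bounds:
  assumes "prob_space \<nu>" and [measurable_cong]: "sets \<nu> = sets borel"
  shows "0 < mixture_density \<nu> y" "mixture_density \<nu> y \<le> 1"
proof -
  interpret prob_space \<nu> by fact
  have "normal_density t 1 y \<le> 1" for t
  proof -
    have "1 \<le> sqrt (2 * pi)" using pi_ge_two by (intro real_le_rsqrt) auto
    then have "exp (-((y - t)\<^sup>2 / 2)) \<le> 1 * sqrt (2 * pi)"
      by (smt (verit) exp_le_one_iff zero_le_power2 divide_nonneg_pos)
    then show ?thesis unfolding normal_density_def
      by (simp add: field_simps)
  qed
  then have "mixture_density \<nu> y \<le> (\<integral>\<^sup>+ t. 1 \<partial>\<nu>)"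
    unfolding mixture_density_def by (intro nn_integral_mono) simp
  then show "mixture_density \<nu> y \<le> 1" by (simp add: emeasure_space_1)
  have m: "(\<lambda>t. ennreal (normal_density t 1 y)) \<in> borel_measurable \<nu>"
    unfolding normal_density_def by measurable
  have "mixture_density \<nu> y \<noteq> 0"
  proof
    assume "mixture_density \<nu> y = 0"
    then have "AE t in \<nu>. ennreal (normal_density t 1 y) = 0"
      using m by (simp add: mixture_density_def nn_integral_0_iff_AE)
    then have "AE t in \<nu>. False"
      by eventually_elim (use normal_density_pos[of 1 _ y] in \<open>auto simp: ennreal_eq_0_iff not_le[symmetric]\<close>)
    then show False by simp
  qed
  then show "0 < mixture_density \<nu> y" by (simp add: zero_less_iff_neq_zero)
qed

lemma joint_density_bounds:
  assumes "prob_space \<nu>" and "sets \<nu> = sets borel"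
  shows "0 < joint_density n \<nu> x" "joint_density n \<nu> x \<le> 1"
proof -
  show "joint_density n \<nu> x \<le> 1"
    unfolding joint_density_def
    using prod_mono_ennreal[of "{1..n}" "\<lambda>i. mixture_density \<nu> (x i)" "\<lambda>_. 1"] mixture_density_bounds[OF assms] by simp
  have "joint_density n \<nu> x \<noteq> 0"
    unfolding joint_density_def using mixture_density_bounds(1)[OF assms]
    by (simp add: zero_less_iff_neq_zero)
  then show "0 < joint_density n \<nu> x" by (simp add: zero_less_iff_neq_zero)
qed

lemma nn_integral_atomic:
  assumes [measurable]: "f \<in> borel_measurable borel"
  shows "(\<integral>\<^sup>+ t. f t \<partial>atomic k w \<theta>) = (\<Sum>j\<in>{1..k}. ennreal (w j) * f (\<theta> j))"
proof -
  have "\<theta> \<in> point_measure {1..k} (\<lambda>j. ennreal (w j)) \<rightarrow>\<^sub>M borel"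
    by (auto simp: measurable_def space_point_measure sets_point_measure)
  then show ?thesis
    by (simp add: atomic_def nn_integral_distr nn_integral_point_measure_finite)
qed

lemma mixture_density_atomic:
  "mixture_density (atomic k w \<theta>) y = (\<Sum>j\<in>{1..k}. ennreal (w j) * ennreal (normal_density (\<theta> j) 1 y))"
  unfolding mixture_density_def
  by (rule nn_integral_atomic) (simp add: normal_density_def)

section \<open>Measurability of the sets of mixing distributions\<close>

lemma emeasure_finite_support:
  assumes "prob_space \<nu>" and sets: "sets \<nu> = sets borel"
    and S: "finite (S :: real set)" "emeasure \<nu> S = 1" and A: "A \<in> sets borel"
  shows "emeasure \<nu> A = (\<Sum>s\<in>S. emeasure \<nu> {s} * indicator A s)"
proof -
  interpret prob_space \<nu> by fact
  have Sm: "S \<in> sets \<nu>" using S(1) sets by (simp add: finite_imp_closed borel_closed)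
  have "AE x in \<nu>. x \<in> S"
    using S(2) Sm by (intro AE_prob_1) (simp add: measure_def)
  then have "emeasure \<nu> A = emeasure \<nu> (S \<inter> A)"
    using A Sm sets by (intro emeasure_eq_AE) auto
  also have "\<dots> = (\<Sum>s\<in>S \<inter> A. emeasure \<nu> {s})"
    using S(1) sets by (intro emeasure_eq_sum_singleton) auto
  also have "\<dots> = (\<Sum>s\<in>S. emeasure \<nu> {s} * indicator A s)"
    using S(1) by (intro sum.mono_neutral_cong_left) (auto simp: indicator_def)
  finally show ?thesis .
qed

text \<open>The representation by weights and locations is not unique. Passing to supports gives a
  property of the measure itself, from which monotonicity in \<open>k\<close> and measurability can
  be read off.\<close>

lemma mixing_iff:
  assumes "0 \<le> L"
  shows "\<nu> \<in> mixing L k \<longleftrightarrow> prob_space \<nu> \<and> sets \<nu> = sets borel \<and>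
    (\<exists>S. finite S \<and> S \<subseteq> {- L..L} \<and> card S \<le> k \<and> emeasure \<nu> S = 1)" (is "_ \<longleftrightarrow> ?R")
proof
  assume "\<nu> \<in> mixing L k"
  then obtain w \<theta> where \<nu>: "\<nu> = atomic k w \<theta>" and w: "w \<in> weights k" and \<theta>: "\<theta> \<in> locations L k"
    by (auto simp: mixing_def)
  have "(\<Sum>j\<in>{1..k}. ennreal (w j)) = 1"
    using w by (subst sum_ennreal) (auto simp: weights_def PiE_iff)
  then have "emeasure \<nu> (\<theta> ` {1..k}) = 1"
    unfolding \<nu> by (subst emeasure_atomic) (auto simp: finite_imp_closed borel_closed)
  moreover have "\<theta> ` {1..k} \<subseteq> {- L..L}" using \<theta> by (auto simp: locations_def PiE_iff)
  moreover have "card (\<theta> ` {1..k}) \<le> k" using card_image_le[of "{1..k}" \<theta>] by simp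
  ultimately show ?R using prob_space_atomic[OF w] \<nu> by (intro conjI exI[of _ "\<theta> ` {1..k}"]) auto
next
  assume ?R
  then obtain S where p: "prob_space \<nu>" and sets: "sets \<nu> = sets borel"
    and S: "finite S" "S \<subseteq> {- L..L}" "card S \<le> k" "emeasure \<nu> S = 1" by auto
  interpret prob_space \<nu> by fact
  obtain e where e: "bij_betw e {1..card S} S" using ex_bij_betw_nat_finite_1[OF S(1)] by blast
  \<comment> \<open>Indices beyond the number of atoms are padded with weight 0 at location 0, which
    lies in the interval because 0 \<le> L.\<close>
  define \<theta> where "\<theta> = (\<lambda>i\<in>{1..k}. if i \<le> card S then e i else 0)"
  define w where "w = (\<lambda>i\<in>{1..k}. if i \<le> card S then measure \<nu> {e i} else 0)"
  have reindex: "(\<Sum>i\<in>{1..k}. if i \<le> card S then f (e i) else 0) = sum f S"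
    for f :: "real \<Rightarrow> 'b :: comm_monoid_add"
  proof -
    have "(\<Sum>i\<in>{1..k}. if i \<le> card S then f (e i) else 0) = (\<Sum>i\<in>{1..card S}. f (e i))"
      using S(3) by (intro sum.mono_neutral_cong_right) auto
    also have "\<dots> = sum f S" using sum.reindex_bij_betw[OF e] .
    finally show ?thesis .
  qed
  have "measure \<nu> S = (\<Sum>s\<in>S. measure \<nu> {s})"
    using S(1) sets by (intro measure_eq_sum_singleton) auto
  then have "(\<Sum>s\<in>S. measure \<nu> {s}) = 1" using S(4) by (simp add: measure_def)
  with reindex[of "\<lambda>s. measure \<nu> {s}"] have "w \<in> weights k"
    unfolding weights_def w_def by (auto cong: if_cong)
  moreover have "\<theta> \<in> locations L k"
    using assms subsetD[OF S(2)] bij_betwE[OF e] by (fastforce simp: locations_def \<theta>_def)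
  moreover have "\<nu> = atomic k w \<theta>"
  proof (rule measure_eqI)
    fix A assume "A \<in> sets \<nu>"
    then have A: "A \<in> sets borel" using sets by simp
    have "emeasure (atomic k w \<theta>) A
        = (\<Sum>i\<in>{1..k}. if i \<le> card S then emeasure \<nu> {e i} * indicator A (e i) else 0)"
      unfolding emeasure_atomic[OF A] by (intro sum.cong) (auto simp: w_def \<theta>_def emeasure_eq_measure)
    also have "\<dots> = emeasure \<nu> A"
      unfolding emeasure_finite_support[OF p sets S(1,4) A] by (rule reindex)
    finally show "emeasure \<nu> A = emeasure (atomic k w \<theta>) A" by simp
  qed (simp add: sets)
  ultimately show "\<nu> \<in> mixing L k" by (auto simp: mixing_def)
qed

text \<open>A positive gap exceeds 1 after multiplication by a large power of 2, and reals at
  distance at least 1 have different floors. So a fine enough dyadic grid puts the points into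
  different cells.\<close>

lemma floor_scale_inj_on:
  assumes "finite (S :: real set)"
  shows "\<exists>N::nat. inj_on (\<lambda>x. \<lfloor>2 ^ N * x\<rfloor>) S"
proof -
  have "\<exists>N. \<forall>x\<in>S. \<forall>y\<in>S. x < y \<longrightarrow> 2 ^ N * (y - x) \<ge> (1::real)"
  proof -
    have "\<forall>p\<in>S \<times> S. \<exists>N. fst p < snd p \<longrightarrow> 2 ^ N * (snd p - fst p) \<ge> (1::real)"
    proof
      fix p :: "real \<times> real"
      show "\<exists>N. fst p < snd p \<longrightarrow> 2 ^ N * (snd p - fst p) \<ge> 1"
      proof (cases "fst p < snd p")
        case True
        then obtain N where "1 / (snd p - fst p) < 2 ^ N"
          using real_arch_pow[of 2 "1 / (snd p - fst p)"] by auto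
        with True show ?thesis by (intro exI[of _ N]) (auto simp: field_simps)
      qed auto
    qed
    then obtain N where N: "\<And>p. p \<in> S \<times> S \<Longrightarrow> fst p < snd p \<Longrightarrow> 2 ^ N p * (snd p - fst p) \<ge> (1::real)"
      by metis
    \<comment> \<open>The sum bounds each of the finitely many exponents, so it works for all pairs
      simultaneously.\<close>
    define N0 where "N0 = (\<Sum>p\<in>S \<times> S. N p)"
    have "2 ^ N0 * (y - x) \<ge> 1" if "x \<in> S" "y \<in> S" "x < y" for x y
    proof -
      have "N (x, y) \<le> N0" unfolding N0_def using assms that by (intro member_le_sum) auto
      then have "(2::real) ^ N (x, y) \<le> 2 ^ N0" by (intro power_increasing) auto
      with that N[of "(x, y)"] show ?thesis
        by (smt (verit) mult_right_mono fst_conv snd_conv mem_Sigma_iff)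
    qed
    then show ?thesis by blast
  qed
  then obtain N where N: "\<And>x y. x \<in> S \<Longrightarrow> y \<in> S \<Longrightarrow> x < y \<Longrightarrow> 2 ^ N * (y - x) \<ge> (1::real)" by blast
  have "\<lfloor>2 ^ N * x\<rfloor> < \<lfloor>2 ^ N * y\<rfloor>" if "x \<in> S" "y \<in> S" "x < y" for x y
    using N[OF that] by (simp add: algebra_simps) linarith
  then show ?thesis by (intro exI[of _ N] inj_onI) (metis linorder_less_linear order_less_irrefl)
qed

text \<open>An atomic distribution has at most \<open>k\<close> atoms iff it charges at most \<open>k\<close> cells of every
  dyadic grid, which is a countable condition on its values on Borel sets.\<close>

lemma sets_mixing:
  assumes "0 \<le> L"
  shows "mixing L k \<in> sets (mixing_space L)"
proof (cases "k = 0")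
  case True
  then show ?thesis by (simp add: mixing_def weights_def)
next
  case False
  define C where "C N j = {x::real. \<lfloor>2 ^ N * x\<rfloor> = j}" for N :: nat and j :: int
  \<comment> \<open>The cells with index in {- J N..J N} cover [-L, L] at scale 2^-N.\<close>
  define J where "J N = \<lceil>2 ^ N * L\<rceil> + 1" for N :: nat
  have C [measurable]: "C N j \<in> sets borel" for N j unfolding C_def by measurable
  have sp: "space (mixing_space L) = (\<Union>k\<in>{1..}. mixing L k)"
    using assms by (auto simp: mixing_space_def space_restrict_space space_prob_algebra mixing_iff)
  have eq: "mixing L k = {\<nu> \<in> space (mixing_space L).
      \<forall>N. (\<Sum>j\<in>{- J N..J N}. if emeasure \<nu> (C N j) = 0 then 0 else 1) \<le> k}" (is "_ = ?M")
  proof (intro set_eqI iffI)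
    fix \<nu> assume \<nu>: "\<nu> \<in> mixing L k"
    then obtain S where p: "prob_space \<nu>" and sets: "sets \<nu> = sets borel"
      and S: "finite S" "card S \<le> k" "emeasure \<nu> S = 1"
      using assms by (auto simp: mixing_iff)
    have "(\<Sum>j\<in>{- J N..J N}. if emeasure \<nu> (C N j) = 0 then 0 else 1) \<le> k" for N
    proof -
      have "(\<Sum>j\<in>{- J N..J N}. if emeasure \<nu> (C N j) = 0 then 0 else 1)
          = card {j \<in> {- J N..J N}. emeasure \<nu> (C N j) \<noteq> 0}"
        by (subst card_eq_sum, subst sum.inter_filter) (auto intro!: sum.cong)
      also have "\<dots> \<le> card ((\<lambda>x. \<lfloor>2 ^ N * x\<rfloor>) ` S)"
      proof (intro card_mono)
        show "{j \<in> {- J N..J N}. emeasure \<nu> (C N j) \<noteq> 0} \<subseteq> (\<lambda>x. \<lfloor>2 ^ N * x\<rfloor>) ` S"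
        proof clarify
          fix j assume "emeasure \<nu> (C N j) \<noteq> 0"
          then obtain s where "s \<in> S" "indicator (C N j) s \<noteq> (0::ennreal)"
            unfolding emeasure_finite_support[OF p sets S(1,3) C] using S(1) by (auto simp: sum_eq_0_iff)
          then show "j \<in> (\<lambda>x. \<lfloor>2 ^ N * x\<rfloor>) ` S" by (auto simp: C_def indicator_def split: if_splits)
        qed
      qed (use S in auto)
      also have "\<dots> \<le> k" using card_image_le[OF S(1)] S(2) by (meson order_trans)
      finally show ?thesis .
    qed
    moreover have "\<nu> \<in> space (mixing_space L)" using \<nu> False sp by auto
    ultimately show "\<nu> \<in> ?M" by blast
  next
    fix \<nu> assume \<nu>: "\<nu> \<in> ?M"
    then obtain S where p: "prob_space \<nu>" and sets: "sets \<nu> = sets borel"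
      and S: "finite S" "S \<subseteq> {- L..L}" "emeasure \<nu> S = 1"
      using assms by (auto simp: sp mixing_iff)
    \<comment> \<open>Points without mass are discarded: they count in \<open>card S\<close> but
      need not make their cell charged.\<close>
    define S' where "S' = {s \<in> S. emeasure \<nu> {s} \<noteq> 0}"
    have S': "finite S'" "S' \<subseteq> {- L..L}" using S by (auto simp: S'_def)
    obtain N where N: "inj_on (\<lambda>x. \<lfloor>2 ^ N * x\<rfloor>) S'" using floor_scale_inj_on[OF S'(1)] by blast
    have "1 = (\<Sum>s\<in>S. emeasure \<nu> {s} * indicator S s)"
      using emeasure_finite_support[OF p sets S(1,3), of S] S by (simp add: finite_imp_closed borel_closed)
    also have "\<dots> = (\<Sum>s\<in>S. emeasure \<nu> {s} * indicator S' s)"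
      by (intro sum.cong) (auto simp: S'_def indicator_def)
    also have "\<dots> = emeasure \<nu> S'"
      using emeasure_finite_support[OF p sets S(1,3), of S'] S' by (simp add: finite_imp_closed borel_closed)
    finally have 1: "emeasure \<nu> S' = 1" by simp
    have "card S' = card ((\<lambda>x. \<lfloor>2 ^ N * x\<rfloor>) ` S')" using N by (simp add: card_image)
    also have "\<dots> \<le> card {j \<in> {- J N..J N}. emeasure \<nu> (C N j) \<noteq> 0}"
    proof (intro card_mono subsetI CollectI conjI)
      fix j assume "j \<in> (\<lambda>x. \<lfloor>2 ^ N * x\<rfloor>) ` S'"
      then obtain s where s: "s \<in> S'" "j = \<lfloor>2 ^ N * s\<rfloor>" by auto
      have "- L \<le> s" "s \<le> L" using s subsetD[OF S'(2), of s] by auto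
      from this[THEN mult_left_mono, of "2 ^ N"]
      have "2 ^ N * s \<le> 2 ^ N * L" "- (2 ^ N * L) \<le> 2 ^ N * s" by auto
      then show "j \<in> {- J N..J N}"
        unfolding s J_def atLeastAtMost_iff by linarith
      have "emeasure \<nu> {s} \<le> emeasure \<nu> (C N j)"
        using s sets C by (intro emeasure_mono) (auto simp: C_def)
      with s show "emeasure \<nu> (C N j) \<noteq> 0" by (auto simp: S'_def)
    qed (rule finite_subset[of _ "{- J N..J N}"], auto)
    also have "\<dots> = (\<Sum>j\<in>{- J N..J N}. if emeasure \<nu> (C N j) = 0 then 0 else 1)"
      by (subst card_eq_sum, subst sum.inter_filter) (auto intro!: sum.cong)
    also have "\<dots> \<le> k" using \<nu> by blast
    finally show "\<nu> \<in> mixing L k"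
      using assms p sets S' 1 by (auto simp: mixing_iff)
  qed
  have "(\<lambda>\<nu>. emeasure \<nu> (C N j)) \<in> borel_measurable (mixing_space L)" for N j
    unfolding mixing_space_def
    by (intro measurable_restrict_space1 measurable_compose[OF measurable_prob_algebraD
        measurable_emeasure_subprob_algebra[OF C]] measurable_ident_sets[OF refl])
  note this[measurable]
  show ?thesis unfolding eq by measurable
qed

section \<open>Comparing the truth with a prior average\<close>

lemma ennreal_le_diff_add: "a \<le> (a - b) + (b :: ennreal)"
  by (cases "b \<le> a") (auto simp: diff_add_cancel_ennreal intro: add_increasing)

text \<open>Subtraction in \<open>ennreal\<close> is truncated, so for probability densities these
  integrals are total variation distances. Replacing the factors one at a time costs one such
  distance per coordinate.\<close>

lemma nn_integral_prod_diff_le: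
  assumes "sigma_finite_measure M" and I: "finite I"
    and [measurable]: "f \<in> borel_measurable M" "g \<in> borel_measurable M"
    and f: "(\<integral>\<^sup>+ y. f y \<partial>M) \<le> 1" and g: "(\<integral>\<^sup>+ y. g y \<partial>M) \<le> 1"
    and fin: "\<And>y. f y < \<infinity>" "\<And>y. g y < \<infinity>"
  shows "(\<integral>\<^sup>+ x. (\<Prod>i\<in>I. f (x i)) - (\<Prod>i\<in>I. g (x i)) \<partial>(\<Pi>\<^sub>M i\<in>I. M))
    \<le> of_nat (card I) * (\<integral>\<^sup>+ y. f y - g y \<partial>M)"
  using I
proof induction
  case (insert i I)
  interpret product_sigma_finite "\<lambda>_. M" using assms by (simp add: product_sigma_finite_def)
  define F G where "F x = (\<Prod>i\<in>I. f (x i))" and "G x = (\<Prod>i\<in>I. g (x i))" for x :: "'b \<Rightarrow> 'a"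
  have [measurable]: "F \<in> borel_measurable (\<Pi>\<^sub>M i\<in>I. M)" "G \<in> borel_measurable (\<Pi>\<^sub>M i\<in>I. M)"
    unfolding F_def G_def by measurable
  have F1: "(\<integral>\<^sup>+ x. F x \<partial>(\<Pi>\<^sub>M i\<in>I. M)) \<le> 1"
    unfolding F_def using insert.hyps f
    using prod_mono_ennreal[of I "\<lambda>_. \<integral>\<^sup>+ y. f y \<partial>M" "\<lambda>_. 1"]
    by (subst product_nn_integral_prod) auto
  \<comment> \<open>The telescoping identity f F - g G = (f - g) F + g (F - G) survives truncation
    as an inequality; finiteness of \<open>g y * G x\<close> is what permits moving that term
    across.\<close>
  have pt: "f y * F x - g y * G x \<le> (f y - g y) * F x + g y * (F x - G x)" for x y
  proof -
    have "f y * F x \<le> ((f y - g y) + g y) * F x"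
      by (intro mult_right_mono ennreal_le_diff_add) auto
    also have "\<dots> \<le> (f y - g y) * F x + g y * ((F x - G x) + G x)"
      unfolding distrib_right by (intro add_left_mono mult_left_mono ennreal_le_diff_add) auto
    finally have "f y * F x \<le> g y * G x + ((f y - g y) * F x + g y * (F x - G x))"
      by (simp add: distrib_left ac_simps)
    moreover have "g y * G x \<noteq> \<top>"
      using fin(2) insert.hyps(1) unfolding G_def
      by (simp add: ennreal_mult_eq_top_iff ennreal_prod_eq_top less_top)
    ultimately show ?thesis by (simp add: ennreal_minus_le_iff)
  qed
  have "(\<integral>\<^sup>+ x. (\<Prod>i\<in>insert i I. f (x i)) - (\<Prod>i\<in>insert i I. g (x i)) \<partial>(\<Pi>\<^sub>M i\<in>insert i I. M))
      = (\<integral>\<^sup>+ x. (\<integral>\<^sup>+ y. (\<Prod>j\<in>insert i I. f ((x(i := y)) j)) - (\<Prod>j\<in>insert i I. g ((x(i := y)) j)) \<partial>M) \<partial>(\<Pi>\<^sub>M i\<in>I. M))"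
    using insert.hyps by (intro product_nn_integral_insert) auto
  also have "\<dots> = (\<integral>\<^sup>+ x. (\<integral>\<^sup>+ y. f y * F x - g y * G x \<partial>M) \<partial>(\<Pi>\<^sub>M i\<in>I. M))"
    using insert.hyps unfolding F_def G_def
    by (intro nn_integral_cong) (auto intro!: arg_cong2[where f="(-)"] arg_cong2[where f="(*)"] prod.cong)
  also have "\<dots> \<le> (\<integral>\<^sup>+ x. (\<integral>\<^sup>+ y. (f y - g y) * F x + g y * (F x - G x) \<partial>M) \<partial>(\<Pi>\<^sub>M i\<in>I. M))"
    by (intro nn_integral_mono pt)
  also have "\<dots> = (\<integral>\<^sup>+ y. f y - g y \<partial>M) * (\<integral>\<^sup>+ x. F x \<partial>(\<Pi>\<^sub>M i\<in>I. M))
      + (\<integral>\<^sup>+ y. g y \<partial>M) * (\<integral>\<^sup>+ x. F x - G x \<partial>(\<Pi>\<^sub>M i\<in>I. M))"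
    by (simp add: nn_integral_add nn_integral_cmult nn_integral_multc)
  also have "\<dots> \<le> (\<integral>\<^sup>+ y. f y - g y \<partial>M) * 1 + 1 * (of_nat (card I) * (\<integral>\<^sup>+ y. f y - g y \<partial>M))"
    using insert.IH unfolding F_def[symmetric] G_def[symmetric]
    by (intro add_mono mult_mono F1 g) auto
  also have "\<dots> = of_nat (card (insert i I)) * (\<integral>\<^sup>+ y. f y - g y \<partial>M)"
    using insert.hyps by (simp add: distrib_right)
  finally show ?case .
qed simp

text \<open>For centres at distance at most 1, exp z \<ge> 1 + z bounds the difference pointwise by
  the density times |a - b| (1 + (y - a)^2 / 2), whose integral is 3/2 |a - b|. For larger distances
  the total mass 1 is already small enough.\<close>

lemma nn_integral_normal_density_diff:
  "(\<integral>\<^sup>+ y. ennreal (normal_density a 1 y) - ennreal (normal_density b 1 y) \<partial>lborel) \<le> ennreal (2 * \<bar>a - b\<bar>)"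
proof (cases "\<bar>a - b\<bar> \<le> 1")
  case True
  have "normal_density a 1 y - normal_density b 1 y
      \<le> normal_density a 1 y * (\<bar>a - b\<bar> * (1 + (y - a)\<^sup>2 / 2))" for y
  proof -
    define d where "d = b - a"
    have "(y - a)\<^sup>2 / 2 - (y - b)\<^sup>2 / 2 = d * (y - a) - d\<^sup>2 / 2"
      by (simp add: d_def power2_eq_square field_simps)
    then have "normal_density b 1 y = normal_density a 1 y * exp (d * (y - a) - d\<^sup>2 / 2)"
      by (simp add: normal_density_def flip: exp_add)
    also have "\<dots> \<ge> normal_density a 1 y * (1 + (d * (y - a) - d\<^sup>2 / 2))"
      by (intro mult_left_mono exp_ge_add_one_self) simp
    \<comment> \<open>Uses |z| \<le> 1/2 + z^2 / 2 for the linear term, and d^2 \<le> |d|, valid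
      since |d| \<le> 1, for the other.\<close>
    moreover have "- (d * (y - a) - d\<^sup>2 / 2) \<le> \<bar>d\<bar> * (1 + (y - a)\<^sup>2 / 2)"
    proof -
      have "\<bar>z\<bar> \<le> 1 / 2 + z\<^sup>2 / 2" for z :: real
        using zero_le_power2[of "\<bar>z\<bar> - 1"] by (simp add: power2_diff)
      then have "\<bar>d\<bar> * \<bar>y - a\<bar> \<le> \<bar>d\<bar> * (1 / 2 + (y - a)\<^sup>2 / 2)" by (intro mult_left_mono) auto
      moreover have "d\<^sup>2 \<le> \<bar>d\<bar>"
        using True mult_right_mono[of "\<bar>d\<bar>" 1 "\<bar>d\<bar>"]
        by (simp add: d_def[symmetric] abs_minus_commute[of a b] power2_eq_square)
      moreover have "- (d * (y - a)) \<le> \<bar>d\<bar> * \<bar>y - a\<bar>" by (metis abs_ge_minus_self abs_mult)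
      ultimately show ?thesis by (simp add: distrib_left)
    qed
    then have "normal_density a 1 y * (- (d * (y - a) - d\<^sup>2 / 2))
        \<le> normal_density a 1 y * (\<bar>d\<bar> * (1 + (y - a)\<^sup>2 / 2))"
      by (intro mult_left_mono normal_density_nonneg)
    ultimately show ?thesis by (simp add: d_def abs_minus_commute algebra_simps)
  qed
  then have "(\<integral>\<^sup>+ y. ennreal (normal_density a 1 y) - ennreal (normal_density b 1 y) \<partial>lborel)
      \<le> (\<integral>\<^sup>+ y. ennreal (normal_density a 1 y * (\<bar>a - b\<bar> * (1 + (y - a)\<^sup>2 / 2))) \<partial>lborel)"
    by (intro nn_integral_mono) (simp add: ennreal_minus ennreal_leI)
  also have "\<dots> = ennreal (\<bar>a - b\<bar> * (3 / 2))"
  proof -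
    have m: "has_bochner_integral lborel (\<lambda>y. normal_density a 1 y * (y - a) ^ 2) 1"
      using normal_moment_even[of 1 a 1] by simp
    have d: "has_bochner_integral lborel (normal_density a 1) 1"
      using integral_normal_density[of 1 a] integrable_normal_density[of 1 a]
      by (simp add: has_bochner_integral_iff)
    have "has_bochner_integral lborel (\<lambda>y. \<bar>a - b\<bar> * (normal_density a 1 y + normal_density a 1 y * (y - a) ^ 2 / 2))
        (\<bar>a - b\<bar> * (1 + 1 / 2))"
      by (intro has_bochner_integral_mult_right has_bochner_integral_add d has_bochner_integral_divide_zero m)
    then have h: "has_bochner_integral lborel (\<lambda>y. normal_density a 1 y * (\<bar>a - b\<bar> * (1 + (y - a)\<^sup>2 / 2)))
        (\<bar>a - b\<bar> * (3 / 2))"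
      by (simp add: algebra_simps)
    have "(\<integral>\<^sup>+ y. ennreal (normal_density a 1 y * (\<bar>a - b\<bar> * (1 + (y - a)\<^sup>2 / 2))) \<partial>lborel)
        = ennreal (\<integral>y. normal_density a 1 y * (\<bar>a - b\<bar> * (1 + (y - a)\<^sup>2 / 2)) \<partial>lborel)"
      using h by (intro nn_integral_eq_integral) (auto simp: has_bochner_integral_iff)
    also have "(\<integral>y. normal_density a 1 y * (\<bar>a - b\<bar> * (1 + (y - a)\<^sup>2 / 2)) \<partial>lborel) = \<bar>a - b\<bar> * (3 / 2)"
      using h by (simp add: has_bochner_integral_iff)
    finally show ?thesis .
  qed
  finally show ?thesis by (rule order_trans) (simp add: ennreal_leI)
next
  case False
  have "(\<integral>\<^sup>+ y. ennreal (normal_density a 1 y) - ennreal (normal_density b 1 y) \<partial>lborel)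
      \<le> (\<integral>\<^sup>+ y. ennreal (normal_density a 1 y) \<partial>lborel)"
    by (intro nn_integral_mono) (simp add: ennreal_minus ennreal_leI)
  also have "\<dots> = 1"
    using integral_normal_density[of 1 a] integrable_normal_density[of 1 a]
    by (subst nn_integral_eq_integral) auto
  also have "\<dots> \<le> ennreal (2 * \<bar>a - b\<bar>)" using False by (simp add: one_ennreal_def[symmetric] flip: ennreal_1)
  finally show ?thesis .
qed

text \<open>Replace the truth by the prior average of the likelihoods over a neighbourhood of the truth
  (the measure \<open>\<mu>\<close>), at the price of \<open>\<epsilon>\<close> in total variation. Under this average the marginal
  likelihood in the denominator of the posterior cancels.\<close>

lemma posterior_expectation_bound:
  fixes f :: "'a \<Rightarrow> 'x \<Rightarrow> ennreal" and F :: "'b \<Rightarrow> 'x \<Rightarrow> ennreal"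
  assumes "sigma_finite_measure M" and "sigma_finite_measure Q" and "finite_measure \<mu>"
    and f [measurable]: "(\<lambda>(\<nu>, x). f \<nu> x) \<in> borel_measurable (Q \<Otimes>\<^sub>M M)"
    and F [measurable]: "(\<lambda>(y, x). F y x) \<in> borel_measurable (\<mu> \<Otimes>\<^sub>M M)"
    and g [measurable]: "g \<in> borel_measurable M"
    and C [measurable]: "C \<in> sets Q" and R [measurable]: "R \<in> sets M"
    and marginal: "\<And>x. x \<in> space M \<Longrightarrow> 0 < (\<integral>\<^sup>+ \<nu>. f \<nu> x \<partial>Q) \<and> (\<integral>\<^sup>+ \<nu>. f \<nu> x \<partial>Q) < \<infinity>"
    and F_le: "\<And>x. x \<in> space M \<Longrightarrow> (\<integral>\<^sup>+ y. F y x \<partial>\<mu>) \<le> (\<integral>\<^sup>+ \<nu>. f \<nu> x \<partial>Q)"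
    and close: "AE y in \<mu>. (\<integral>\<^sup>+ x. g x - F y x \<partial>M) \<le> \<epsilon>"
  shows "emeasure \<mu> (space \<mu>) * (\<integral>\<^sup>+ x. (\<integral>\<^sup>+ \<nu>. f \<nu> x / (\<integral>\<^sup>+ \<nu>'. f \<nu>' x \<partial>Q) * indicator C \<nu> \<partial>Q) * g x \<partial>M)
    \<le> emeasure \<mu> (space \<mu>) * ((\<integral>\<^sup>+ x. g x * indicator R x \<partial>M) + \<epsilon>)
      + (\<integral>\<^sup>+ \<nu>. (\<integral>\<^sup>+ x. f \<nu> x * indicator (space M - R) x \<partial>M) * indicator C \<nu> \<partial>Q)"
proof -
  interpret M: sigma_finite_measure M by fact
  interpret Q: sigma_finite_measure Q by fact
  interpret \<mu>: finite_measure \<mu> by fact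
  interpret QM: pair_sigma_finite Q M ..
  interpret \<mu>M: pair_sigma_finite \<mu> M ..
  \<comment> \<open>Here \<open>m\<close> is the marginal likelihood, \<open>q\<close> its part
    coming from the neighbourhood, \<open>r\<close> the loss from replacing the truth by neighbours,
    \<open>c\<close> the unnormalised and \<open>p\<close> the normalised posterior mass of
    \<open>C\<close>.\<close>
  define m where "m x = (\<integral>\<^sup>+ \<nu>. f \<nu> x \<partial>Q)" for x
  define q where "q x = (\<integral>\<^sup>+ y. F y x \<partial>\<mu>)" for x
  define r where "r x = (\<integral>\<^sup>+ y. g x - F y x \<partial>\<mu>)" for x
  define c where "c x = (\<integral>\<^sup>+ \<nu>. f \<nu> x * indicator C \<nu> \<partial>Q)" for x
  define p where "p x = c x / m x" for x
  let ?b = "emeasure \<mu> (space \<mu>)"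
  have mm [measurable]: "m \<in> borel_measurable M" unfolding m_def by measurable
  have qm [measurable]: "q \<in> borel_measurable M" unfolding q_def by measurable
  have rm [measurable]: "r \<in> borel_measurable M" unfolding r_def by measurable
  have cm [measurable]: "c \<in> borel_measurable M" unfolding c_def by measurable
  have pm [measurable]: "p \<in> borel_measurable M" unfolding p_def by measurable
  have post: "(\<integral>\<^sup>+ \<nu>. f \<nu> x / (\<integral>\<^sup>+ \<nu>'. f \<nu>' x \<partial>Q) * indicator C \<nu> \<partial>Q) = p x" if "x \<in> space M" for x
  proof -
    have [measurable]: "(\<lambda>\<nu>. f \<nu> x) \<in> borel_measurable Q" using that by measurable
    have "(\<integral>\<^sup>+ \<nu>. f \<nu> x / (\<integral>\<^sup>+ \<nu>'. f \<nu>' x \<partial>Q) * indicator C \<nu> \<partial>Q)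
        = (\<integral>\<^sup>+ \<nu>. (f \<nu> x * indicator C \<nu>) / m x \<partial>Q)"
      unfolding m_def by (intro nn_integral_cong) (simp add: divide_ennreal_def ac_simps)
    also have "\<dots> = p x" unfolding p_def c_def by (intro nn_integral_divide) measurable
    finally show ?thesis .
  qed
  have mpos: "m x \<noteq> 0" "m x \<noteq> \<top>" if "x \<in> space M" for x
    using marginal[OF that] by (auto simp: m_def)
  have p1: "p x \<le> 1" if "x \<in> space M" for x
  proof -
    have "c x \<le> m x" unfolding c_def m_def by (intro nn_integral_mono) (simp add: indicator_def)
    then have "c x / m x \<le> m x / m x" by (intro divide_right_mono_ennreal)
    also have "\<dots> = 1" using mpos[OF that] by (simp add: ennreal_divide_self top.not_eq_extremum)
    finally show ?thesis by (simp add: p_def)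
  qed
  \<comment> \<open>The cancellation: the neighbourhood average is at most the denominator of
    \<open>p\<close>, so multiplying by it leaves the numerator, whose integral over the sample is
    controlled by the prior mass of \<open>C\<close>.\<close>
  have pq: "p x * q x \<le> c x" if "x \<in> space M" for x
  proof -
    have "p x * q x \<le> p x * m x" using F_le[OF that] by (intro mult_left_mono) (auto simp: q_def m_def)
    also have "\<dots> = c x" using mpos[OF that]
      by (simp add: p_def ennreal_times_divide mult.commute ennreal_mult_divide_eq)
    finally show ?thesis .
  qed
  have bg: "?b * g x \<le> r x + q x" if "x \<in> space M" for x
  proof -
    have [measurable]: "(\<lambda>y. F y x) \<in> borel_measurable \<mu>" using that by measurable
    have "?b * g x = (\<integral>\<^sup>+ y. g x \<partial>\<mu>)" by (simp add: mult.commute)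
    also have "\<dots> \<le> (\<integral>\<^sup>+ y. (g x - F y x) + F y x \<partial>\<mu>)"
      by (intro nn_integral_mono ennreal_le_diff_add)
    also have "\<dots> = r x + q x" unfolding r_def q_def by (intro nn_integral_add) measurable
    finally show ?thesis .
  qed
  \<comment> \<open>On the rejection region the posterior mass is bounded by 1 and the truth is
    kept; only outside it is the truth exchanged for its neighbours.\<close>
  have pt: "?b * (p x * g x) \<le> ?b * (g x * indicator R x) + (r x + c x * indicator (space M - R) x)"
    if x: "x \<in> space M" for x
  proof (cases "x \<in> R")
    case True
    then have "?b * (p x * g x) \<le> ?b * (1 * g x)"
      using p1[OF x] by (intro mult_left_mono mult_right_mono) auto
    then show ?thesis using True by (simp add: add_increasing2)
  next
    case False
    have "?b * (p x * g x) = p x * (?b * g x)" by (simp add: ac_simps)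
    also have "\<dots> \<le> p x * (r x + q x)" using bg[OF x] by (intro mult_left_mono) auto
    also have "\<dots> \<le> 1 * r x + c x"
      unfolding distrib_left using p1[OF x] pq[OF x] by (intro add_mono mult_right_mono) auto
    finally show ?thesis using False x by simp
  qed
  have "?b * (\<integral>\<^sup>+ x. (\<integral>\<^sup>+ \<nu>. f \<nu> x / (\<integral>\<^sup>+ \<nu>'. f \<nu>' x \<partial>Q) * indicator C \<nu> \<partial>Q) * g x \<partial>M)
      = ?b * (\<integral>\<^sup>+ x. p x * g x \<partial>M)"
    by (intro arg_cong[where f="(*) ?b"] nn_integral_cong) (simp add: post)
  also have "\<dots> = (\<integral>\<^sup>+ x. ?b * (p x * g x) \<partial>M)"
    by (simp add: nn_integral_cmult)
  also have "\<dots> \<le> (\<integral>\<^sup>+ x. ?b * (g x * indicator R x) + (r x + c x * indicator (space M - R) x) \<partial>M)"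
    by (intro nn_integral_mono pt)
  also have "\<dots> = ?b * (\<integral>\<^sup>+ x. g x * indicator R x \<partial>M)
      + ((\<integral>\<^sup>+ x. r x \<partial>M) + (\<integral>\<^sup>+ x. c x * indicator (space M - R) x \<partial>M))"
    by (simp add: nn_integral_add nn_integral_cmult)
  also have "(\<integral>\<^sup>+ x. r x \<partial>M) = (\<integral>\<^sup>+ y. (\<integral>\<^sup>+ x. g x - F y x \<partial>M) \<partial>\<mu>)"
    unfolding r_def by (intro \<mu>M.Fubini') measurable
  also have "\<dots> \<le> (\<integral>\<^sup>+ y. \<epsilon> \<partial>\<mu>)" by (intro nn_integral_mono_AE close)
  also have "\<dots> = ?b * \<epsilon>" by (simp add: mult.commute)
  also have "(\<integral>\<^sup>+ x. c x * indicator (space M - R) x \<partial>M)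
      = (\<integral>\<^sup>+ x. (\<integral>\<^sup>+ \<nu>. f \<nu> x * indicator C \<nu> * indicator (space M - R) x \<partial>Q) \<partial>M)"
    unfolding c_def by (intro nn_integral_cong nn_integral_multc[symmetric]) measurable
  also have "\<dots> = (\<integral>\<^sup>+ \<nu>. (\<integral>\<^sup>+ x. f \<nu> x * indicator C \<nu> * indicator (space M - R) x \<partial>M) \<partial>Q)"
    by (intro QM.Fubini') measurable
  also have "\<dots> = (\<integral>\<^sup>+ \<nu>. (\<integral>\<^sup>+ x. f \<nu> x * indicator (space M - R) x * indicator C \<nu> \<partial>M) \<partial>Q)"
    by (simp add: ac_simps)
  also have "\<dots> = (\<integral>\<^sup>+ \<nu>. (\<integral>\<^sup>+ x. f \<nu> x * indicator (space M - R) x \<partial>M) * indicator C \<nu> \<partial>Q)"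
    by (intro nn_integral_cong nn_integral_multc) measurable
  finally show ?thesis by (simp add: distrib_left add.assoc add_right_mono add_left_mono)
qed

section \<open>A separating trigonometric polynomial\<close>

text \<open>With d = a - b, the first-order Taylor error of exp(i d) is at most d^2 / 2 \<le> |d| /
  2, which leaves half of the arc for the chord.\<close>

lemma cmod_cis_diff_ge:
  assumes "\<bar>a - b\<bar> \<le> 1"
  shows "\<bar>a - b\<bar> / 2 \<le> cmod (cis a - cis b)"
proof -
  define d where "d = a - b"
  have "cis a - cis b = cis b * (cis d - 1)"
    by (simp add: d_def cis_mult right_diff_distrib)
  then have 1: "cmod (cis a - cis b) = cmod (cis d - 1)" by (simp add: norm_mult)
  have "cmod (cis d - (1 + \<i> * d)) \<le> \<bar>d\<bar> ^ 2 / 2"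
    using iexp_approx1[of d 1] by (simp add: cis_conv_exp numeral_2_eq_2)
  moreover have "cmod (\<i> * d) - cmod (cis d - 1 - \<i> * d) \<le> cmod (cis d - 1)"
    using norm_triangle_ineq4[of "cis d - 1" "cis d - 1 - \<i> * d"] by simp
  moreover have "\<bar>d\<bar> ^ 2 \<le> \<bar>d\<bar> * 1"
    unfolding power2_eq_square using assms by (intro mult_left_mono) (auto simp: d_def)
  ultimately show ?thesis using 1 by (simp add: d_def[symmetric] norm_mult diff_diff_eq)
qed

lemma cmod_cis_diff_power2:
  "complex_of_real ((cmod (cis a - cis b))\<^sup>2) = 2 - cis (- b) * cis a - cis b * cis (- a)"
  unfolding complex_norm_square by (simp add: algebra_simps cis_mult cis_cnj)

text \<open>Each factor equals 2 - exp(-iur) exp(iut) - exp(iur) exp(-iut): it shifts frequencies by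
  at most one and its coefficients have absolute sum 4. So \<open>d\<close> factors use up
  \<open>d\<close> frequencies and a factor 4^d. The functional will be the difference of the
  integrals against two mixing distributions.\<close>

lemma trig_product_le:
  fixes \<Lambda> :: "(real \<Rightarrow> complex) \<Rightarrow> complex" and r :: "nat \<Rightarrow> real" and m :: int
  assumes diff: "\<And>f g. \<Lambda> (\<lambda>t. f t - g t) = \<Lambda> f - \<Lambda> g"
    and cmult: "\<And>c f. \<Lambda> (\<lambda>t. c * f t) = c * \<Lambda> f"
    and small: "\<And>m::int. \<bar>m\<bar> \<le> int N \<Longrightarrow> cmod (\<Lambda> (\<lambda>t. cis (u * of_int m * t))) \<le> \<tau>"
  shows "\<bar>m\<bar> + int d \<le> int N \<Longrightarrow>
    cmod (\<Lambda> (\<lambda>t. cis (u * of_int m * t) * (\<Prod>j\<in>{1..d}. of_real ((cmod (cis (u * t) - cis (u * r j)))\<^sup>2))))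
      \<le> 4 ^ d * \<tau>"
proof (induction d arbitrary: m)
  case 0
  then show ?case using small[of m] by simp
next
  case (Suc d)
  define P where "P t = (\<Prod>j\<in>{1..d}. complex_of_real ((cmod (cis (u * t) - cis (u * r j)))\<^sup>2))" for t
  define E where "E m t = cis (u * of_int m * t) * P t" for m :: int and t
  define a where "a = u * r (Suc d)"
  \<comment> \<open>Multiplying by the last factor turns the product at frequency \<open>m\<close>
    into shorter products at the frequencies \<open>m\<close>, \<open>m + 1\<close> and
    \<open>m - 1\<close>, so the induction needs \<open>m\<close> arbitrary.\<close>
  have "cis (u * of_int m * t) * (\<Prod>j\<in>{1..Suc d}. of_real ((cmod (cis (u * t) - cis (u * r j)))\<^sup>2))
      = 2 * E m t - cis (- a) * E (m + 1) t - cis a * E (m - 1) t" for t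
  proof -
    have "(\<Prod>j\<in>{1..Suc d}. complex_of_real ((cmod (cis (u * t) - cis (u * r j)))\<^sup>2))
        = P t * (2 - cis (- a) * cis (u * t) - cis a * cis (- (u * t)))"
      unfolding P_def a_def cmod_cis_diff_power2[symmetric] by (simp add: atLeastAtMostSuc_conv mult.commute)
    moreover have "cis (u * of_int m * t) * cis (u * t) = cis (u * of_int (m + 1) * t)"
      "cis (u * of_int m * t) * cis (- (u * t)) = cis (u * of_int (m - 1) * t)"
      by (simp_all add: cis_mult algebra_simps)
    ultimately show ?thesis
      unfolding E_def by (simp only: right_diff_distrib left_diff_distrib mult.assoc mult.left_commute mult.commute)
  qed
  then have "\<Lambda> (\<lambda>t. cis (u * of_int m * t) * (\<Prod>j\<in>{1..Suc d}. of_real ((cmod (cis (u * t) - cis (u * r j)))\<^sup>2)))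
      = 2 * \<Lambda> (E m) - cis (- a) * \<Lambda> (E (m + 1)) - cis a * \<Lambda> (E (m - 1))"
    by (simp add: diff cmult)
  also have "cmod \<dots> \<le> cmod (2 * \<Lambda> (E m)) + cmod (cis (- a) * \<Lambda> (E (m + 1))) + cmod (cis a * \<Lambda> (E (m - 1)))"
    by (intro order_trans[OF norm_triangle_ineq4] add_mono norm_triangle_ineq4 order_refl)
  also have "\<dots> = 2 * cmod (\<Lambda> (E m)) + cmod (\<Lambda> (E (m + 1))) + cmod (\<Lambda> (E (m - 1)))"
    by (simp add: norm_mult)
  also have "\<dots> \<le> 2 * (4 ^ d * \<tau>) + 4 ^ d * \<tau> + 4 ^ d * \<tau>"
    using Suc.IH[of m] Suc.IH[of "m + 1"] Suc.IH[of "m - 1"] Suc.prems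
    unfolding E_def P_def by (intro add_mono mult_left_mono) auto
  finally show ?case by (simp add: mult.commute)
qed

text \<open>Two atoms within less than \<gamma> / 2 of the same \<open>r i\<close> would be closer
  than \<gamma> to each other, and there is one \<open>r i\<close> too few for an injective
  assignment.\<close>

lemma separated_point:
  fixes \<theta> r :: "nat \<Rightarrow> real"
  assumes sep: "\<And>i j. i \<in> {1..k} \<Longrightarrow> j \<in> {1..k} \<Longrightarrow> i \<noteq> j \<Longrightarrow> \<gamma> \<le> \<bar>\<theta> i - \<theta> j\<bar>" and "1 \<le> k"
  shows "\<exists>j\<in>{1..k}. \<forall>i\<in>{1..k - 1}. \<gamma> / 2 \<le> \<bar>\<theta> j - r i\<bar>"
proof (rule ccontr)
  assume "\<not> ?thesis"
  then have "\<forall>j\<in>{1..k}. \<exists>i\<in>{1..k - 1}. \<bar>\<theta> j - r i\<bar> < \<gamma> / 2" by (auto simp: not_le)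
  then obtain g where g: "\<And>j. j \<in> {1..k} \<Longrightarrow> g j \<in> {1..k - 1} \<and> \<bar>\<theta> j - r (g j)\<bar> < \<gamma> / 2" by metis
  then have "g ` {1..k} \<subseteq> {1..k - 1}" by blast
  then have "card (g ` {1..k}) < card {1..k}"
    using card_mono[of "{1..k - 1}" "g ` {1..k}"] \<open>1 \<le> k\<close> by simp
  then obtain i j where ij: "i \<in> {1..k}" "j \<in> {1..k}" "i \<noteq> j" "g i = g j"
    using pigeonhole unfolding inj_on_def by blast
  then show False using sep[OF ij(1-3)] g[OF ij(1)] g[OF ij(2)] by (auto simp: abs_if split: if_splits)
qed

text \<open>If all these exponential sums nearly agreed, the two integrals of the separating
  polynomial would nearly agree as well, although one vanishes and the other does not. The
  assumption \<open>close\<close> keeps all angles below 1, so chords are comparable to arcs and no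
  aliasing occurs.\<close>

lemma frequency_separation:
  fixes \<theta> r v w :: "nat \<Rightarrow> real"
  assumes k: "1 \<le> k" and sep: "\<And>i j. i \<in> {1..k} \<Longrightarrow> j \<in> {1..k} \<Longrightarrow> i \<noteq> j \<Longrightarrow> \<gamma> \<le> \<bar>\<theta> i - \<theta> j\<bar>"
    and w: "\<And>j. j \<in> {1..k} \<Longrightarrow> \<omega> \<le> w j" and pos: "0 < \<omega>" "0 < \<gamma>" "0 < u"
    and close: "\<And>i j. i \<in> {1..k - 1} \<Longrightarrow> j \<in> {1..k} \<Longrightarrow> u * \<bar>\<theta> j - r i\<bar> \<le> 1"
  shows "\<exists>m::int. \<bar>m\<bar> \<le> int (k - 1) \<and>
    \<omega> * (u * \<gamma> / 8) ^ (2 * (k - 1)) / 2 \<le>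
      cmod ((\<Sum>j\<in>{1..k}. w j * cis (u * of_int m * \<theta> j)) - (\<Sum>i\<in>{1..k - 1}. v i * cis (u * of_int m * r i)))"
proof (rule ccontr)
  define \<Lambda> where "\<Lambda> f = (\<Sum>j\<in>{1..k}. of_real (w j) * f (\<theta> j)) - (\<Sum>i\<in>{1..k - 1}. of_real (v i) * f (r i))"
    for f :: "real \<Rightarrow> complex"
  define p where "p t = (\<Prod>j\<in>{1..k - 1}. (cmod (cis (u * t) - cis (u * r j)))\<^sup>2)" for t
  \<comment> \<open>A lower bound for the integral of \<open>p\<close> against the truth, obtained
    from one distant atom alone.\<close>
  define \<delta> where "\<delta> = \<omega> * (u * \<gamma> / 4) ^ (2 * (k - 1))"
  have "\<delta> > 0" using pos by (simp add: \<delta>_def)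
  \<comment> \<open>The 8 in place of 4 pays for the factor 4^(k - 1) lost in expanding the
    polynomial; the further 1/2 makes the contradiction \<delta> \<le> \<delta> / 2 strict.\<close>
  have \<delta>: "\<omega> * (u * \<gamma> / 8) ^ (2 * (k - 1)) / 2 = \<delta> / 4 ^ (k - 1) / 2"
  proof -
    have "(u * \<gamma> / 8) ^ (2 * (k - 1)) = ((u * \<gamma> / 4) / 2) ^ (2 * (k - 1))" by simp
    also have "\<dots> = (u * \<gamma> / 4) ^ (2 * (k - 1)) / 4 ^ (k - 1)"
      unfolding power_divide by (simp add: power_mult)
    finally show ?thesis by (simp add: \<delta>_def)
  qed
  assume "\<not> ?thesis"
  then have "cmod (\<Lambda> (\<lambda>t. cis (u * of_int m * t))) \<le> \<delta> / 4 ^ (k - 1) / 2" if "\<bar>m\<bar> \<le> int (k - 1)" for m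
    unfolding \<delta> \<Lambda>_def using that by (meson le_cases)
  from trig_product_le[of \<Lambda> "k - 1" u, OF _ _ this, of 0 "k - 1" r]
  have "cmod (\<Lambda> (\<lambda>t. of_real (p t))) \<le> \<delta> / 2"
    by (simp add: \<Lambda>_def p_def sum_subtractf sum_distrib_left algebra_simps)
  moreover have "\<Lambda> (\<lambda>t. of_real (p t)) = of_real (\<Sum>j\<in>{1..k}. w j * p (\<theta> j))"
  proof -
    have "p (r i) = 0" if "i \<in> {1..k - 1}" for i
      unfolding p_def using that by (intro prod_zero) auto
    then show ?thesis by (simp add: \<Lambda>_def)
  qed
  moreover have "\<delta> \<le> (\<Sum>j\<in>{1..k}. w j * p (\<theta> j))"
  proof -
    obtain j where j: "j \<in> {1..k}" "\<And>i. i \<in> {1..k - 1} \<Longrightarrow> \<gamma> / 2 \<le> \<bar>\<theta> j - r i\<bar>"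
      using separated_point[where \<theta> = \<theta> and r = r and \<gamma> = \<gamma>, OF sep k] by blast
    \<comment> \<open>The angle is at least u \<gamma> / 2, and the chord at least half of
      that.\<close>
    have "(u * \<gamma> / 4)\<^sup>2 \<le> (cmod (cis (u * \<theta> j) - cis (u * r i)))\<^sup>2" if i: "i \<in> {1..k - 1}" for i
    proof (rule power_mono)
      have "u * \<gamma> / 4 \<le> u * \<bar>\<theta> j - r i\<bar> / 2"
        using mult_left_mono[OF j(2)[OF i], of u] pos by simp
      also have "u * \<bar>\<theta> j - r i\<bar> = \<bar>u * \<theta> j - u * r i\<bar>"
        using pos by (simp add: abs_mult flip: right_diff_distrib)
      also have "\<dots> / 2 \<le> cmod (cis (u * \<theta> j) - cis (u * r i))"
        using close[OF i j(1)] pos by (intro cmod_cis_diff_ge) (simp add: abs_mult flip: right_diff_distrib)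
      finally show "u * \<gamma> / 4 \<le> cmod (cis (u * \<theta> j) - cis (u * r i))" .
    qed (use pos in auto)
    then have "(\<Prod>i\<in>{1..k - 1}. (u * \<gamma> / 4)\<^sup>2) \<le> p (\<theta> j)"
      unfolding p_def by (intro prod_mono) auto
    then have "(u * \<gamma> / 4) ^ (2 * (k - 1)) \<le> p (\<theta> j)" by (simp add: power_mult)
    then have "\<delta> \<le> w j * p (\<theta> j)"
      unfolding \<delta>_def using w[OF j(1)] pos by (intro mult_mono) auto
    also have "\<dots> \<le> (\<Sum>j\<in>{1..k}. w j * p (\<theta> j))"
    proof (rule member_le_sum[OF j(1)])
      fix i assume "i \<in> {1..k} - {j}"
      then have "0 \<le> w i" using w[of i] pos by auto
      moreover have "0 \<le> p (\<theta> i)" unfolding p_def by (intro prod_nonneg) auto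
      ultimately show "0 \<le> w i * p (\<theta> i)" by simp
    qed simp
    finally show ?thesis .
  qed
  ultimately show False
    using \<open>\<delta> > 0\<close> by (simp only: norm_of_real)
qed

section \<open>A test based on empirical Fourier coefficients\<close>

lemma indep_vars_PiM_coordinates:
  assumes G: "prob_space G" "sets G = sets borel" and I: "finite I" "I \<noteq> {}"
  shows "prob_space.indep_vars (\<Pi>\<^sub>M i\<in>I. G) (\<lambda>_. borel) (\<lambda>i x. x i) I"
proof -
  interpret G: prob_space G by fact
  interpret product_prob_space "\<lambda>_. G" I by unfold_locales
  have comp: "distr (\<Pi>\<^sub>M i\<in>I. G) borel (\<lambda>x. x i) = G" if "i \<in> I" for i
  proof -
    have "distr (\<Pi>\<^sub>M i\<in>I. G) borel (\<lambda>x. x i) = distr (\<Pi>\<^sub>M i\<in>I. G) G (\<lambda>x. x i)"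
      using G(2) by (intro distr_cong) auto
    then show ?thesis using PiM_component[OF that] by simp
  qed
  have "distr (\<Pi>\<^sub>M i\<in>I. G) (\<Pi>\<^sub>M i\<in>I. borel) (\<lambda>x. \<lambda>i\<in>I. x i) = (\<Pi>\<^sub>M i\<in>I. G)"
  proof -
    have "distr (\<Pi>\<^sub>M i\<in>I. G) (\<Pi>\<^sub>M i\<in>I. borel) (\<lambda>x. \<lambda>i\<in>I. x i)
        = distr (\<Pi>\<^sub>M i\<in>I. G) (\<Pi>\<^sub>M i\<in>I. G) (\<lambda>x. x)"
      using G(2) by (intro distr_cong sets_PiM_cong) (auto simp: space_PiM extensional_restrict PiE_iff)
    then show ?thesis by simp
  qed
  also have "\<dots> = (\<Pi>\<^sub>M i\<in>I. distr (\<Pi>\<^sub>M i\<in>I. G) borel (\<lambda>x. x i))"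
    using comp by (intro PiM_cong) auto
  finally show ?thesis
    using I G(2) by (subst indep_vars_iff_distr_eq_PiM') (auto cong: measurable_cong_sets)
qed

lemma Hoeffding_sample:
  assumes G: "prob_space G" "sets G = sets borel" and n: "1 \<le> n" and \<tau>: "0 \<le> \<tau>"
    and h [measurable]: "h \<in> borel_measurable borel" and bd: "\<And>y. \<bar>h y\<bar> \<le> (1::real)"
  shows "emeasure (sample n G)
      {x \<in> space (sample n G). \<bar>(\<Sum>i\<in>{1..n}. h (x i)) - real n * (\<integral>y. h y \<partial>G)\<bar> \<ge> real n * \<tau>}
    \<le> ennreal (2 * exp (- real n * \<tau>\<^sup>2 / 2))"
proof -
  interpret G: prob_space G by fact
  interpret P: product_prob_space "\<lambda>_. G" "{1..n}" by unfold_locales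
  have bd': "- 1 \<le> h y" "h y \<le> 1" for y using bd[of y] by auto
  have ne: "{1..n} \<noteq> {}" using n by auto
  have indep: "P.indep_vars (\<lambda>_. borel) (\<lambda>i x. h (x i)) {1..n}"
    using P.indep_vars_compose2[OF indep_vars_PiM_coordinates[OF G _ ne], of "\<lambda>_. h" "\<lambda>_. borel"] by simp
  have expect: "(\<integral>x. h (x i) \<partial>(\<Pi>\<^sub>M i\<in>{1..n}. G)) = (\<integral>y. h y \<partial>G)" if "i \<in> {1..n}" for i
  proof -
    have "(\<integral>y. h y \<partial>distr (\<Pi>\<^sub>M i\<in>{1..n}. G) G (\<lambda>x. x i)) = (\<integral>x. h (x i) \<partial>(\<Pi>\<^sub>M i\<in>{1..n}. G))"
      using that G(2) by (intro integral_distr) (auto cong: measurable_cong_sets)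
    then show ?thesis using P.PiM_component[OF that] by simp
  qed
  interpret H: indep_interval_bounded_random_variables "\<Pi>\<^sub>M i\<in>{1..n}. G" "{1..n}" "\<lambda>i x. h (x i)" "\<lambda>_. - 1" "\<lambda>_. 1"
    by (rule indep_interval_bounded_random_variables.intro[OF P.prob_space_axioms], unfold_locales)
      (use indep bd' in auto)
  have mean: "real n * (\<integral>y. h y \<partial>G) = (\<Sum>i\<in>{1..n}. P.expectation (\<lambda>x. h (x i)))"
    using expect by simp
  have "P.prob {x \<in> space (\<Pi>\<^sub>M i\<in>{1..n}. G). \<bar>(\<Sum>i\<in>{1..n}. h (x i)) - real n * (\<integral>y. h y \<partial>G)\<bar> \<ge> real n * \<tau>}
      \<le> 2 * exp (- 2 * (real n * \<tau>)\<^sup>2 / (\<Sum>i\<in>{1..n}. (1 - (- 1))\<^sup>2))"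
    unfolding mean
    by (rule Hoeffding_ineq.Hoeffding_ineq_abs_ge[OF Hoeffding_ineq.intro[OF H.indep_interval_bounded_random_variables_axioms]])
      (use \<tau> n in auto)
  \<comment> \<open>Each summand ranges over an interval of length 2, so the denominator is 4
    n.\<close>
  also have "- 2 * (real n * \<tau>)\<^sup>2 / (\<Sum>i\<in>{1..n}. (1 - (- 1))\<^sup>2) = - real n * \<tau>\<^sup>2 / 2"
    using n by (simp add: power2_eq_square)
  finally show ?thesis
    unfolding sample_def P.emeasure_eq_measure by (intro ennreal_leI)
qed

section \<open>Characteristic functions of Gaussian mixtures\<close>

lemma has_bochner_integral_normal_cis:
  "has_bochner_integral lborel (\<lambda>y. normal_density \<theta> 1 y *\<^sub>R cis (s * y)) (of_real (exp (- s\<^sup>2 / 2)) * cis (s * \<theta>))"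
proof -
  have "integrable std_normal_distribution (\<lambda>y. cis (s * y))"
  proof -
    interpret real_distribution std_normal_distribution by (rule real_dist_normal_dist)
    show ?thesis
      by (rule integrable_const_bound[where B=1]) (auto simp: cis_conv_exp)
  qed
  then have "integrable lborel (\<lambda>y. std_normal_density y *\<^sub>R cis (s * y))"
    by (subst (asm) integrable_density) (auto simp: cis_conv_exp)
  moreover have "(\<integral>y. std_normal_density y *\<^sub>R cis (s * y) \<partial>lborel) = exp (- s\<^sup>2 / 2)"
    using fun_cong[OF char_std_normal_distribution, of s] unfolding char_def
    by (subst (asm) integral_density) (auto simp: cis_conv_exp)
  ultimately have "has_bochner_integral lborel (\<lambda>y. std_normal_density y *\<^sub>R cis (s * y)) (exp (- s\<^sup>2 / 2))"
    by (simp add: has_bochner_integral_iff)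
  then have "has_bochner_integral lborel
      (\<lambda>y. std_normal_density (- \<theta> + 1 * y) *\<^sub>R cis (s * (- \<theta> + 1 * y))) (exp (- s\<^sup>2 / 2))"
    using lborel_has_bochner_integral_real_affine_iff[of 1 "\<lambda>y. std_normal_density y *\<^sub>R cis (s * y)"
        "complex_of_real (exp (- s\<^sup>2 / 2))" "- \<theta>"] by simp
  then have "has_bochner_integral lborel
      (\<lambda>y. cis (s * \<theta>) * (std_normal_density (- \<theta> + 1 * y) *\<^sub>R cis (s * (- \<theta> + 1 * y)))) (cis (s * \<theta>) * exp (- s\<^sup>2 / 2))"
    by (rule has_bochner_integral_mult_right)
  moreover have "cis (s * \<theta>) * (std_normal_density (- \<theta> + 1 * y) *\<^sub>R cis (s * (- \<theta> + 1 * y)))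
      = normal_density \<theta> 1 y *\<^sub>R cis (s * y)" for y
    by (simp add: normal_density_def cis_mult algebra_simps)
  ultimately show ?thesis by (simp add: mult.commute)
qed

text \<open>The Gaussian damping depends on the frequency but not on the atoms. Hence the
  characteristic functions of two mixtures differ by the damped difference of the exponential sums
  of their mixing distributions.\<close>

lemma integral_cis_gauss_mixture:
  assumes w: "w \<in> weights k"
  shows "(\<integral>y. cis (s * y) \<partial>gauss_mixture (atomic k w \<theta>))
    = of_real (exp (- s\<^sup>2 / 2)) * (\<Sum>j\<in>{1..k}. of_real (w j) * cis (s * \<theta> j))"
proof -
  define p where "p y = (\<Sum>j\<in>{1..k}. w j * normal_density (\<theta> j) 1 y)" for y
  have w0: "0 \<le> w j" if "j \<in> {1..k}" for j using w that by (auto simp: weights_def PiE_iff)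
  have p0: "0 \<le> p y" for y unfolding p_def using w0 by (intro sum_nonneg) auto
  have [measurable]: "p \<in> borel_measurable borel" unfolding p_def normal_density_def by measurable
  have "mixture_density (atomic k w \<theta>) = (\<lambda>y. ennreal (p y))"
    unfolding mixture_density_atomic[abs_def] p_def using w0
    by (intro ext, subst sum_ennreal[symmetric]) (auto simp: ennreal_mult)
  then have "gauss_mixture (atomic k w \<theta>) = density lborel (\<lambda>y. ennreal (p y))"
    using gauss_mixture_density[OF prob_space_atomic[OF w]] by simp
  then have "(\<integral>y. cis (s * y) \<partial>gauss_mixture (atomic k w \<theta>)) = (\<integral>y. p y *\<^sub>R cis (s * y) \<partial>lborel)"
    using p0 by (simp add: integral_density cis_conv_exp)
  also have "\<dots> = (\<integral>y. (\<Sum>j\<in>{1..k}. of_real (w j) * (normal_density (\<theta> j) 1 y *\<^sub>R cis (s * y))) \<partial>lborel)"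
    by (simp add: p_def scaleR_conv_of_real sum_distrib_right mult.assoc)
  also have "\<dots> = (\<Sum>j\<in>{1..k}. of_real (w j) * (of_real (exp (- s\<^sup>2 / 2)) * cis (s * \<theta> j)))"
    by (intro has_bochner_integral_integral_eq has_bochner_integral_sum has_bochner_integral_mult_right
        has_bochner_integral_normal_cis)
  finally show ?thesis by (simp add: sum_distrib_left mult.left_commute)
qed

lemma cis_integral_diff_le:
  assumes "prob_space G" "sets G = sets borel" "prob_space H" "sets H = sets borel"
  shows "cmod ((\<integral>y. cis (s * y) \<partial>G) - (\<integral>y. cis (s * y) \<partial>H))
    \<le> \<bar>(\<integral>y. cos (s * y) \<partial>G) - (\<integral>y. cos (s * y) \<partial>H)\<bar> + \<bar>(\<integral>y. sin (s * y) \<partial>G) - (\<integral>y. sin (s * y) \<partial>H)\<bar>"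
proof -
  have "Re (\<integral>y. cis (s * y) \<partial>G) = (\<integral>y. cos (s * y) \<partial>G) \<and> Im (\<integral>y. cis (s * y) \<partial>G) = (\<integral>y. sin (s * y) \<partial>G)"
    if "prob_space G" "sets G = sets borel" for G
  proof -
    interpret prob_space G by fact
    note that(2)[measurable_cong]
    have "(\<lambda>y. cis (s * y)) \<in> borel_measurable G" by (simp add: cis_conv_exp)
    then have "integrable G (\<lambda>y. cis (s * y))"
      by (intro integrable_const_bound[where B=1]) auto
    from integral_Re[OF this] integral_Im[OF this] show ?thesis by simp
  qed
  from this[OF assms(1,2)] this[OF assms(3,4)] show ?thesis
    using cmod_le[of "(\<integral>y. cis (s * y) \<partial>G) - (\<integral>y. cis (s * y) \<partial>H)"] by simp
qed

text \<open>The region is built from \<open>G\<close> and \<open>F\<close> alone, so it serves all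
  alternatives at once. Under \<open>G\<close> a union bound over the cosine and sine of every
  frequency is paid, with 2 exp(...) for each; an alternative has to be caught at a single frequency
  only.\<close>

lemma frequency_test:
  fixes F :: "real set"
  assumes G: "prob_space G" "sets G = sets borel" and n: "1 \<le> n" and \<tau>: "0 \<le> \<tau>" and F: "finite F"
  shows "\<exists>R\<in>sets (\<Pi>\<^sub>M i\<in>{1..n}. borel).
    emeasure (sample n G) R \<le> ennreal (4 * real (card F) * exp (- real n * \<tau>\<^sup>2 / 2)) \<and>
    (\<forall>H. prob_space H \<longrightarrow> sets H = sets borel \<longrightarrow>
      (\<exists>s\<in>F. 4 * \<tau> \<le> cmod ((\<integral>y. cis (s * y) \<partial>G) - (\<integral>y. cis (s * y) \<partial>H))) \<longrightarrow>
      emeasure (sample n H) (space (\<Pi>\<^sub>M i\<in>{1..n}. borel) - R) \<le> ennreal (2 * exp (- real n * \<tau>\<^sup>2 / 2)))"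
proof -
  define E :: real where "E = 2 * exp (- real n * \<tau>\<^sup>2 / 2)"
  define D where "D H h = {x \<in> space (\<Pi>\<^sub>M i\<in>{1..n}. borel). \<bar>(\<Sum>i\<in>{1..n}. h (x i)) - real n * (\<integral>y. h y \<partial>H)\<bar> \<ge> real n * \<tau>}"
    for H and h :: "real \<Rightarrow> real"
  define R where "R = (\<Union>s\<in>F. D G (\<lambda>y. cos (s * y)) \<union> D G (\<lambda>y. sin (s * y)))"
  have D_sets: "D H h \<in> sets (\<Pi>\<^sub>M i\<in>{1..n}. borel)" if [measurable]: "h \<in> borel_measurable borel" for H h
    unfolding D_def by measurable
  have sets_sample: "sets (sample n H) = sets (\<Pi>\<^sub>M i\<in>{1..n}. borel)" if "sets H = sets borel" for H
    unfolding sample_def using that by (intro sets_PiM_cong) auto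
  have D: "emeasure (sample n H) (D H h) \<le> ennreal E"
    if "prob_space H" "sets H = sets borel" "h \<in> borel_measurable borel" "\<And>y. \<bar>h y\<bar> \<le> 1" for H h
    using Hoeffding_sample[OF that(1,2) n \<tau> that(3,4)] sets_eq_imp_space_eq[OF sets_sample[OF that(2)]]
    unfolding D_def E_def by simp
  show ?thesis
  proof (intro bexI[of _ R] conjI allI impI)
    show "R \<in> sets (\<Pi>\<^sub>M i\<in>{1..n}. borel)"
      unfolding R_def using F by (intro sets.finite_UN sets.Un D_sets) auto
    have "emeasure (sample n G) R \<le> (\<Sum>s\<in>F. emeasure (sample n G) (D G (\<lambda>y. cos (s * y)) \<union> D G (\<lambda>y. sin (s * y))))"
      unfolding R_def using F sets_sample[OF G(2)] D_sets by (intro emeasure_subadditive_finite) auto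
    also have "\<dots> \<le> (\<Sum>s\<in>F. ennreal E + ennreal E)"
      using sets_sample[OF G(2)] D_sets
      by (intro sum_mono order_trans[OF emeasure_subadditive] add_mono D G) auto
    also have "\<dots> = ennreal (4 * real (card F) * exp (- real n * \<tau>\<^sup>2 / 2))"
      by (simp add: E_def ennreal_of_nat_eq_real_of_nat flip: ennreal_plus ennreal_mult)
    finally show "emeasure (sample n G) R \<le> \<dots>" .
    fix H assume H: "prob_space H" "sets H = sets borel"
      and "\<exists>s\<in>F. 4 * \<tau> \<le> cmod ((\<integral>y. cis (s * y) \<partial>G) - (\<integral>y. cis (s * y) \<partial>H))"
    then obtain s where s: "s \<in> F" "4 * \<tau> \<le> cmod ((\<integral>y. cis (s * y) \<partial>G) - (\<integral>y. cis (s * y) \<partial>H))" by auto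
    \<comment> \<open>A complex gap of 4 \<tau> forces a gap of 2 \<tau> in the cosine or in the
      sine part.\<close>
    obtain h where h: "h \<in> borel_measurable borel" "\<And>y. \<bar>h y\<bar> \<le> (1::real)" "D G h \<subseteq> R"
      and dist: "2 * \<tau> \<le> \<bar>(\<integral>y. h y \<partial>G) - (\<integral>y. h y \<partial>H)\<bar>"
    proof (cases "2 * \<tau> \<le> \<bar>(\<integral>y. cos (s * y) \<partial>G) - (\<integral>y. cos (s * y) \<partial>H)\<bar>")
      case True
      show thesis by (rule that[of "\<lambda>y. cos (s * y)"]) (use True s(1) in \<open>auto simp: R_def\<close>)
    next
      case False
      then have "2 * \<tau> \<le> \<bar>(\<integral>y. sin (s * y) \<partial>G) - (\<integral>y. sin (s * y) \<partial>H)\<bar>"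
        using cis_integral_diff_le[OF G H, of s] s(2) by linarith
      then show thesis by (intro that[of "\<lambda>y. sin (s * y)"]) (use s(1) in \<open>auto simp: R_def\<close>)
    qed
    \<comment> \<open>Outside \<open>R\<close> the empirical mean is within \<tau> of its value
      under \<open>G\<close>, so it misses its value under \<open>H\<close> by at least
      \<tau>.\<close>
    have "space (\<Pi>\<^sub>M i\<in>{1..n}. borel) - R \<subseteq> D H h"
    proof
      fix x assume x: "x \<in> space (\<Pi>\<^sub>M i\<in>{1..n}. borel) - R"
      then have "\<bar>(\<Sum>i\<in>{1..n}. h (x i)) - real n * (\<integral>y. h y \<partial>G)\<bar> < real n * \<tau>"
        using h(3) by (auto simp: D_def not_le)
      moreover have "2 * (real n * \<tau>) \<le> \<bar>real n * (\<integral>y. h y \<partial>G) - real n * (\<integral>y. h y \<partial>H)\<bar>"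
        using mult_left_mono[OF dist, of "real n"] by (simp add: abs_mult flip: right_diff_distrib)
      ultimately show "x \<in> D H h" using x unfolding D_def by auto
    qed
    then have "emeasure (sample n H) (space (\<Pi>\<^sub>M i\<in>{1..n}. borel) - R) \<le> emeasure (sample n H) (D H h)"
      using D_sets[OF h(1)] sets_sample[OF H(2)] by (intro emeasure_mono) auto
    also have "\<dots> \<le> ennreal (2 * exp (- real n * \<tau>\<^sup>2 / 2))"
      using D[OF H h(1,2)] by (simp add: E_def)
    finally show "emeasure (sample n H) (space (\<Pi>\<^sub>M i\<in>{1..n}. borel) - R) \<le> \<dots>" .
  qed
qed

text \<open>The frequency scale \<open>1 / sqrt k\<close> balances the Gaussian damping \<open>exp (- s\<^sup>2 / 2)\<close> of the highest
  of the \<open>k\<close> frequencies against the size of the separating trigonometric polynomial.\<close>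

lemma component_number_test:
  assumes L: "0 < L" and k: "1 \<le> k" and n: "1 \<le> n" and pos: "0 < \<gamma>" "0 < \<omega>" and \<tau>: "0 \<le> \<tau>"
    and w: "w \<in> weights k" and \<theta>: "\<theta> \<in> locations L k"
    and sep: "\<And>i j. i \<in> {1..k} \<Longrightarrow> j \<in> {1..k} \<Longrightarrow> i \<noteq> j \<Longrightarrow> \<gamma> \<le> \<bar>\<theta> i - \<theta> j\<bar>"
    and w_ge: "\<And>j. j \<in> {1..k} \<Longrightarrow> \<omega> \<le> w j"
    and \<tau>_le: "4 * \<tau> \<le> exp (- real k / 2) * (\<omega> * (\<gamma> / (16 * (1 + L) * sqrt (real k))) ^ (2 * (k - 1)) / 2)"
  shows "\<exists>R\<in>sets (\<Pi>\<^sub>M i\<in>{1..n}. borel).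
    emeasure (sample n (gauss_mixture (atomic k w \<theta>))) R \<le> ennreal (8 * real k * exp (- real n * \<tau>\<^sup>2 / 2)) \<and>
    (\<forall>\<nu>\<in>mixing L (k - 1). emeasure (sample n (gauss_mixture \<nu>)) (space (\<Pi>\<^sub>M i\<in>{1..n}. borel) - R)
        \<le> ennreal (2 * exp (- real n * \<tau>\<^sup>2 / 2)))"
proof -
  \<comment> \<open>Atoms are at distance at most 2 L, so the factor 2 (1 + L) keeps all angles
    below 1. The square root balances damping and separation.\<close>
  define u where "u = 1 / (2 * (1 + L) * sqrt (real k))"
  define F where "F = (\<lambda>m. u * of_int m) ` {- int (k - 1)..int (k - 1)}"
  have u: "0 < u" using L k by (simp add: u_def)
  have "card F \<le> 2 * k"
    unfolding F_def using k by (intro order_trans[OF card_image_le]) auto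
  then have F: "4 * real (card F) * exp (- real n * \<tau>\<^sup>2 / 2) \<le> 8 * real k * exp (- real n * \<tau>\<^sup>2 / 2)"
    by (intro mult_right_mono) auto
  let ?\<nu> = "atomic k w \<theta>"
  have G: "prob_space (gauss_mixture ?\<nu>)" by (rule prob_space_gauss_mixture) (auto intro: prob_space_atomic w)
  have far: "\<exists>s\<in>F. 4 * \<tau> \<le> cmod ((\<integral>y. cis (s * y) \<partial>gauss_mixture ?\<nu>) - (\<integral>y. cis (s * y) \<partial>gauss_mixture \<nu>))"
    if \<nu>: "\<nu> \<in> mixing L (k - 1)" for \<nu>
  proof -
    obtain v r where \<nu>_eq: "\<nu> = atomic (k - 1) v r" and v: "v \<in> weights (k - 1)" and r: "r \<in> locations L (k - 1)"
      using \<nu> by (auto simp: mixing_def)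
    have "u * \<bar>\<theta> j - r i\<bar> \<le> 1" if "i \<in> {1..k - 1}" "j \<in> {1..k}" for i j
    proof -
      have "\<theta> j \<in> {- L..L}" "r i \<in> {- L..L}" using that \<theta> r by (auto simp: locations_def PiE_iff)
      then have "\<bar>\<theta> j - r i\<bar> \<le> 2 * L" by auto
      also have "\<dots> \<le> 2 * (1 + L) * sqrt (real k)"
        using mult_mono[of "2 * L" "2 * (1 + L)" 1 "sqrt (real k)"] L k by simp
      finally show ?thesis using L k by (simp add: u_def)
    qed
    from frequency_separation[where \<theta> = \<theta> and r = r and w = w and v = v, OF k sep w_ge pos(2,1) u this]
    obtain m :: int where m: "\<bar>m\<bar> \<le> int (k - 1)"
      and diff: "\<omega> * (u * \<gamma> / 8) ^ (2 * (k - 1)) / 2 \<le>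
      cmod ((\<Sum>j\<in>{1..k}. w j * cis (u * of_int m * \<theta> j)) - (\<Sum>i\<in>{1..k - 1}. v i * cis (u * of_int m * r i)))"
      by blast
    define s where "s = u * of_int m"
    have "s \<in> F" unfolding F_def s_def by (rule imageI) (use m in auto)
    moreover have "4 * \<tau> \<le> cmod ((\<integral>y. cis (s * y) \<partial>gauss_mixture ?\<nu>) - (\<integral>y. cis (s * y) \<partial>gauss_mixture \<nu>))"
    proof -
      have "s\<^sup>2 \<le> real k"
      proof -
        have "\<bar>of_int m\<bar> \<le> real k" using m k by linarith
        then have "\<bar>s\<bar> \<le> u * real k" using u by (simp add: s_def abs_mult)
        also have "\<dots> = sqrt (real k) / (2 * (1 + L))"
        proof -
          have "u * (sqrt (real k) * sqrt (real k)) = sqrt (real k) / (2 * (1 + L))"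
            using k by (simp add: u_def del: real_sqrt_mult_self)
          then show ?thesis by simp
        qed
        also have "\<dots> \<le> sqrt (real k)" using L by (simp add: divide_le_eq mult_le_cancel_left1)
        finally show ?thesis using abs_le_square_iff[of s "sqrt (real k)"] by simp
      qed
      \<comment> \<open>The largest frequency is at most u k \<le> sqrt k, so the damping never
        falls below exp(-k/2).\<close>
      then have "exp (- real k / 2) \<le> exp (- s\<^sup>2 / 2)" by simp
      moreover have c: "\<gamma> / (16 * (1 + L) * sqrt (real k)) = u * \<gamma> / 8" by (simp add: u_def)
      ultimately have "4 * \<tau> \<le> exp (- s\<^sup>2 / 2) *
          cmod ((\<Sum>j\<in>{1..k}. w j * cis (s * \<theta> j)) - (\<Sum>i\<in>{1..k - 1}. v i * cis (s * r i)))"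
        using diff pos u L unfolding s_def
        by (intro order_trans[OF \<tau>_le[unfolded c]] mult_mono) simp_all
      also have "\<dots> = cmod ((\<integral>y. cis (s * y) \<partial>gauss_mixture ?\<nu>) - (\<integral>y. cis (s * y) \<partial>gauss_mixture \<nu>))"
        unfolding \<nu>_eq integral_cis_gauss_mixture[OF w] integral_cis_gauss_mixture[OF v]
        by (simp add: norm_mult flip: right_diff_distrib)
      finally show ?thesis .
    qed
    ultimately show ?thesis by blast
  qed
  obtain R where R: "R \<in> sets (\<Pi>\<^sub>M i\<in>{1..n}. borel)"
    "emeasure (sample n (gauss_mixture ?\<nu>)) R \<le> ennreal (4 * real (card F) * exp (- real n * \<tau>\<^sup>2 / 2))"
    "\<And>H. prob_space H \<Longrightarrow> sets H = sets borel \<Longrightarrow>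
      (\<exists>s\<in>F. 4 * \<tau> \<le> cmod ((\<integral>y. cis (s * y) \<partial>gauss_mixture ?\<nu>) - (\<integral>y. cis (s * y) \<partial>H))) \<Longrightarrow>
      emeasure (sample n H) (space (\<Pi>\<^sub>M i\<in>{1..n}. borel) - R) \<le> ennreal (2 * exp (- real n * \<tau>\<^sup>2 / 2))"
    using frequency_test[OF G sets_gauss_mixture n \<tau>, of F] by (auto simp: F_def)
  show ?thesis
  proof (intro bexI[OF _ R(1)] conjI ballI)
    show "emeasure (sample n (gauss_mixture ?\<nu>)) R \<le> ennreal (8 * real k * exp (- real n * \<tau>\<^sup>2 / 2))"
      using R(2) ennreal_leI[OF F] by (rule order_trans)
    fix \<nu> assume \<nu>: "\<nu> \<in> mixing L (k - 1)"
    then show "emeasure (sample n (gauss_mixture \<nu>)) (space (\<Pi>\<^sub>M i\<in>{1..n}. borel) - R)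
        \<le> ennreal (2 * exp (- real n * \<tau>\<^sup>2 / 2))"
      using mixing_in_prob_algebra[OF \<nu>]
      by (intro R(3) prob_space_gauss_mixture far) (auto simp: space_prob_algebra)
  qed
qed

section \<open>Neighbourhoods of the truth and the prior\<close>

text \<open>The weights are changed first at the old locations, then the locations are moved under
  the new weights: w a - v b = (w - v) a + v (a - b) in each term.\<close>

lemma mixture_density_atomic_diff_le:
  assumes v: "v \<in> weights k"
  shows "mixture_density (atomic k w \<theta>) y - mixture_density (atomic k v r) y
    \<le> (\<Sum>j\<in>{1..k}. ennreal \<bar>w j - v j\<bar> * ennreal (normal_density (\<theta> j) 1 y)
        + ennreal (v j) * (ennreal (normal_density (\<theta> j) 1 y) - ennreal (normal_density (r j) 1 y)))"
proof -
  have term_le: "ennreal (w j) * a \<le> ennreal (v j) * b + (ennreal \<bar>w j - v j\<bar> * a + ennreal (v j) * (a - b))"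
    if "j \<in> {1..k}" for j a b
  proof -
    have "0 \<le> v j" using v that by (auto simp: weights_def PiE_iff)
    then have "ennreal (w j) \<le> ennreal \<bar>w j - v j\<bar> + ennreal (v j)"
      by (simp flip: ennreal_plus add: ennreal_leI)
    then have "ennreal (w j) * a \<le> (ennreal \<bar>w j - v j\<bar> + ennreal (v j)) * a" by (rule mult_right_mono) simp
    also have "\<dots> \<le> ennreal \<bar>w j - v j\<bar> * a + ennreal (v j) * ((a - b) + b)"
      unfolding distrib_right by (intro add_left_mono mult_left_mono ennreal_le_diff_add) auto
    finally show ?thesis by (simp add: distrib_left ac_simps)
  qed
  have "mixture_density (atomic k v r) y \<noteq> \<top>"
    using mixture_density_bounds(2)[OF prob_space_atomic[OF v] sets_atomic, of r y]
    by (auto simp: top_unique)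
  moreover have "mixture_density (atomic k w \<theta>) y \<le> mixture_density (atomic k v r) y
      + (\<Sum>j\<in>{1..k}. ennreal \<bar>w j - v j\<bar> * ennreal (normal_density (\<theta> j) 1 y)
        + ennreal (v j) * (ennreal (normal_density (\<theta> j) 1 y) - ennreal (normal_density (r j) 1 y)))"
    unfolding mixture_density_atomic sum.distrib[symmetric] by (intro sum_mono term_le)
  ultimately show ?thesis by (simp add: ennreal_minus_le_iff)
qed

lemma nn_integral_mixture_density:
  assumes "prob_space \<nu>" "sets \<nu> = sets borel"
  shows "(\<integral>\<^sup>+ y. mixture_density \<nu> y \<partial>lborel) = 1"
proof -
  have "emeasure (gauss_mixture \<nu>) (space (gauss_mixture \<nu>)) = 1"
    using prob_space_gauss_mixture[OF assms] by (rule prob_space.emeasure_space_1)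
  then show ?thesis
    using measurable_mixture_density[OF assms(2,1)]
    by (simp add: gauss_mixture_density[OF assms] emeasure_density)
qed

text \<open>The l1 error of the weights enters as it is; the location errors are averaged by weights
  of sum 1, so their cost does not grow with the number of components. Passing to samples multiplies
  by \<open>n\<close>.\<close>

lemma nn_integral_joint_density_diff_le:
  assumes w: "w \<in> weights k" and v: "v \<in> weights k"
    and a: "(\<Sum>j\<in>{1..k}. \<bar>w j - v j\<bar>) \<le> a" and b: "\<And>j. j \<in> {1..k} \<Longrightarrow> \<bar>\<theta> j - r j\<bar> \<le> b"
  shows "(\<integral>\<^sup>+ x. joint_density n (atomic k w \<theta>) x - joint_density n (atomic k v r) x \<partial>(\<Pi>\<^sub>M i\<in>{1..n}. lborel))
    \<le> ennreal (real n * (a + 2 * b))"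
proof -
  have v0: "0 \<le> v j" if "j \<in> {1..k}" for j using v that by (auto simp: weights_def PiE_iff)
  have int1: "(\<integral>\<^sup>+ y. ennreal (normal_density t 1 y) \<partial>lborel) = 1" for t
    using integral_normal_density[of 1 t] integrable_normal_density[of 1 t]
    by (subst nn_integral_eq_integral) auto
  have m [measurable]: "(\<lambda>y. ennreal (normal_density t 1 y)) \<in> borel_measurable borel" for t
    unfolding normal_density_def by measurable
  have "(\<integral>\<^sup>+ y. mixture_density (atomic k w \<theta>) y - mixture_density (atomic k v r) y \<partial>lborel)
    \<le> (\<integral>\<^sup>+ y. (\<Sum>j\<in>{1..k}. ennreal \<bar>w j - v j\<bar> * ennreal (normal_density (\<theta> j) 1 y)
        + ennreal (v j) * (ennreal (normal_density (\<theta> j) 1 y) - ennreal (normal_density (r j) 1 y))) \<partial>lborel)"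
    by (intro nn_integral_mono mixture_density_atomic_diff_le v)
  also have "\<dots> = (\<Sum>j\<in>{1..k}. ennreal \<bar>w j - v j\<bar>
      + ennreal (v j) * (\<integral>\<^sup>+ y. ennreal (normal_density (\<theta> j) 1 y) - ennreal (normal_density (r j) 1 y) \<partial>lborel))"
    by (simp add: nn_integral_sum nn_integral_add nn_integral_cmult int1)
  also have "\<dots> \<le> (\<Sum>j\<in>{1..k}. ennreal \<bar>w j - v j\<bar> + ennreal (v j) * ennreal (2 * b))"
    using b by (intro sum_mono add_left_mono mult_left_mono order_trans[OF nn_integral_normal_density_diff]) (auto intro!: ennreal_leI)
  also have "\<dots> = (\<Sum>j\<in>{1..k}. ennreal (\<bar>w j - v j\<bar> + v j * (2 * b)))"
  proof (intro sum.cong refl)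
    fix j assume j: "j \<in> {1..k}"
    have "0 \<le> b" using b[OF j] by (rule order_trans[rotated]) simp
    then show "ennreal \<bar>w j - v j\<bar> + ennreal (v j) * ennreal (2 * b) = ennreal (\<bar>w j - v j\<bar> + v j * (2 * b))"
      using v0[OF j] by (simp add: ennreal_mult)
  qed
  also have "\<dots> = ennreal (\<Sum>j\<in>{1..k}. \<bar>w j - v j\<bar> + v j * (2 * b))"
  proof (rule sum_ennreal)
    fix j assume j: "j \<in> {1..k}"
    have "0 \<le> b" using b[OF j] by (rule order_trans[rotated]) simp
    then show "0 \<le> \<bar>w j - v j\<bar> + v j * (2 * b)" using v0[OF j] by simp
  qed
  also have "\<dots> \<le> ennreal (a + 2 * b)"
  proof (rule ennreal_leI)
    have "(\<Sum>j\<in>{1..k}. v j * (2 * b)) = 2 * b"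
      using v by (simp add: weights_def flip: sum_distrib_right)
    then show "(\<Sum>j\<in>{1..k}. \<bar>w j - v j\<bar> + v j * (2 * b)) \<le> a + 2 * b"
      using a by (simp add: sum.distrib)
  qed
  finally have one: "(\<integral>\<^sup>+ y. mixture_density (atomic k w \<theta>) y - mixture_density (atomic k v r) y \<partial>lborel)
    \<le> ennreal (a + 2 * b)" .
  have "(\<integral>\<^sup>+ x. joint_density n (atomic k w \<theta>) x - joint_density n (atomic k v r) x \<partial>(\<Pi>\<^sub>M i\<in>{1..n}. lborel))
    \<le> of_nat (card {1..n}) * (\<integral>\<^sup>+ y. mixture_density (atomic k w \<theta>) y - mixture_density (atomic k v r) y \<partial>lborel)"
    unfolding joint_density_def
    using measurable_mixture_density[OF sets_atomic prob_space_atomic[OF w], of \<theta>]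
      measurable_mixture_density[OF sets_atomic prob_space_atomic[OF v], of r]
      mixture_density_bounds(2)[OF prob_space_atomic[OF w] sets_atomic, of \<theta>]
      mixture_density_bounds(2)[OF prob_space_atomic[OF v] sets_atomic, of r]
      nn_integral_mixture_density[OF prob_space_atomic[OF w] sets_atomic, of \<theta>]
      nn_integral_mixture_density[OF prob_space_atomic[OF v] sets_atomic, of r]
    by (intro nn_integral_prod_diff_le lborel.sigma_finite_measure_axioms) (auto intro: le_less_trans[OF _ ennreal_one_less_top])
  also have "\<dots> \<le> ennreal (real n) * ennreal (a + 2 * b)"
    using one by (intro mult_mono) (auto simp: ennreal_of_nat_eq_real_of_nat)
  also have "\<dots> = ennreal (real n * (a + 2 * b))" by (simp add: ennreal_mult')
  finally show ?thesis .
qed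

section \<open>The prior as a mixture over the number of components\<close>

lemma prior_dataD:
  assumes "prior_data L K W T"
  shows "prob_space K" "sets K = Pow {1..}" "space K = {1..}"
    and "1 \<le> k \<Longrightarrow> prob_space (W k)" "1 \<le> k \<Longrightarrow> sets (W k) = sets (weight_space k)"
    and "1 \<le> k \<Longrightarrow> prob_space (T k)" "1 \<le> k \<Longrightarrow> sets (T k) = sets (location_space L k)"
proof -
  show "prob_space K" "sets K = Pow {1..}"
    using assms by (auto simp: prior_data_def space_prob_algebra)
  then show "space K = {1..}" using assms sets_eq_imp_space_eq[of K "count_space {1..}"] by simp
qed (use assms in \<open>auto simp: prior_data_def space_prob_algebra\<close>)

lemma space_weight_space: "space (weight_space k) = weights k"
  and space_location_space: "space (location_space L k) = locations L k"
  by (auto simp: weight_space_def location_space_def space_restrict_space space_PiM weights_def locations_def)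

lemma prior_kernel:
  assumes pd: "prior_data L K W T" and k: "1 \<le> k"
  shows "(\<lambda>(w, \<theta>). atomic k w \<theta>) \<in> W k \<Otimes>\<^sub>M T k \<rightarrow>\<^sub>M mixing_space L"
    and "distr (W k \<Otimes>\<^sub>M T k) (mixing_space L) (\<lambda>(w, \<theta>). atomic k w \<theta>) \<in> space (prob_algebra (mixing_space L))"
proof -
  interpret W: prob_space "W k" using prior_dataD[OF pd] k by blast
  interpret T: prob_space "T k" using prior_dataD[OF pd] k by blast
  interpret pair_prob_space "W k" "T k" ..
  have "sets (W k \<Otimes>\<^sub>M T k) = sets (weight_space k \<Otimes>\<^sub>M location_space L k)"
    using prior_dataD[OF pd] k by (intro sets_pair_measure_cong) auto
  then show *: "(\<lambda>(w, \<theta>). atomic k w \<theta>) \<in> W k \<Otimes>\<^sub>M T k \<rightarrow>\<^sub>M mixing_space L"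
    using measurable_atomic[OF k] by (simp cong: measurable_cong_sets)
  show "distr (W k \<Otimes>\<^sub>M T k) (mixing_space L) (\<lambda>(w, \<theta>). atomic k w \<theta>) \<in> space (prob_algebra (mixing_space L))"
    using * by (auto simp: space_prob_algebra intro!: prob_space_distr)
qed

lemma nn_integral_prior:
  assumes pd: "prior_data L K W T" and f: "f \<in> borel_measurable (mixing_space L)"
  shows "(\<integral>\<^sup>+ \<nu>. f \<nu> \<partial>prior L K W T)
    = (\<integral>\<^sup>+ k. (\<integral>\<^sup>+ p. f (atomic k (fst p) (snd p)) \<partial>(W k \<Otimes>\<^sub>M T k)) \<partial>K)"
proof -
  have "(\<lambda>k. distr (W k \<Otimes>\<^sub>M T k) (mixing_space L) (\<lambda>(w, \<theta>). atomic k w \<theta>))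
      \<in> count_space {1..} \<rightarrow>\<^sub>M subprob_algebra (mixing_space L)"
    using prior_kernel(2)[OF pd] by (auto simp: space_prob_algebra space_subprob_algebra
        intro: prob_space_imp_subprob_space)
  then have "(\<lambda>k. distr (W k \<Otimes>\<^sub>M T k) (mixing_space L) (\<lambda>(w, \<theta>). atomic k w \<theta>))
      \<in> K \<rightarrow>\<^sub>M subprob_algebra (mixing_space L)"
    using prior_dataD(2)[OF pd] by (subst measurable_cong_sets[where M' = "count_space {1..}"]) auto
  then have "(\<integral>\<^sup>+ \<nu>. f \<nu> \<partial>prior L K W T)
      = (\<integral>\<^sup>+ k. (\<integral>\<^sup>+ \<nu>. f \<nu> \<partial>distr (W k \<Otimes>\<^sub>M T k) (mixing_space L) (\<lambda>(w, \<theta>). atomic k w \<theta>)) \<partial>K)"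
    unfolding prior_def by (rule nn_integral_bind[OF f])
  also have "\<dots> = (\<integral>\<^sup>+ k. (\<integral>\<^sup>+ p. f (atomic k (fst p) (snd p)) \<partial>(W k \<Otimes>\<^sub>M T k)) \<partial>K)"
    using f prior_kernel(1)[OF pd] prior_dataD(3)[OF pd]
    by (intro nn_integral_cong) (simp add: nn_integral_distr case_prod_beta')
  finally show ?thesis .
qed

lemma mixing_mono:
  assumes "0 \<le> L" "j \<le> k"
  shows "mixing L j \<subseteq> mixing L k"
proof
  fix \<nu> assume "\<nu> \<in> mixing L j"
  then obtain S where "prob_space \<nu>" "sets \<nu> = sets borel" "finite S" "S \<subseteq> {- L..L}" "card S \<le> j" "emeasure \<nu> S = 1"
    by (auto simp: mixing_iff[OF assms(1)])
  moreover from this have "card S \<le> k" using assms(2) by simp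
  ultimately show "\<nu> \<in> mixing L k" by (auto simp: mixing_iff[OF assms(1)])
qed

text \<open>A draw with at most \<open>k\<close> components always lies in
  \<open>mixing L k\<close>. Only an inequality results, since a draw with more components may have
  vanishing weights or coinciding atoms.\<close>

lemma prior_outside_mixing_le:
  assumes pd: "prior_data L K W T" and L: "0 \<le> L" and k: "1 \<le> k"
  shows "emeasure (prior L K W T) (space (mixing_space L) - mixing L k) \<le> emeasure K {k<..}"
proof -
  let ?C = "space (mixing_space L) - mixing L k"
  have C: "?C \<in> sets (mixing_space L)" using sets_mixing[OF L] by auto
  have Q: "sets (prior L K W T) = sets (mixing_space L)"
    using prior_in_prob_algebra[OF pd] by (simp add: space_prob_algebra)
  have "emeasure (prior L K W T) ?C = (\<integral>\<^sup>+ \<nu>. indicator ?C \<nu> \<partial>prior L K W T)"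
    using C Q by simp
  also have "\<dots> = (\<integral>\<^sup>+ j. (\<integral>\<^sup>+ p. indicator ?C (atomic j (fst p) (snd p)) \<partial>(W j \<Otimes>\<^sub>M T j)) \<partial>K)"
    using C by (intro nn_integral_prior[OF pd]) simp
  also have "\<dots> \<le> (\<integral>\<^sup>+ j. indicator {k<..} j \<partial>K)"
  proof (rule nn_integral_mono)
    fix j assume j: "j \<in> space K"
    then have j1: "1 \<le> j" using prior_dataD(3)[OF pd] by simp
    interpret W: prob_space "W j" using prior_dataD[OF pd] j1 by blast
    interpret T: prob_space "T j" using prior_dataD[OF pd] j1 by blast
    interpret pair_prob_space "W j" "T j" ..
    have "(\<integral>\<^sup>+ p. indicator ?C (atomic j (fst p) (snd p)) \<partial>(W j \<Otimes>\<^sub>M T j))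
        \<le> (\<integral>\<^sup>+ p. indicator {k<..} j \<partial>(W j \<Otimes>\<^sub>M T j))"
    proof (rule nn_integral_mono)
      fix p assume p: "p \<in> space (W j \<Otimes>\<^sub>M T j)"
      have "space (W j) = weights j" "space (T j) = locations L j"
        using prior_dataD[OF pd] j1 sets_eq_imp_space_eq space_weight_space space_location_space by metis+
      with p have "atomic j (fst p) (snd p) \<in> mixing L j"
        by (cases p) (simp add: space_pair_measure mixing_def, blast)
      then show "indicator ?C (atomic j (fst p) (snd p)) \<le> (indicator {k<..} j :: ennreal)"
        using mixing_mono[OF L, of j k] by (cases "j \<le> k") (auto simp: indicator_def)
    qed
    also have "\<dots> = indicator {k<..} j" by (simp add: emeasure_space_1)
    finally show "(\<integral>\<^sup>+ p. indicator ?C (atomic j (fst p) (snd p)) \<partial>(W j \<Otimes>\<^sub>M T j)) \<le> indicator {k<..} j" .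
  qed
  also have "\<dots> = emeasure K {k<..}"
  proof (rule nn_integral_indicator)
    show "{k<..} \<in> sets K" unfolding prior_dataD(2)[OF pd] using k by auto
  qed
  finally show ?thesis .
qed

text \<open>The factor \<open>measure K {k}\<close> is kept on the right because the prior mass of
  the neighbourhood of the truth contains the same factor, and the two cancel.\<close>

lemma geometric_tail_le:
  fixes K :: "nat measure"
  assumes "finite_measure K" and sets: "sets K = Pow {1..}" and k: "1 \<le> k"
    and decay: "\<And>j. k \<le> j \<Longrightarrow> measure K {j + 1} \<le> \<rho> * measure K {j}" and \<rho>: "0 \<le> \<rho>" "\<rho> \<le> 1 / 2"
  shows "measure K {k<..} \<le> 2 * \<rho> * measure K {k}"
proof -
  interpret finite_measure K by fact
  have bound: "measure K {k + i} \<le> \<rho> ^ i * measure K {k}" for i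
  proof (induction i)
    case (Suc i)
    have "measure K {k + Suc i} \<le> \<rho> * measure K {k + i}" using decay[of "k + i"] by simp
    also have "\<dots> \<le> \<rho> * (\<rho> ^ i * measure K {k})" using Suc \<rho> by (intro mult_left_mono) auto
    finally show ?case by simp
  qed simp
  have "{k<..} = (\<Union>i. {k + Suc i})" by (auto simp: less_iff_Suc_add)
  moreover have "(\<lambda>i. measure K {k + Suc i}) sums measure K (\<Union>i. {k + Suc i})"
    using sets k by (intro finite_measure_UNION) (auto simp: disjoint_family_on_def)
  ultimately have "(\<lambda>i. measure K {k + Suc i}) sums measure K {k<..}" by simp
  moreover have "(\<lambda>i. \<rho> ^ i * (\<rho> * measure K {k})) sums (1 / (1 - \<rho>) * (\<rho> * measure K {k}))"
    using \<rho> by (intro sums_mult2 geometric_sums) auto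
  ultimately have "measure K {k<..} \<le> 1 / (1 - \<rho>) * (\<rho> * measure K {k})"
  proof (rule sums_le[rotated])
    show "measure K {k + Suc i} \<le> \<rho> ^ i * (\<rho> * measure K {k})" for i
      using bound[of "Suc i"] by (simp add: ac_simps)
  qed
  also have "\<dots> \<le> 2 * (\<rho> * measure K {k})"
    using \<rho> by (intro mult_right_mono) (auto simp: divide_le_eq)
  finally show ?thesis by simp
qed

section \<open>The posterior as a probability measure\<close>

context
  fixes L :: real and n :: nat and Q :: "real measure measure"
  assumes Q: "Q \<in> space (prob_algebra (mixing_space L))"
begin

interpretation Q: prob_space Q using Q by (simp add: space_prob_algebra)

lemma sets_prior: "sets Q = sets (mixing_space L)"
  using Q by (simp add: space_prob_algebra)

lemma measurable_joint_density_prior [measurable]: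
  "(\<lambda>(\<nu>, x). joint_density n \<nu> x) \<in> borel_measurable (Q \<Otimes>\<^sub>M (\<Pi>\<^sub>M i\<in>{1..n}. lborel))"
  using measurable_joint_density
  by (subst measurable_cong_sets[OF sets_pair_measure_cong[OF sets_prior refl] refl])

lemma measurable_joint_density_prior_section [measurable]:
  assumes "x \<in> space (\<Pi>\<^sub>M i\<in>{1..n}. lborel)"
  shows "(\<lambda>\<nu>. joint_density n \<nu> x) \<in> borel_measurable Q"
  using measurable_compose[OF measurable_Pair2'[OF assms] measurable_joint_density_prior] by simp

lemma joint_density_prior_bounds:
  assumes "\<nu> \<in> space Q"
  shows "0 < joint_density n \<nu> x" "joint_density n \<nu> x \<le> 1"
  using assms mixing_spaceD sets_eq_imp_space_eq[OF sets_prior] by (auto intro!: joint_density_bounds)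

lemma marginal_bounds:
  assumes "x \<in> space (\<Pi>\<^sub>M i\<in>{1..n}. lborel)"
  shows "0 < (\<integral>\<^sup>+ \<nu>. joint_density n \<nu> x \<partial>Q)" "(\<integral>\<^sup>+ \<nu>. joint_density n \<nu> x \<partial>Q) < \<infinity>"
proof -
  have "(\<integral>\<^sup>+ \<nu>. joint_density n \<nu> x \<partial>Q) \<le> (\<integral>\<^sup>+ \<nu>. 1 \<partial>Q)"
    by (intro nn_integral_mono joint_density_prior_bounds)
  also have "\<dots> < \<infinity>" by (simp add: Q.emeasure_space_1)
  finally show "(\<integral>\<^sup>+ \<nu>. joint_density n \<nu> x \<partial>Q) < \<infinity>" .
  have "(\<integral>\<^sup>+ \<nu>. joint_density n \<nu> x \<partial>Q) \<noteq> 0"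
  proof
    assume "(\<integral>\<^sup>+ \<nu>. joint_density n \<nu> x \<partial>Q) = 0"
    then have "AE \<nu> in Q. joint_density n \<nu> x = 0"
      using assms by (simp add: nn_integral_0_iff_AE)
    with AE_space have "AE \<nu> in Q. False"
      by eventually_elim (metis joint_density_prior_bounds(1) less_irrefl)
    then show False by simp
  qed
  then show "0 < (\<integral>\<^sup>+ \<nu>. joint_density n \<nu> x \<partial>Q)" by (simp add: zero_less_iff_neq_zero)
qed

lemma emeasure_posterior:
  assumes "C \<in> sets (mixing_space L)" "x \<in> space (\<Pi>\<^sub>M i\<in>{1..n}. lborel)"
  shows "emeasure (posterior n Q x) C
    = (\<integral>\<^sup>+ \<nu>. joint_density n \<nu> x / (\<integral>\<^sup>+ \<nu>'. joint_density n \<nu>' x \<partial>Q) * indicator C \<nu> \<partial>Q)"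
  unfolding posterior_def using assms sets_prior by (intro emeasure_density) auto

lemma sets_posterior: "sets (posterior n Q x) = sets (mixing_space L)"
  by (simp add: posterior_def sets_prior)

lemma prob_space_posterior:
  assumes x: "x \<in> space (\<Pi>\<^sub>M i\<in>{1..n}. lborel)"
  shows "prob_space (posterior n Q x)"
proof
  have sp: "space (posterior n Q x) = space (mixing_space L)"
    using sets_eq_imp_space_eq[OF sets_posterior] .
  have "emeasure (posterior n Q x) (space (posterior n Q x))
      = (\<integral>\<^sup>+ \<nu>. joint_density n \<nu> x / (\<integral>\<^sup>+ \<nu>'. joint_density n \<nu>' x \<partial>Q) \<partial>Q)"
    unfolding sp emeasure_posterior[OF sets.top x]
    using sets_eq_imp_space_eq[OF sets_prior] by (intro nn_integral_cong) simp
  also have "\<dots> = (\<integral>\<^sup>+ \<nu>. joint_density n \<nu> x \<partial>Q) / (\<integral>\<^sup>+ \<nu>'. joint_density n \<nu>' x \<partial>Q)"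
    using x by (intro nn_integral_divide) simp
  also have "\<dots> = 1" using marginal_bounds[OF x] by (intro ennreal_divide_self) auto
  finally show "emeasure (posterior n Q x) (space (posterior n Q x)) = 1" .
qed

lemma measurable_emeasure_posterior:
  assumes C: "C \<in> sets (mixing_space L)"
  shows "(\<lambda>x. emeasure (posterior n Q x) C) \<in> borel_measurable (\<Pi>\<^sub>M i\<in>{1..n}. lborel)"
proof -
  have [measurable]: "C \<in> sets Q" using C sets_prior by simp
  interpret P: sigma_finite_measure "\<Pi>\<^sub>M i\<in>{1..n}. lborel :: real measure" by (rule sigma_finite_lborel_PiM)
  have "(\<lambda>x. \<integral>\<^sup>+ \<nu>. joint_density n \<nu> x / (\<integral>\<^sup>+ \<nu>'. joint_density n \<nu>' x \<partial>Q) * indicator C \<nu> \<partial>Q)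
      \<in> borel_measurable (\<Pi>\<^sub>M i\<in>{1..n}. lborel)"
    by measurable
  then show ?thesis by (rule measurable_cong[THEN iffD1, rotated]) (simp add: emeasure_posterior[OF C])
qed

text \<open>Passing to the complement in additive form avoids subtraction in \<open>ennreal\<close>;
  \<open>C\<close> and \<open>D\<close> will be the distributions with too many and with too few
  atoms.\<close>

lemma nn_integral_posterior_ge:
  assumes G: "prob_space \<nu>" "sets \<nu> = sets borel" and S: "S \<in> sets (mixing_space L)"
    and C: "C \<in> sets (mixing_space L)" "D \<in> sets (mixing_space L)"
    and cover: "space (mixing_space L) \<subseteq> S \<union> C \<union> D"
    and bounds: "(\<integral>\<^sup>+ x. emeasure (posterior n Q x) C \<partial>sample n (gauss_mixture \<nu>)) \<le> c"
      "(\<integral>\<^sup>+ x. emeasure (posterior n Q x) D \<partial>sample n (gauss_mixture \<nu>)) \<le> d"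
  shows "1 \<le> (\<integral>\<^sup>+ x. emeasure (posterior n Q x) S \<partial>sample n (gauss_mixture \<nu>)) + (c + d)"
proof -
  let ?M = "sample n (gauss_mixture \<nu>)"
  interpret M: prob_space ?M by (rule prob_space_sample[OF G])
  have eq: "sets ?M = sets (\<Pi>\<^sub>M i\<in>{1..n}. lborel)"
    unfolding sample_def by (intro sets_PiM_cong) auto
  have m: "(\<lambda>x. emeasure (posterior n Q x) A) \<in> borel_measurable ?M" if "A \<in> sets (mixing_space L)" for A
    using measurable_emeasure_posterior[OF that] by (subst measurable_cong_sets[OF eq refl])
  have "1 = (\<integral>\<^sup>+ x. 1 \<partial>?M)" by (simp add: M.emeasure_space_1)
  also have "\<dots> \<le> (\<integral>\<^sup>+ x. emeasure (posterior n Q x) S + (emeasure (posterior n Q x) C + emeasure (posterior n Q x) D) \<partial>?M)"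
  proof (rule nn_integral_mono)
    fix x assume "x \<in> space ?M"
    then have x: "x \<in> space (\<Pi>\<^sub>M i\<in>{1..n}. lborel)" using sets_eq_imp_space_eq[OF eq] by simp
    interpret P: prob_space "posterior n Q x" by (rule prob_space_posterior[OF x])
    have "1 = emeasure (posterior n Q x) (space (posterior n Q x))" by (simp add: P.emeasure_space_1)
    also have "\<dots> \<le> emeasure (posterior n Q x) (S \<union> (C \<union> D))"
      using cover S C sets_eq_imp_space_eq[OF sets_posterior]
      by (intro emeasure_mono) (auto simp: sets_posterior)
    also have "\<dots> \<le> emeasure (posterior n Q x) S + (emeasure (posterior n Q x) C + emeasure (posterior n Q x) D)"
      using S C by (intro order_trans[OF emeasure_subadditive] add_mono order_refl emeasure_subadditive)
        (auto simp: sets_posterior)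
    finally show "1 \<le> \<dots>" .
  qed
  also have "\<dots> = (\<integral>\<^sup>+ x. emeasure (posterior n Q x) S \<partial>?M)
      + ((\<integral>\<^sup>+ x. emeasure (posterior n Q x) C \<partial>?M) + (\<integral>\<^sup>+ x. emeasure (posterior n Q x) D \<partial>?M))"
    using m S C by (simp add: nn_integral_add)
  also have "\<dots> \<le> (\<integral>\<^sup>+ x. emeasure (posterior n Q x) S \<partial>?M) + (c + d)"
    using bounds by (intro add_mono order_refl)
  finally show ?thesis .
qed

end

text \<open>Serves both bad sets. With an empty rejection region and \<open>e2 = 1\<close> it bounds
  the posterior by prior mass divided by \<open>b\<close>; with a genuine test, small
  \<open>e2\<close> compensates for the division by \<open>b\<close>.\<close>

lemma nn_integral_posterior_le:
  assumes pd: "prior_data L K W T" and k: "1 \<le> k" and w: "w \<in> weights k" and b: "0 < b"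
    and b_le: "b \<le> measure K {k} * (measure (W k) {v \<in> space (W k). (\<Sum>j\<in>{1..k}. \<bar>v j - w j\<bar>) \<le> \<eta>}
      * measure (T k) {r \<in> space (T k). (MAX j\<in>{1..k}. \<bar>r j - \<theta> j\<bar>) \<le> \<eta>})"
    and C: "C \<in> sets (mixing_space L)" and R: "R \<in> sets (\<Pi>\<^sub>M i\<in>{1..n}. borel)"
    and e1: "emeasure (sample n (gauss_mixture (atomic k w \<theta>))) R \<le> ennreal e1"
    and e2: "\<And>\<nu>. \<nu> \<in> C \<Longrightarrow> emeasure (sample n (gauss_mixture \<nu>)) (space (\<Pi>\<^sub>M i\<in>{1..n}. borel) - R) \<le> ennreal e2"
  shows "(\<integral>\<^sup>+ x. emeasure (posterior n (prior L K W T) x) C \<partial>sample n (gauss_mixture (atomic k w \<theta>)))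
    \<le> ennreal e1 + ennreal (real n * (3 * \<eta>)) + ennreal (e2 / b) * emeasure (prior L K W T) C"
proof -
  define Q where "Q = prior L K W T"
  have Q: "Q \<in> space (prob_algebra (mixing_space L))"
    unfolding Q_def by (rule prior_in_prob_algebra[OF pd])
  interpret Q: prob_space Q using Q by (simp add: space_prob_algebra)
  interpret W: prob_space "W k" using prior_dataD[OF pd] k by blast
  interpret T: prob_space "T k" using prior_dataD[OF pd] k by blast
  interpret WT: pair_prob_space "W k" "T k" ..
  interpret K: prob_space K using prior_dataD[OF pd] by blast
  let ?P = "\<Pi>\<^sub>M i\<in>{1..n}. lborel :: real measure"
  let ?G = "sample n (gauss_mixture (atomic k w \<theta>))"
  define N1 where "N1 = {v \<in> space (W k). (\<Sum>j\<in>{1..k}. \<bar>v j - w j\<bar>) \<le> \<eta>}"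
  define N2 where "N2 = {r \<in> space (T k). (MAX j\<in>{1..k}. \<bar>r j - \<theta> j\<bar>) \<le> \<eta>}"
  have N2_eq: "N2 = {r \<in> space (T k). \<forall>j\<in>{1..k}. \<bar>r j - \<theta> j\<bar> \<le> \<eta>}"
    unfolding N2_def using k by (subst Max_le_iff) auto
  have Wm [measurable]: "(\<lambda>v. v j) \<in> borel_measurable (W k)" if "j \<in> {1..k}" for j
    unfolding measurable_cong_sets[OF prior_dataD(5)[OF pd k] refl] weight_space_def
    by (rule measurable_restrict_space1) (rule measurable_component_singleton, fact)
  have Tm [measurable]: "(\<lambda>r. r j) \<in> borel_measurable (T k)" if "j \<in> {1..k}" for j
    unfolding measurable_cong_sets[OF prior_dataD(7)[OF pd k] refl] location_space_def
    by (rule measurable_restrict_space1) (rule measurable_component_singleton, fact)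
  have N1 [measurable]: "N1 \<in> sets (W k)" unfolding N1_def by measurable
  have N2 [measurable]: "N2 \<in> sets (T k)" unfolding N2_eq by measurable
  \<comment> \<open>The neighbourhood is taken on parameters rather than on mixing distributions,
    since closeness of weights and locations is not a property of the measure alone.\<close>
  define \<mu> where "\<mu> = density (W k \<Otimes>\<^sub>M T k) (\<lambda>p. ennreal (measure K {k}) * indicator (N1 \<times> N2) p)"
  define F where "F p x = joint_density n (atomic k (fst p) (snd p)) x" for p x
  \<comment> \<open>\<open>B\<close> is the exact mass of the neighbourhood, by which the inequality
    is divided; its lower bound \<open>b\<close> enters only at the end.\<close>
  define B where "B = measure K {k} * (measure (W k) N1 * measure (T k) N2)"
  have B: "0 < B" "b \<le> B" using b b_le unfolding B_def N1_def N2_def by auto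
  have mu: "emeasure \<mu> (space \<mu>) = ennreal B"
    unfolding \<mu>_def B_def
    by (simp add: emeasure_density nn_integral_cmult T.emeasure_pair_measure_Times
        W.emeasure_eq_measure T.emeasure_eq_measure ennreal_mult)
  have fin: "finite_measure \<mu>" by (rule finite_measureI) (simp add: mu)
  have kernel: "(\<lambda>p. atomic k (fst p) (snd p)) \<in> W k \<Otimes>\<^sub>M T k \<rightarrow>\<^sub>M mixing_space L"
    using prior_kernel(1)[OF pd k] by (simp add: case_prod_beta')
  have Fm: "(\<lambda>(p, x). F p x) \<in> borel_measurable ((W k \<Otimes>\<^sub>M T k) \<Otimes>\<^sub>M ?P)"
  proof -
    have "(\<lambda>q. (atomic k (fst (fst q)) (snd (fst q)), snd q)) \<in> (W k \<Otimes>\<^sub>M T k) \<Otimes>\<^sub>M ?P \<rightarrow>\<^sub>M mixing_space L \<Otimes>\<^sub>M ?P"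
      by (intro measurable_Pair measurable_compose[OF measurable_fst kernel] measurable_snd)
    from measurable_compose[OF this measurable_joint_density] show ?thesis
      by (simp add: F_def case_prod_beta')
  qed
  \<comment> \<open>The neighbourhood average is the part of the prior average with exactly
    \<open>k\<close> drawn components and parameters in N1 and N2; all other contributions are
    nonnegative.\<close>
  have F_le: "(\<integral>\<^sup>+ p. F p x \<partial>\<mu>) \<le> (\<integral>\<^sup>+ \<nu>. joint_density n \<nu> x \<partial>Q)" if x: "x \<in> space ?P" for x
  proof -
    have f: "(\<lambda>\<nu>. joint_density n \<nu> x) \<in> borel_measurable (mixing_space L)"
      using measurable_compose[OF measurable_Pair2'[OF x] measurable_joint_density] by simp
    have Fx [measurable]: "(\<lambda>p. F p x) \<in> borel_measurable (W k \<Otimes>\<^sub>M T k)"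
      unfolding F_def by (rule measurable_compose[OF kernel f])
    have "(\<integral>\<^sup>+ p. F p x \<partial>\<mu>) = (\<integral>\<^sup>+ p. ennreal (measure K {k}) * indicator (N1 \<times> N2) p * F p x \<partial>(W k \<Otimes>\<^sub>M T k))"
      unfolding \<mu>_def by (intro nn_integral_density) measurable
    also have "\<dots> \<le> (\<integral>\<^sup>+ p. ennreal (measure K {k}) * F p x \<partial>(W k \<Otimes>\<^sub>M T k))"
      by (intro nn_integral_mono) (simp add: indicator_def)
    also have "\<dots> = (\<integral>\<^sup>+ p. F p x \<partial>(W k \<Otimes>\<^sub>M T k)) * emeasure K {k}"
      by (subst nn_integral_cmult) (simp_all add: K.emeasure_eq_measure mult.commute)
    also have "\<dots> = (\<integral>\<^sup>+ j. (\<integral>\<^sup>+ p. F p x \<partial>(W k \<Otimes>\<^sub>M T k)) * indicator {k} j \<partial>K)"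
      using k prior_dataD(2)[OF pd] by (intro nn_integral_cmult_indicator[symmetric]) simp
    also have "\<dots> \<le> (\<integral>\<^sup>+ j. (\<integral>\<^sup>+ p. joint_density n (atomic j (fst p) (snd p)) x \<partial>(W j \<Otimes>\<^sub>M T j)) \<partial>K)"
      unfolding F_def by (intro nn_integral_mono) (simp add: indicator_def)
    also have "\<dots> = (\<integral>\<^sup>+ \<nu>. joint_density n \<nu> x \<partial>Q)"
      unfolding Q_def by (rule nn_integral_prior[OF pd f, symmetric])
    finally show ?thesis .
  qed
  have close: "AE p in \<mu>. (\<integral>\<^sup>+ x. joint_density n (atomic k w \<theta>) x - F p x \<partial>?P) \<le> ennreal (real n * (3 * \<eta>))"
    unfolding \<mu>_def
  proof (subst AE_density, measurable, rule AE_I2, rule impI)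
    fix p assume p: "p \<in> space (W k \<Otimes>\<^sub>M T k)" and pos: "0 < ennreal (measure K {k}) * indicator (N1 \<times> N2) p"
    have "p \<in> N1 \<times> N2" using pos by (cases "p \<in> N1 \<times> N2") auto
    then have p': "fst p \<in> N1" "snd p \<in> N2" by auto
    then have v: "fst p \<in> weights k"
      using sets_eq_imp_space_eq[OF prior_dataD(5)[OF pd k]] by (auto simp: N1_def space_weight_space)
    have "(\<integral>\<^sup>+ x. joint_density n (atomic k w \<theta>) x - joint_density n (atomic k (fst p) (snd p)) x \<partial>?P)
        \<le> ennreal (real n * (\<eta> + 2 * \<eta>))"
      using p' by (intro nn_integral_joint_density_diff_le w v) (auto simp: N1_def N2_eq abs_minus_commute)
    then show "(\<integral>\<^sup>+ x. joint_density n (atomic k w \<theta>) x - F p x \<partial>?P) \<le> ennreal (real n * (3 * \<eta>))"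
      by (simp add: F_def)
  qed
  have G: "prob_space (atomic k w \<theta>)" by (rule prob_space_atomic[OF w])
  have gm: "joint_density n (atomic k w \<theta>) \<in> borel_measurable ?P"
    unfolding joint_density_def
    using measurable_mixture_density[OF sets_atomic G]
    by (intro borel_measurable_prod_ennreal measurable_compose[OF measurable_component_singleton]) auto
  have eq: "sets (\<Pi>\<^sub>M i\<in>{1..n}. borel :: real measure) = sets ?P" by (intro sets_PiM_cong) auto
  have R': "R \<in> sets ?P" using R eq by simp
  have CQ: "C \<in> sets Q" using C sets_prior[OF Q] by simp
  have meas\<mu>: "(\<lambda>(p, x). F p x) \<in> borel_measurable (\<mu> \<Otimes>\<^sub>M ?P)"
    using Fm by (subst measurable_cong_sets[OF sets_pair_measure_cong[OF _ refl] refl]) (auto simp: \<mu>_def)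
  define X where "X = (\<integral>\<^sup>+ x. emeasure (posterior n Q x) C \<partial>?G)"
  have X_eq: "X = (\<integral>\<^sup>+ x. (\<integral>\<^sup>+ \<nu>. joint_density n \<nu> x / (\<integral>\<^sup>+ \<nu>'. joint_density n \<nu>' x \<partial>Q) * indicator C \<nu> \<partial>Q)
      * joint_density n (atomic k w \<theta>) x \<partial>?P)"
    unfolding X_def sample_gauss_mixture[OF G sets_atomic]
    using measurable_emeasure_posterior[OF Q C] gm
    by (subst nn_integral_density) (auto intro!: nn_integral_cong simp: emeasure_posterior[OF Q C] mult.commute)
  have "ennreal B * X \<le> ennreal B * ((\<integral>\<^sup>+ x. joint_density n (atomic k w \<theta>) x * indicator R x \<partial>?P) + ennreal (real n * (3 * \<eta>)))
      + (\<integral>\<^sup>+ \<nu>. (\<integral>\<^sup>+ x. joint_density n \<nu> x * indicator (space ?P - R) x \<partial>?P) * indicator C \<nu> \<partial>Q)"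
    unfolding X_eq mu[symmetric]
    using marginal_bounds[OF Q] F_le
    by (intro posterior_expectation_bound[where F = F] sigma_finite_lborel_PiM Q.sigma_finite_measure_axioms fin
        measurable_joint_density_prior[OF Q] meas\<mu> gm CQ R' close conjI)
  also have "(\<integral>\<^sup>+ x. joint_density n (atomic k w \<theta>) x * indicator R x \<partial>?P) = emeasure ?G R"
    unfolding sample_gauss_mixture[OF G sets_atomic] using gm R' by (simp add: emeasure_density)
  also have "(\<integral>\<^sup>+ \<nu>. (\<integral>\<^sup>+ x. joint_density n \<nu> x * indicator (space ?P - R) x \<partial>?P) * indicator C \<nu> \<partial>Q)
      \<le> (\<integral>\<^sup>+ \<nu>. ennreal e2 * indicator C \<nu> \<partial>Q)"
  proof (intro nn_integral_mono)
    fix \<nu> assume "\<nu> \<in> space Q"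
    then have \<nu>: "prob_space \<nu>" "sets \<nu> = sets borel"
      using mixing_spaceD sets_eq_imp_space_eq[OF sets_prior[OF Q]] by auto
    have jm: "joint_density n \<nu> \<in> borel_measurable ?P"
      unfolding joint_density_def
      using measurable_mixture_density[OF \<nu>(2,1)]
      by (intro borel_measurable_prod_ennreal measurable_compose[OF measurable_component_singleton]) auto
    have "(\<integral>\<^sup>+ x. joint_density n \<nu> x * indicator (space ?P - R) x \<partial>?P)
        = emeasure (sample n (gauss_mixture \<nu>)) (space (\<Pi>\<^sub>M i\<in>{1..n}. borel) - R)"
      unfolding sample_gauss_mixture[OF \<nu>] sets_eq_imp_space_eq[OF eq]
      using jm R' by (intro emeasure_density[symmetric]) auto
    then show "(\<integral>\<^sup>+ x. joint_density n \<nu> x * indicator (space ?P - R) x \<partial>?P) * indicator C \<nu> \<le> ennreal e2 * indicator C \<nu>"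
      using e2[of \<nu>] by (simp add: indicator_def)
  qed
  also have "\<dots> = ennreal e2 * emeasure Q C" using CQ by (rule nn_integral_cmult_indicator)
  finally have main: "ennreal B * X \<le> ennreal B * (emeasure ?G R + ennreal (real n * (3 * \<eta>))) + ennreal e2 * emeasure Q C"
    by (simp add: add_left_mono)
  have cancel: "ennreal B * y / ennreal B = y" for y
    using B by (simp add: mult.commute ennreal_mult_divide_eq)
  have "X \<le> (emeasure ?G R + ennreal (real n * (3 * \<eta>))) + ennreal e2 * emeasure Q C / ennreal B"
    using divide_right_mono_ennreal[OF main, of "ennreal B"] unfolding add_divide_distrib_ennreal cancel .
  also have "\<dots> \<le> (ennreal e1 + ennreal (real n * (3 * \<eta>))) + ennreal (e2 / b) * emeasure Q C"
  proof (intro add_mono e1 order_refl)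
    have "ennreal e2 / ennreal B \<le> ennreal (e2 / b)"
    proof (cases "0 \<le> e2")
      case True
      then show ?thesis using b B by (simp add: divide_ennreal ennreal_leI divide_left_mono)
    qed (simp add: ennreal_neg)
    then have "ennreal e2 / ennreal B * emeasure Q C \<le> ennreal (e2 / b) * emeasure Q C" by (rule mult_right_mono) simp
    then show "ennreal e2 * emeasure Q C / ennreal B \<le> ennreal (e2 / b) * emeasure Q C"
      by (simp add: divide_ennreal_def ac_simps)
  qed
  finally show ?thesis unfolding X_def Q_def .
qed

section \<open>Rates\<close>

text \<open>A partition of \<open>k\<close> indices into \<open>k\<close> blocks consists of
  singletons: mapping each index to its block is a surjection between finite sets of equal size,
  hence injective.\<close>

lemma separated_singletons:
  assumes "separated k k \<gamma> \<omega> w \<theta>"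
  shows "i \<in> {1..k} \<Longrightarrow> j \<in> {1..k} \<Longrightarrow> i \<noteq> j \<Longrightarrow> \<gamma> \<le> \<bar>\<theta> i - \<theta> j\<bar>"
    and "j \<in> {1..k} \<Longrightarrow> \<omega> \<le> w j"
proof -
  obtain P where P: "partition_on {1..k} P" "card P = k"
    and sep: "\<And>S S' j j'. S \<in> P \<Longrightarrow> S' \<in> P \<Longrightarrow> S \<noteq> S' \<Longrightarrow> j \<in> S \<Longrightarrow> j' \<in> S' \<Longrightarrow> \<gamma> \<le> \<bar>\<theta> j - \<theta> j'\<bar>"
    and wt: "\<And>S. S \<in> P \<Longrightarrow> \<omega> \<le> (\<Sum>j\<in>S. w j)"
    using assms by (auto simp: separated_def)
  have "\<exists>S\<in>P. j \<in> S" if "j \<in> {1..k}" for j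
    using partition_onD1[OF P(1)] that by auto
  then obtain f where f: "\<And>j. j \<in> {1..k} \<Longrightarrow> f j \<in> P \<and> j \<in> f j" by metis
  have block: "S = f j" if "S \<in> P" "j \<in> S" "j \<in> {1..k}" for S j
    using partition_onD2[OF P(1)] f[OF that(3)] that by (auto simp: disjoint_def)
  have "P \<subseteq> f ` {1..k}"
  proof
    fix S assume S: "S \<in> P"
    then obtain j where "j \<in> S" using partition_onD3[OF P(1)] by (metis all_not_in_conv)
    moreover have "j \<in> {1..k}" using partition_onD1[OF P(1)] S calculation by blast
    ultimately show "S \<in> f ` {1..k}" using block[OF S] by blast
  qed
  moreover have "f ` {1..k} \<subseteq> P" using f by blast
  ultimately have "f ` {1..k} = P" by (intro equalityI)
  then have "card (f ` {1..k}) = card {1..k}" using P(2) by simp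
  then have inj: "inj_on f {1..k}" by (intro eq_card_imp_inj_on) auto
  show "\<gamma> \<le> \<bar>\<theta> i - \<theta> j\<bar>" if "i \<in> {1..k}" "j \<in> {1..k}" "i \<noteq> j"
  proof -
    have "f i \<noteq> f j" using inj_on_eq_iff[OF inj that(1,2)] that(3) by simp
    with f[OF that(1)] f[OF that(2)] show ?thesis by (meson sep)
  qed
  show "\<omega> \<le> w j" if j: "j \<in> {1..k}"
  proof -
    have "f j = {j}"
    proof (intro equalityI subsetI)
      fix i assume i: "i \<in> f j"
      then have "i \<in> {1..k}" using partition_onD1[OF P(1)] f[OF j] by blast
      then show "i \<in> {j}" using block[of "f j" i] f[OF j] i inj_on_eq_iff[OF inj _ j, of i] by simp
    qed (use f[OF j] in auto)
    then show ?thesis using wt[of "f j"] f[OF j] by simp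
  qed
qed

text \<open>The exponent \<open>1 / (4 * k - 2)\<close> of the rate is undone by raising \<open>\<gamma> * \<omega>\<close> to the power
  \<open>2 * k - 1\<close>; the powers of \<open>k\<close> in the rate absorb those of the test.\<close>

lemma rate_lower_bound:
  assumes L: "0 < L" and D: "0 < D" and M: "48 * L * D + 768 * (1 + L)\<^sup>2 + 1 \<le> M"
    and n: "2 \<le> n" and k: "2 \<le> k" and \<gamma>: "0 < \<gamma>" "\<gamma> \<le> 2 * L" and \<omega>: "0 < \<omega>" "\<omega> \<le> 1"
    and rate: "M * eps_bar n k < \<gamma> * \<omega>"
  shows "4 * (D * (real k * ln (real n) / sqrt (real n)))
    \<le> exp (- real k / 2) * (\<omega> * (\<gamma> / (16 * (1 + L) * sqrt (real k))) ^ (2 * (k - 1)) / 2)"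
proof -
  define x where "x = ln (real n) / sqrt (real n)"
  define m where "m = k - 1"
  have k_m: "k = m + 1" "2 * k - 1 = 2 * m + 1" using k by (auto simp: m_def)
  have x: "0 < x" using n by (auto simp: x_def)
  have M1: "1 \<le> M" "48 * L * D \<le> M" "768 * (1 + L)\<^sup>2 \<le> M"
  proof -
    have "0 \<le> L * D" "0 \<le> (1 + L)\<^sup>2" using L D by auto
    then show "1 \<le> M" "48 * L * D \<le> M" "768 * (1 + L)\<^sup>2 \<le> M" using M by linarith+
  qed
  have pow': "(y powr a) ^ N = y powr (a * real N)" if "0 < y" for y a :: real and N :: nat
    using that by (subst powr_power) (auto simp: mult.commute)
  have pow: "(y powr (1 / real N)) ^ N = y" if "0 < N" "0 < y" for y :: real and N :: nat
    using that by (simp add: pow')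
  \<comment> \<open>In terms of \<open>x\<close> the rate has exponent 1 / (2 k - 1), which the
    power removes. The power of k becomes (3/2)(2 k - 1) \<ge> k, enough for the k^k needed
    below.\<close>
  have eps: "real k ^ k * x \<le> eps_bar n k ^ (2 * m + 1)"
  proof -
    have "((ln (real n))\<^sup>2 / real n) = x powr 2"
      using n x by (simp add: x_def power_divide powr_numeral)
    moreover have "2 * (1 / (4 * real k - 2)) = 1 / real (2 * m + 1)"
      by (simp add: k_m field_simps)
    ultimately have "((ln (real n))\<^sup>2 / real n) powr (1 / (4 * real k - 2)) = x powr (1 / real (2 * m + 1))"
      by (simp only: powr_powr)
    then have "eps_bar n k ^ (2 * m + 1)
        = (real k powr (3 / 2)) ^ (2 * m + 1) * (x powr (1 / real (2 * m + 1))) ^ (2 * m + 1)"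
      by (simp add: eps_bar_def power_mult_distrib)
    also have "(x powr (1 / real (2 * m + 1))) ^ (2 * m + 1) = x" by (rule pow) (use x in auto)
    also have "(real k powr (3 / 2)) ^ (2 * m + 1) = real k powr (3 / 2 * real (2 * m + 1))"
      by (rule pow') (use k in simp)
    finally have eq: "eps_bar n k ^ (2 * m + 1) = real k powr (3 / 2 * real (2 * m + 1)) * x" .
    have "real k powr real k \<le> real k powr (3 / 2 * real (2 * m + 1))"
      using k by (intro powr_mono) (auto simp: k_m)
    moreover have "real k powr real k = real k ^ k" using k by (intro powr_realpow) simp
    ultimately show ?thesis unfolding eq using x by (intro mult_right_mono) auto
  qed
  have "M ^ (2 * m + 1) * (real k ^ k * x) \<le> M ^ (2 * m + 1) * eps_bar n k ^ (2 * m + 1)"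
    using eps M1 by (intro mult_left_mono) auto
  also have "\<dots> = (M * eps_bar n k) ^ (2 * m + 1)" by (simp only: power_mult_distrib)
  also have "\<dots> \<le> (\<gamma> * \<omega>) ^ (2 * m + 1)"
    using rate M1 by (intro power_mono) (auto simp: eps_bar_def)
  \<comment> \<open>One factor \<omega> and 2 k - 2 factors \<gamma> are kept as in the test; the
    remaining \<gamma> is at most 2 L and the remaining \<omega> at most 1.\<close>
  also have "\<dots> = \<omega> * \<gamma> ^ (2 * m) * (\<gamma> * \<omega> ^ (2 * m))" by (simp add: power_mult_distrib)
  also have "\<dots> \<le> \<omega> * \<gamma> ^ (2 * m) * (2 * L * 1)"
    using \<gamma> \<omega> by (intro mult_left_mono mult_mono power_le_one) auto
  finally have lower: "M ^ (2 * m + 1) * (real k ^ k * x) \<le> \<omega> * \<gamma> ^ (2 * m) * (2 * L)" by simp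
  \<comment> \<open>Origin of the constants: 256 (1 + L)^2 is the square of 16 (1 + L), the factors
    3 come from exp(k/2) \<le> 3^k, and 16 L D collects 4 D, the final 1/2 and the leftover 2
    L.\<close>
  have "48 * L * D * (768 * (1 + L)\<^sup>2) ^ m \<le> M * (M ^ 2) ^ m"
  proof (intro mult_mono power_mono M1)
    have "M * 1 \<le> M * M" using M1 by (intro mult_left_mono) auto
    then show "768 * (1 + L)\<^sup>2 \<le> M\<^sup>2" using M1(3) unfolding power2_eq_square[of M] by linarith
  qed (use L M1 in auto)
  also have "\<dots> = M ^ (2 * m + 1)" by (simp add: power_mult)
  finally have M_pow: "48 * L * D * (768 * (1 + L)\<^sup>2) ^ m \<le> M ^ (2 * m + 1)" .
  have kk: "real k ^ k = real k * real k ^ m" using k_m(1) by (metis power_Suc Suc_eq_plus1)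
  have exp_k: "exp (real k / 2) \<le> 3 * 3 ^ m"
  proof -
    have "exp (real k / 2) \<le> exp (real k)" by simp
    also have "\<dots> = exp 1 ^ k" by (simp flip: exp_of_nat_mult)
    also have "\<dots> \<le> 3 ^ k" using exp_le by (intro power_mono) auto
    finally show ?thesis by (simp add: k_m)
  qed
  have "16 * L * D * (exp (real k / 2) * (256 * (1 + L)\<^sup>2) ^ m) \<le> 16 * L * D * ((3 * 3 ^ m) * (256 * (1 + L)\<^sup>2) ^ m)"
    using exp_k L D by (intro mult_left_mono mult_right_mono) auto
  also have "\<dots> = 48 * L * D * (3 * (256 * (1 + L)\<^sup>2)) ^ m" by (simp only: power_mult_distrib)
  also have "3 * (256 * (1 + L)\<^sup>2) = 768 * (1 + L)\<^sup>2" by simp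
  also note M_pow
  finally have "16 * L * D * (exp (real k / 2) * (256 * (1 + L)\<^sup>2) ^ m) \<le> M ^ (2 * m + 1)" .
  then have "16 * L * D * (exp (real k / 2) * (256 * (1 + L)\<^sup>2) ^ m) * (real k ^ k * x)
      \<le> M ^ (2 * m + 1) * (real k ^ k * x)"
    by (rule mult_right_mono) (use x in simp)
  also note lower
  also have "16 * L * D * (exp (real k / 2) * (256 * (1 + L)\<^sup>2) ^ m) * (real k ^ k * x)
      = 2 * L * (8 * D * (real k ^ k * x) * (exp (real k / 2) * (256 * (1 + L)\<^sup>2) ^ m))"
    by (simp only: mult_ac)
  also have "\<omega> * \<gamma> ^ (2 * m) * (2 * L) = 2 * L * (\<omega> * \<gamma> ^ (2 * m))" by (simp only: mult_ac)
  finally have "8 * D * (real k ^ k * x) * (exp (real k / 2) * (256 * (1 + L)\<^sup>2) ^ m) \<le> \<omega> * \<gamma> ^ (2 * m)"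
    by (rule mult_left_le_imp_le) (use L in simp)
  then have "8 * D * (real k * x) * (exp (real k / 2) * (256 * (1 + L)\<^sup>2 * real k) ^ m) \<le> \<omega> * \<gamma> ^ (2 * m)"
    unfolding kk power_mult_distrib[of _ "real k"] by (simp only: mult_ac)
  then have "8 * D * (real k * x) \<le> \<omega> * \<gamma> ^ (2 * m) / (exp (real k / 2) * (256 * (1 + L)\<^sup>2 * real k) ^ m)"
    using L k by (subst pos_le_divide_eq) auto
  also have "\<dots> = exp (- real k / 2) * (\<omega> * (\<gamma> / (16 * (1 + L) * sqrt (real k))) ^ (2 * m))"
  proof -
    have "(16 * (1 + L) * sqrt (real k))\<^sup>2 = 256 * (1 + L)\<^sup>2 * real k"
      by (simp only: power_mult_distrib) simp
    then have "(\<gamma> / (16 * (1 + L) * sqrt (real k))) ^ (2 * m) = \<gamma> ^ (2 * m) / (256 * (1 + L)\<^sup>2 * real k) ^ m"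
      by (simp only: power_divide power_mult)
    moreover have "exp (- real k / 2) = inverse (exp (real k / 2))" by (simp flip: exp_minus)
    ultimately show ?thesis by (simp only: divide_inverse inverse_mult_distrib mult_ac)
  qed
  finally show ?thesis by (simp add: x_def m_def)
qed

section \<open>Finite-sample bound for the posterior number of components\<close>

lemma posterior_component_number_bound:
  fixes k kb n :: nat
  assumes pos: "0 < L" "0 < c1" "0 < c2" "0 < c3" "0 < c4" "0 < c5" "0 < c6" "0 < c7" "0 < C0"
    and n: "1 \<le> ln (real n)" "1 \<le> ln (ln (real n))" "c1 / real n \<le> 1 / 2" "1 / (real n)\<^sup>2 < \<eta>0" "real kb < (real n)\<^sup>2"
    and k: "1 \<le> k" "k \<le> kb" "real kb \<le> C0 * ln (real n) / ln (ln (real n))"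
    and pd: "prior_data L K W T"
    and K_decay: "\<And>j. 1 \<le> j \<Longrightarrow> measure K {j + 1} \<le> c1 * exp (- A * real kb * ln (real n)) * measure K {j}"
    and K_lower: "c2 * exp (- (c3 * real kb * ln (real n)) * real k) \<le> measure K {k}"
    and W_lower: "\<And>w \<eta>. w \<in> weights k \<Longrightarrow> 0 < \<eta> \<Longrightarrow> \<eta> < 1 / real k \<Longrightarrow>
      c4 * \<eta> powr (c5 * real k) \<le> measure (W k) {v \<in> space (W k). (\<Sum>j\<in>{1..k}. \<bar>v j - w j\<bar>) \<le> \<eta>}"
    and T_lower: "\<And>\<theta> \<eta>. \<theta> \<in> locations L k \<Longrightarrow> 0 < \<eta> \<Longrightarrow> \<eta> < \<eta>0 \<Longrightarrow>
      c6 * \<eta> powr (c7 * real k) \<le> measure (T k) {r \<in> space (T k). (MAX j\<in>{1..k}. \<bar>r j - \<theta> j\<bar>) \<le> \<eta>}"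
    and A: "2 * (c5 + c7) + 1 \<le> A"
    and D: "D = c3 * C0 + 2 * (c5 + c7) + 2"
    and M: "48 * L * D + 768 * (1 + L)\<^sup>2 + 1 \<le> M"
    and rate: "0 < \<gamma>" "0 < \<omega>" "M * eps_bar n k < \<gamma> * \<omega>"
    and \<nu>: "\<nu> \<in> mixing_sep L k k \<gamma> \<omega>"
  shows "1 \<le> (\<integral>\<^sup>+ x. emeasure (posterior n (prior L K W T) x) (mixing L k - mixing L (k - 1)) \<partial>sample n (gauss_mixture \<nu>))
    + ennreal ((14 + 2 * c1 / (c4 * c6) + 2 / (c2 * c4 * c6)) / real n)"
proof -
  define l where "l = ln (real n)"
  have l: "1 \<le> l" using n by (simp add: l_def)
  have n_pos: "0 < real n" using l ln_ge_zero_iff[of "real n"] by (cases "n = 0") (auto simp: l_def)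
  have n2: "2 \<le> n" using l n_pos by (cases "n = 1") (auto simp: l_def)
  have exp_l: "exp (- l) = 1 / real n" using n_pos by (simp add: l_def exp_minus inverse_eq_divide)
  obtain w \<theta> where \<nu>_eq: "\<nu> = atomic k w \<theta>" and w: "w \<in> weights k" and \<theta>: "\<theta> \<in> locations L k"
    and "separated k k \<gamma> \<omega> w \<theta>"
    using \<nu> by (auto simp: mixing_sep_def)
  note sep = separated_singletons(1)[OF this(4)] and w_ge = separated_singletons(2)[OF this(4)]
  define Q where "Q = prior L K W T"
  have Q: "Q \<in> space (prob_algebra (mixing_space L))" unfolding Q_def by (rule prior_in_prob_algebra[OF pd])
  interpret Q: prob_space Q using Q by (simp add: space_prob_algebra)
  interpret K: prob_space K using prior_dataD[OF pd] by blast
  define p where "p = measure K {k}"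
  have p: "0 < p" using K_lower pos unfolding p_def by (smt (verit) exp_gt_zero mult_pos_pos)
  \<comment> \<open>Small enough that n observations cost only 3 / n in total variation, yet a power
    of n, so that (P2) and (P3) lose only a factor polynomial in n per component.\<close>
  define \<eta> where "\<eta> = 1 / (real n)\<^sup>2"
  have \<eta>: "0 < \<eta>" "\<eta> < 1 / real k" "\<eta> < \<eta>0"
  proof -
    have "real k < (real n)\<^sup>2" using n k by linarith
    then show "\<eta> < 1 / real k" using k n_pos unfolding \<eta>_def by (intro divide_strict_left_mono) auto
  qed (use n n_pos in \<open>auto simp: \<eta>_def\<close>)
  have \<eta>_powr: "\<eta> powr a = exp (- 2 * a * l)" for a
    using n_pos by (simp add: \<eta>_def powr_def l_def ln_div ln_realpow)
  have n\<eta>: "real n * (3 * \<eta>) = 3 / real n" using n_pos by (simp add: \<eta>_def power2_eq_square)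
  define b where "b = p * (c4 * \<eta> powr (c5 * real k) * (c6 * \<eta> powr (c7 * real k)))"
  have b_eq: "b = p * (c4 * c6) * exp (- 2 * (c5 + c7) * real k * l)"
    unfolding b_def \<eta>_powr by (simp add: algebra_simps flip: exp_add)
  have b: "0 < b" using p pos by (simp add: b_eq)
  have b_le: "b \<le> measure K {k} * (measure (W k) {v \<in> space (W k). (\<Sum>j\<in>{1..k}. \<bar>v j - w j\<bar>) \<le> \<eta>}
      * measure (T k) {r \<in> space (T k). (MAX j\<in>{1..k}. \<bar>r j - \<theta> j\<bar>) \<le> \<eta>})"
    unfolding b_def p_def using pos
    by (intro mult_left_mono mult_mono W_lower[OF w] T_lower[OF \<theta>] \<eta>) auto
  have S: "mixing L j \<in> sets (mixing_space L)" for j using sets_mixing pos(1) by simp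
  define C1 where "C1 = space (mixing_space L) - mixing L k"
  define C2 where "C2 = mixing L (k - 1)"
  have C: "C1 \<in> sets (mixing_space L)" "C2 \<in> sets (mixing_space L)"
    unfolding C1_def C2_def using S by auto

  have "(\<integral>\<^sup>+ x. emeasure (posterior n Q x) C1 \<partial>sample n (gauss_mixture \<nu>)) \<le> ennreal ((3 + 2 * c1 / (c4 * c6)) / real n)"
  proof -
    define \<rho> where "\<rho> = c1 * exp (- A * real kb * l)"
    have rho_le: "exp (- A * real kb * l) \<le> exp (- l)"
    proof -
      have "1 * 1 * l \<le> A * real kb * l" using A pos k l by (intro mult_right_mono mult_mono) auto
      then show ?thesis by simp
    qed
    have "\<rho> \<le> c1 / real n" using mult_left_mono[OF rho_le, of c1] pos exp_l by (simp add: \<rho>_def)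
    then have \<rho>: "0 \<le> \<rho>" "\<rho> \<le> 1 / 2" using n(3) pos(2) by (simp add: \<rho>_def, linarith)
    have tail: "measure K {k<..} \<le> 2 * \<rho> * p"
      unfolding p_def
    proof (rule geometric_tail_le[OF K.finite_measure_axioms prior_dataD(2)[OF pd] k(1) _ \<rho>])
      fix j assume "k \<le> j"
      then show "measure K {j + 1} \<le> \<rho> * measure K {j}" using K_decay[of j] k(1) by (simp add: \<rho>_def l_def)
    qed
    \<comment> \<open>Too many atoms: no test is made, and the trivial error bound 1 is
      used.\<close>
    have one: "emeasure (sample n (gauss_mixture \<nu>')) (space (\<Pi>\<^sub>M i\<in>{1..n}. borel) - {}) \<le> ennreal 1"
      if "\<nu>' \<in> C1" for \<nu>'
      using that mixing_spaceD[of \<nu>' L] prob_space_sample[of \<nu>' n]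
      by (simp add: C1_def prob_space.emeasure_le_1)
    have "(\<integral>\<^sup>+ x. emeasure (posterior n Q x) C1 \<partial>sample n (gauss_mixture \<nu>))
        \<le> ennreal 0 + ennreal (real n * (3 * \<eta>)) + ennreal (1 / b) * emeasure Q C1"
      unfolding Q_def \<nu>_eq
      by (intro nn_integral_posterior_le[where R = "{}"] pd k w b b_le C one) auto
    also have "\<dots> \<le> ennreal 0 + ennreal (3 / real n) + ennreal (1 / b) * ennreal (2 * \<rho> * p)"
    proof (intro add_mono mult_left_mono)
      have "emeasure Q C1 \<le> emeasure K {k<..}"
        unfolding Q_def C1_def using pos k by (intro prior_outside_mixing_le pd) auto
      also have "\<dots> \<le> ennreal (2 * \<rho> * p)" unfolding K.emeasure_eq_measure using tail by (intro ennreal_leI)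
      finally show "emeasure Q C1 \<le> ennreal (2 * \<rho> * p)" .
    qed (auto simp: n\<eta>)
    also have "\<dots> = ennreal (3 / real n + 1 / b * (2 * \<rho> * p))"
      using b \<rho> p by (simp flip: ennreal_mult ennreal_plus)
    also have "\<dots> \<le> ennreal ((3 + 2 * c1 / (c4 * c6)) / real n)"
    proof (rule ennreal_leI)
      have "1 / b * (2 * \<rho> * p) = 2 * c1 / (c4 * c6) * exp (- A * real kb * l + 2 * (c5 + c7) * real k * l)"
      proof -
        have "exp (- 2 * (c5 + c7) * real k * l) = inverse (exp (2 * (c5 + c7) * real k * l))"
          by (simp add: algebra_simps flip: exp_minus)
        then show ?thesis
          unfolding b_eq \<rho>_def exp_add using p by (simp only:) (simp add: divide_inverse)
      qed
      also have "\<dots> \<le> 2 * c1 / (c4 * c6) * exp (- l)"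
      proof (intro mult_left_mono)
        \<comment> \<open>Both k \<le> kb and 1 \<le> kb enter: the decay exponent A kb pays for the
          neighbourhood and still leaves one factor 1 / n.\<close>
        have "2 * (c5 + c7) * real k * l + 1 * l \<le> 2 * (c5 + c7) * real kb * l + real kb * l"
          using k pos l by (intro add_mono mult_right_mono mult_left_mono) auto
        also have "\<dots> = (2 * (c5 + c7) + 1) * real kb * l" by (simp add: algebra_simps)
        also have "\<dots> \<le> A * real kb * l" using A l by (intro mult_right_mono) auto
        finally show "exp (- A * real kb * l + 2 * (c5 + c7) * real k * l) \<le> exp (- l)" by simp
      qed (use pos in auto)
      finally show "3 / real n + 1 / b * (2 * \<rho> * p) \<le> (3 + 2 * c1 / (c4 * c6)) / real n"
        by (simp add: exp_l add_divide_distrib)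
    qed
    finally show ?thesis .
  qed

  moreover have "(\<integral>\<^sup>+ x. emeasure (posterior n Q x) C2 \<partial>sample n (gauss_mixture \<nu>)) \<le> ennreal ((11 + 2 / (c2 * c4 * c6)) / real n)"
  proof (cases "k = 1")
    \<comment> \<open>There is no distribution with 0 atoms, so \<open>C2\<close> is empty.\<close>
    case True
    then show ?thesis by (simp add: C2_def mixing_def weights_def)
  next
    case False
    then have k2: "2 \<le> k" using k by simp
    \<comment> \<open>Chosen so that n \<tau>^2 is D^2 k^2 log^2 n, which must dominate the
      logarithm of 1 / b.\<close>
    define \<tau> where "\<tau> = D * (real k * ln (real n) / sqrt (real n))"
    have D2: "2 \<le> D" using D pos by simp
    \<comment> \<open>The upper bounds on \<gamma> and \<omega> come from the truth itself: two
      atoms of [-L, L] are \<gamma>-separated, and no weight exceeds 1.\<close>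
    have "\<gamma> \<le> \<bar>\<theta> 1 - \<theta> 2\<bar>" using k2 by (intro sep) auto
    moreover have "\<theta> 1 \<in> {- L..L}" "\<theta> 2 \<in> {- L..L}" using \<theta> k2 by (auto simp: locations_def PiE_iff)
    ultimately have \<gamma>: "\<gamma> \<le> 2 * L" by auto
    have "\<omega> \<le> w 1" "w 1 \<le> 1" using w_ge[of 1] w k by (auto simp: weights_def PiE_iff)
    then have \<omega>: "\<omega> \<le> 1" by simp
    have "0 \<le> \<tau>" using D2 l by (simp add: \<tau>_def l_def)
    moreover have "4 * \<tau> \<le> exp (- real k / 2) * (\<omega> * (\<gamma> / (16 * (1 + L) * sqrt (real k))) ^ (2 * (k - 1)) / 2)"
      unfolding \<tau>_def using D2 by (intro rate_lower_bound[OF pos(1) _ M n2 k2 rate(1) \<gamma> rate(2) \<omega> rate(3)]) simp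
    ultimately obtain R where R: "R \<in> sets (\<Pi>\<^sub>M i\<in>{1..n}. borel)"
      and e1: "emeasure (sample n (gauss_mixture (atomic k w \<theta>))) R \<le> ennreal (8 * real k * exp (- real n * \<tau>\<^sup>2 / 2))"
      and e2: "\<And>\<nu>. \<nu> \<in> C2 \<Longrightarrow> emeasure (sample n (gauss_mixture \<nu>)) (space (\<Pi>\<^sub>M i\<in>{1..n}. borel) - R)
        \<le> ennreal (2 * exp (- real n * \<tau>\<^sup>2 / 2))"
      using component_number_test[where k = k and n = n and \<gamma> = \<gamma> and \<omega> = \<omega> and \<tau> = \<tau>, OF pos(1) k(1) _ rate(1,2) _ w \<theta> sep w_ge] n2
      unfolding C2_def by auto
    define q where "q = (real k)\<^sup>2 * l\<^sup>2"
    have k1: "1 \<le> real k" using k by simp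
    have kl: "1 \<le> real k * l" "l \<le> real k * l" "real k \<le> real k * l"
      using mult_mono[of 1 "real k" 1 l] mult_right_mono[OF k1, of l] mult_left_mono[OF l, of "real k"] k1 l by auto
    have "real k * l \<le> (real k * l) * (real k * l)"
      using mult_left_mono[OF kl(1), of "real k * l"] kl(1) by simp
    also have "\<dots> = q" by (simp add: q_def power2_eq_square)
    finally have klq: "real k * l \<le> q" .
    have q: "l \<le> q" "real k \<le> q" "0 \<le> q" using kl klq by linarith+
    have klq': "real k * l\<^sup>2 \<le> q"
      unfolding q_def using k1 by (intro mult_right_mono) (auto simp: power2_eq_square)
    have n\<tau>: "real n * \<tau>\<^sup>2 / 2 = D\<^sup>2 / 2 * q"
      using n_pos by (simp add: \<tau>_def q_def l_def power_mult_distrib power_divide)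
    have "2 * D \<le> D\<^sup>2" unfolding power2_eq_square using D2 by (intro mult_right_mono) auto
    then have n\<tau>_ge: "D * q \<le> real n * \<tau>\<^sup>2 / 2" unfolding n\<tau> using q(3) by (intro mult_right_mono) auto
    have e1_le: "8 * real k * exp (- real n * \<tau>\<^sup>2 / 2) \<le> 8 / real n"
    proof -
      have "2 * q \<le> D * q" using D2 q(3) by (intro mult_right_mono) auto
      then have "real k + l \<le> real n * \<tau>\<^sup>2 / 2" using q n\<tau>_ge by linarith
      then have "real k * exp (- real n * \<tau>\<^sup>2 / 2) \<le> exp (real k) * exp (- real k - l)"
      proof (intro mult_mono)
        show "real k \<le> exp (real k)" using exp_ge_add_one_self[of "real k"] by linarith
      qed auto
      also have "\<dots> = exp (- l)" by (simp flip: exp_add)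
      finally show ?thesis by (simp add: exp_l)
    qed
    have e2_le: "2 * exp (- real n * \<tau>\<^sup>2 / 2) / b \<le> 2 / (c2 * c4 * c6) / real n"
    proof -
      \<comment> \<open>Only kb = O(log n) is used at this point, so the lower bound on Pi(k) is at
        least c2 exp(-c3 C0 k log^2 n).\<close>
      have kb_le: "real kb \<le> C0 * l"
      proof -
        have "1 \<le> ln l" using n(2) by (simp add: l_def)
        moreover from this have "0 < ln l" by linarith
        ultimately have "C0 * l / ln l \<le> C0 * l"
          using mult_left_mono[of 1 "ln l" "C0 * l"] pos l by (simp add: pos_divide_le_eq del: ln_gt_zero_iff)
        then show ?thesis using k(3) by (simp add: l_def)
      qed
      have "c3 * real kb * l * real k \<le> c3 * (C0 * l) * l * real k"
        using kb_le pos l by (intro mult_right_mono mult_left_mono) auto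
      also have "\<dots> = c3 * C0 * (real k * l\<^sup>2)" by (simp add: power2_eq_square)
      also have "\<dots> \<le> c3 * C0 * q" using klq' pos by (intro mult_left_mono) auto
      finally have t1: "c3 * real kb * l * real k \<le> c3 * C0 * q" .
      have t2: "2 * (c5 + c7) * (real k * l) \<le> 2 * (c5 + c7) * q" using klq pos by (intro mult_left_mono) auto
      \<comment> \<open>The summands of \<open>D\<close> pay in turn for the prior mass of k, for
        the neighbourhood of the truth, and for the final factor 1 / n.\<close>
      have "c3 * C0 * q + 2 * (c5 + c7) * q + q \<le> D * q" unfolding D using q(3) by (simp add: algebra_simps)
      then have expo: "c3 * real kb * l * real k + 2 * (c5 + c7) * real k * l + l \<le> real n * \<tau>\<^sup>2 / 2"
        using t1 t2 q n\<tau>_ge by (simp add: mult.assoc)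
      have "c2 * exp (- (c3 * real kb * l * real k)) * (c4 * c6) * exp (- 2 * (c5 + c7) * real k * l) \<le> b"
        unfolding b_eq p_def using K_lower pos by (intro mult_right_mono) (auto simp: l_def)
      then have "2 * exp (- real n * \<tau>\<^sup>2 / 2) / b \<le> 2 * exp (- real n * \<tau>\<^sup>2 / 2)
          / (c2 * exp (- (c3 * real kb * l * real k)) * (c4 * c6) * exp (- 2 * (c5 + c7) * real k * l))"
        using pos b by (intro divide_left_mono mult_pos_pos) auto
      also have "\<dots> = 2 / (c2 * c4 * c6)
          * exp (- (real n * \<tau>\<^sup>2 / 2) + c3 * real kb * l * real k + 2 * (c5 + c7) * real k * l)"
      proof -
        have "2 * exp (- t) / (c2 * exp (- x) * (c4 * c6) * exp (- y)) = 2 / (c2 * c4 * c6) * exp (- t + x + y)"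
          for t x y :: real
          unfolding exp_add exp_minus by (simp add: divide_inverse)
        moreover have "- 2 * (c5 + c7) * real k * l = - (2 * (c5 + c7) * real k * l)"
          by (simp only: minus_mult_left)
        ultimately show ?thesis by (simp only: minus_mult_left[symmetric] minus_divide_left[symmetric])
      qed
      also have "\<dots> \<le> 2 / (c2 * c4 * c6) * exp (- l)"
        using expo pos by (intro mult_left_mono) auto
      finally show ?thesis by (simp add: exp_l)
    qed
    have "(\<integral>\<^sup>+ x. emeasure (posterior n Q x) C2 \<partial>sample n (gauss_mixture \<nu>))
        \<le> ennreal (8 * real k * exp (- real n * \<tau>\<^sup>2 / 2)) + ennreal (real n * (3 * \<eta>))
          + ennreal (2 * exp (- real n * \<tau>\<^sup>2 / 2) / b) * emeasure Q C2"
      unfolding Q_def \<nu>_eq by (rule nn_integral_posterior_le[OF pd k(1) w b b_le C(2) R e1 e2])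
    also have "\<dots> \<le> ennreal (8 / real n) + ennreal (3 / real n) + ennreal (2 / (c2 * c4 * c6) / real n) * 1"
      using e1_le e2_le by (intro add_mono mult_mono ennreal_leI) (auto simp: n\<eta> Q.emeasure_le_1)
    also have "\<dots> = ennreal ((11 + 2 / (c2 * c4 * c6)) / real n)"
      using pos n_pos by (simp add: add_divide_distrib flip: ennreal_plus)
    finally show ?thesis .
  qed

  moreover have "space (mixing_space L) \<subseteq> (mixing L k - mixing L (k - 1)) \<union> C1 \<union> C2"
    by (auto simp: C1_def C2_def)
  moreover have "mixing L k - mixing L (k - 1) \<in> sets (mixing_space L)" using S by auto
  moreover have "prob_space \<nu>" "sets \<nu> = sets borel"
    unfolding \<nu>_eq using prob_space_atomic[OF w] by auto
  ultimately have "1 \<le> (\<integral>\<^sup>+ x. emeasure (posterior n Q x) (mixing L k - mixing L (k - 1)) \<partial>sample n (gauss_mixture \<nu>))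
    + (ennreal ((3 + 2 * c1 / (c4 * c6)) / real n) + ennreal ((11 + 2 / (c2 * c4 * c6)) / real n))"
    using C by (intro nn_integral_posterior_ge[OF Q, where C = C1 and D = C2])
  \<comment> \<open>The 14 consists of 3 for each exchange of the truth for its neighbours and 8 for
    the error of the test under the truth.\<close>
  also have "ennreal ((3 + 2 * c1 / (c4 * c6)) / real n) + ennreal ((11 + 2 / (c2 * c4 * c6)) / real n)
      = ennreal ((14 + 2 * c1 / (c4 * c6) + 2 / (c2 * c4 * c6)) / real n)"
    using pos n_pos by (simp flip: ennreal_plus) (simp add: add_divide_distrib)
  finally show ?thesis unfolding Q_def .
qed

text \<open>The infimum inherits the finite-sample bound, whose error c / n does not involve the
  truth, k, \<gamma> or \<omega>. If the class is empty the infimum is infinite, and the cap at 1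
  gives the value 1.\<close>

theorem theorem2p6:
  fixes L c4 c5 c6 c7 \<eta>0 :: real
  assumes "L > 0" and "c4 > 0" and "c5 > 0" and "c6 > 0" and "c7 > 0" and "0 < \<eta>0" and "\<eta>0 < 1"
  shows "\<exists>A0>0. \<forall>(C0::real) (kbar :: nat \<Rightarrow> nat) (c1::real) (A::real) (c2::real) (c3::real)
      (K :: nat \<Rightarrow> nat measure)
      (W :: nat \<Rightarrow> nat \<Rightarrow> (nat \<Rightarrow> real) measure)
      (T :: nat \<Rightarrow> nat \<Rightarrow> (nat \<Rightarrow> real) measure).
    C0 > 0 \<and> (\<forall>n\<ge>1. kbar n \<ge> 1) \<and>
    (\<forall>n\<ge>3. real (kbar n) \<le> C0 * ln (real n) / ln (ln (real n))) \<and>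
    (\<forall>n\<ge>1. prior_data L (K n) (W n) (T n)) \<and>
    c1 > 0 \<and> A > 0 \<and> c2 > 0 \<and> c3 > 0 \<and> P1 kbar K c1 A c2 c3 \<and>
    P2 W c4 c5 \<and> P3 L T c6 c7 \<eta>0 \<and> A \<ge> A0 \<longrightarrow>
    (\<exists>M'>0. \<forall>(kstar :: nat \<Rightarrow> nat) (\<gamma> :: nat \<Rightarrow> real) (\<omega> :: nat \<Rightarrow> real).
      (\<forall>n\<ge>1. 1 \<le> kstar n \<and> kstar n \<le> kbar n \<and> \<gamma> n > 0 \<and> \<omega> n > 0 \<and>
        \<gamma> n * \<omega> n > M' * max (eps_bar n (kstar n)) (eps_sep n (kstar n) (\<gamma> n))) \<longrightarrow>
      (\<lambda>n. min 1 (INF \<nu>star \<in> mixing_sep L (kstar n) (kstar n) (\<gamma> n) (\<omega> n).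
          \<integral>\<^sup>+ x. emeasure (posterior n (prior L (K n) (W n) (T n)) x)
                    (mixing L (kstar n) - mixing L (kstar n - 1))
            \<partial>sample n (gauss_mixture \<nu>star)))
        \<longlonglongrightarrow> 1)"
proof (rule exI[of _ "2 * (c5 + c7) + 1"], intro conjI allI impI)
  fix C0 c1 A c2 c3 :: real and kbar :: "nat \<Rightarrow> nat" and K :: "nat \<Rightarrow> nat measure"
    and W T :: "nat \<Rightarrow> nat \<Rightarrow> (nat \<Rightarrow> real) measure"
  assume "C0 > 0 \<and> (\<forall>n\<ge>1. kbar n \<ge> 1) \<and>
    (\<forall>n\<ge>3. real (kbar n) \<le> C0 * ln (real n) / ln (ln (real n))) \<and>
    (\<forall>n\<ge>1. prior_data L (K n) (W n) (T n)) \<and>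
    c1 > 0 \<and> A > 0 \<and> c2 > 0 \<and> c3 > 0 \<and> P1 kbar K c1 A c2 c3 \<and>
    P2 W c4 c5 \<and> P3 L T c6 c7 \<eta>0 \<and> A \<ge> 2 * (c5 + c7) + 1"
  then have pos: "C0 > 0" "c1 > 0" "c2 > 0" "c3 > 0"
    and kbar: "\<And>n. n \<ge> 3 \<Longrightarrow> real (kbar n) \<le> C0 * ln (real n) / ln (ln (real n))"
    and pd: "\<And>n. n \<ge> 1 \<Longrightarrow> prior_data L (K n) (W n) (T n)"
    and P1: "P1 kbar K c1 A c2 c3" and P2: "P2 W c4 c5" and P3: "P3 L T c6 c7 \<eta>0"
    and A: "2 * (c5 + c7) + 1 \<le> A" by blast+
  define D where "D = c3 * C0 + 2 * (c5 + c7) + 2"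
  define M where "M = 48 * L * D + 768 * (1 + L)\<^sup>2 + 1"
  have "0 < D" using pos assms by (simp add: D_def add_pos_pos)
  then have M: "0 < M" using assms by (simp add: M_def add_pos_pos add_nonneg_pos)
  show "\<exists>M'>0. \<forall>(kstar :: nat \<Rightarrow> nat) (\<gamma> :: nat \<Rightarrow> real) (\<omega> :: nat \<Rightarrow> real).
      (\<forall>n\<ge>1. 1 \<le> kstar n \<and> kstar n \<le> kbar n \<and> \<gamma> n > 0 \<and> \<omega> n > 0 \<and>
        \<gamma> n * \<omega> n > M' * max (eps_bar n (kstar n)) (eps_sep n (kstar n) (\<gamma> n))) \<longrightarrow>
      (\<lambda>n. min 1 (INF \<nu>star \<in> mixing_sep L (kstar n) (kstar n) (\<gamma> n) (\<omega> n).
          \<integral>\<^sup>+ x. emeasure (posterior n (prior L (K n) (W n) (T n)) x)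
                    (mixing L (kstar n) - mixing L (kstar n - 1))
            \<partial>sample n (gauss_mixture \<nu>star)))
        \<longlonglongrightarrow> 1"
  proof (rule exI[of _ M], intro conjI M allI impI)
    fix kstar :: "nat \<Rightarrow> nat" and \<gamma> \<omega> :: "nat \<Rightarrow> real"
    assume hyp: "\<forall>n\<ge>1. 1 \<le> kstar n \<and> kstar n \<le> kbar n \<and> \<gamma> n > 0 \<and> \<omega> n > 0 \<and>
        \<gamma> n * \<omega> n > M * max (eps_bar n (kstar n)) (eps_sep n (kstar n) (\<gamma> n))"
    define I where "I n = (INF \<nu>star \<in> mixing_sep L (kstar n) (kstar n) (\<gamma> n) (\<omega> n).
          \<integral>\<^sup>+ x. emeasure (posterior n (prior L (K n) (W n) (T n)) x)
                    (mixing L (kstar n) - mixing L (kstar n - 1))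
            \<partial>sample n (gauss_mixture \<nu>star))" for n
    define c where "c = 14 + 2 * c1 / (c4 * c6) + 2 / (c2 * c4 * c6)"
    have "\<forall>\<^sub>F n in sequentially. 1 \<le> ln (real n)" by real_asymp
    moreover have "\<forall>\<^sub>F n in sequentially. 1 \<le> ln (ln (real n))" by real_asymp
    moreover have "\<forall>\<^sub>F n in sequentially. c1 / real n \<le> 1 / 2" by real_asymp
    moreover have "\<forall>\<^sub>F n in sequentially. 1 / (real n)\<^sup>2 < \<eta>0" using \<open>0 < \<eta>0\<close> by real_asymp
    moreover have "\<forall>\<^sub>F n in sequentially. C0 * ln (real n) / ln (ln (real n)) < (real n)\<^sup>2"
      using \<open>0 < C0\<close> by real_asymp
    moreover have "\<forall>\<^sub>F n in sequentially. (3::nat) \<le> n" by (rule eventually_ge_at_top)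
    ultimately have lower: "\<forall>\<^sub>F n in sequentially. 1 - ennreal (c / real n) \<le> min 1 (I n)"
    proof eventually_elim
      case (elim n)
      note h = hyp[rule_format, of n]
      have n1: "1 \<le> n" using elim by simp
      have "M * eps_bar n (kstar n) \<le> M * max (eps_bar n (kstar n)) (eps_sep n (kstar n) (\<gamma> n))"
        using M by (intro mult_left_mono) auto
      then have rate: "M * eps_bar n (kstar n) < \<gamma> n * \<omega> n" using h[OF n1] by linarith
      have "1 - ennreal (c / real n) \<le> (\<integral>\<^sup>+ x. emeasure (posterior n (prior L (K n) (W n) (T n)) x)
          (mixing L (kstar n) - mixing L (kstar n - 1)) \<partial>sample n (gauss_mixture \<nu>))"
        if "\<nu> \<in> mixing_sep L (kstar n) (kstar n) (\<gamma> n) (\<omega> n)" for \<nu>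
      proof -
        have "1 \<le> (\<integral>\<^sup>+ x. emeasure (posterior n (prior L (K n) (W n) (T n)) x)
          (mixing L (kstar n) - mixing L (kstar n - 1)) \<partial>sample n (gauss_mixture \<nu>)) + ennreal (c / real n)"
          unfolding c_def
        proof (rule posterior_component_number_bound[where ?C0.0 = C0 and kb = "kbar n" and \<gamma> = "\<gamma> n" and \<omega> = "\<omega> n"])
          \<comment> \<open>This makes the radius n^-2 smaller than 1 / kstar, the range in which
            (P2) applies.\<close>
          show "real (kbar n) < (real n)\<^sup>2" using kbar[of n] elim by linarith
          show "measure (K n) {j + 1} \<le> c1 * exp (- A * real (kbar n) * ln (real n)) * measure (K n) {j}" if "1 \<le> j" for j
            using P1 n1 that unfolding P1_def by blast
          show "c2 * exp (- (c3 * real (kbar n) * ln (real n)) * real (kstar n)) \<le> measure (K n) {kstar n}"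
            using P1 n1 h unfolding P1_def by auto
          show "c4 * \<eta> powr (c5 * real (kstar n))
              \<le> measure (W n (kstar n)) {v \<in> space (W n (kstar n)). (\<Sum>j\<in>{1..kstar n}. \<bar>v j - w j\<bar>) \<le> \<eta>}"
            if "w \<in> weights (kstar n)" "0 < \<eta>" "\<eta> < 1 / real (kstar n)" for w \<eta>
            using P2 n1 h that unfolding P2_def by simp
          show "c6 * \<eta> powr (c7 * real (kstar n))
              \<le> measure (T n (kstar n)) {r \<in> space (T n (kstar n)). (MAX j\<in>{1..kstar n}. \<bar>r j - \<theta> j\<bar>) \<le> \<eta>}"
            if "\<theta> \<in> locations L (kstar n)" "0 < \<eta>" "\<eta> < \<eta>0" for \<theta> \<eta>
            using P3 n1 h that unfolding P3_def by simp
        qed (use assms pos elim n1 h pd kbar A rate that in \<open>auto simp: D_def M_def\<close>)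
        then show ?thesis by (subst ennreal_minus_le_iff) (auto simp: add.commute)
      qed
      then have "1 - ennreal (c / real n) \<le> I n" unfolding I_def by (intro INF_greatest)
      then show ?case by (simp add: diff_le_self_ennreal)
    qed
    have "(\<lambda>n. c / real n) \<longlonglongrightarrow> 0" by real_asymp
    then have "(\<lambda>n. 1 - ennreal (c / real n)) \<longlonglongrightarrow> 1 - ennreal 0"
      by (intro tendsto_diff_ennreal tendsto_const tendsto_ennrealI) auto
    then have limit: "(\<lambda>n. 1 - ennreal (c / real n)) \<longlonglongrightarrow> 1" by simp
    \<comment> \<open>The cap supplies the upper half of the sandwich.\<close>
    have "(\<lambda>n. min 1 (I n)) \<longlonglongrightarrow> 1"
      by (rule tendsto_sandwich[OF lower _ limit tendsto_const]) simp
    then show "(\<lambda>n. min 1 (INF \<nu>star \<in> mixing_sep L (kstar n) (kstar n) (\<gamma> n) (\<omega> n).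
          \<integral>\<^sup>+ x. emeasure (posterior n (prior L (K n) (W n) (T n)) x)
                    (mixing L (kstar n) - mixing L (kstar n - 1))
            \<partial>sample n (gauss_mixture \<nu>star))) \<longlonglongrightarrow> 1"
      unfolding I_def .
  qed
qed (use assms in simp)

end
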